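(* Let $\mathcal{A}$ be a cluster algebra of type $\mathrm{C}_n$ with an initial cluster $\mathrm{x}_0=\{x_1,\dots,x_n\}$. Let $x$ be a non-initial cluster variable with denominator vector $\operatorname{den}(x)=(d_1,\dots,d_n)^{\mathrm{tr}}\in\mathbb{Z}^n$ (with respect to $\mathrm{x}_0$). Then (1) all components $d_i$ are non-negative; (2) $d_i=0$ if and only if there is a cluster containing both $x$ and $x_i$; (3) each component $d_i$ depends only on the cluster variables $x$ and $x_i$ (and not on the other elements of the initial cluster containing $x_i$).
   Context: Write $[x]_+=\max\{x,0\}$ and $\operatorname{sgn}(x)\in\{-1,0,1\}$ for the sign. Let $m\ge n\geq 1$, let $\mathbb{P}$ be the tropical semifield on variables $x_{n+1},\dots,x_m$ (as a group, the free abelian multiplicative group on these variables), and let $\mathcal{F}$ be the field of rational functions in $n$ variables with coefficients in the group algebra $\mathbb{Q}\mathbb{P}$. A seed is a pair $(\tilde B,\mathrm{x})$ where $\tilde B=(b_{ij})$ is an $m\times n$ integer matrix whose principal part $B$ (top $n\times n$ submatrix) is skew-symmetrizable and $\mathrm{x}=\{x_1,\dots,x_n\}$ is a free generating set of $\mathcal{F}$. For $1\le k\le n$, the mutation $\mu_k(\tilde B,\mathrm{x})=(\tilde B',\mathrm{x}')$ is given by $b'_{ij}=-b_{ij}$ if $i=k$ or $j=k$ and $b'_{ij}=b_{ij}+\operatorname{sgn}(b_{ik})[b_{ik}b_{kj}]_+$ otherwise, and $\mathrm{x}'$ is obtained from $\mathrm{x}$ by replacing $x_k$ with $x_k'=\frac{1}{x_k}\big(\prod_{i=1}^m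 x_i^{[b_{ik}]_+}+\prod_{i=1}^m x_i^{[-b_{ik}]_+}\big)$. Starting from an initial seed, the clusters are the sets $\mathrm{x}_t$ in all seeds obtained by iterated mutations; cluster variables are the elements of the clusters; the cluster algebra is the $\mathbb{Z}\mathbb{P}$-subalgebra of $\mathcal{F}$ generated by the cluster variables. The Cartan counterpart of a skew-symmetrizable $B=(b_{ij})$ is $A(B)=(c_{ij})$ with $c_{ii}=2$ and $c_{ij}=-|b_{ij}|$ for $i\ne j$. The cluster algebra is of type $\mathrm{C}_n$ if some seed in its mutation class has exchange matrix whose principal part has Cartan counterpart equal, up to simultaneous permutation of rows and columns, to the Cartan matrix of type $\mathrm{C}_n$ ($c_{ii}=2$, $c_{i,i+1}=c_{i+1,i}=-1$ except $c_{n-1,n}=-2$, all other entries $0$). Denominator vectors: by the Laurent phenomenon, each cluster variable $x$ can be written uniquely as $x=\frac{f(x_1,\dots,x_n)}{x_1^{d_1}\cdots x_n^{d_n}}$ with $x_1,\dots,x_n$ the initial cluster variables, $f$ a polynomial in $x_1,\dots,x_n$ not divisible by any $x_i$ and $d_i\in\mathbb{Z}$; then $\operatorname{den}(x)=(d_1,\dots,d_n)^{\mathrm{tr}}$. Any cluster may serve as initial cluster. *)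

theory Defs
  imports Complex_Main "HOL-Library.Poly_Mapping" "HOL-Combinatorics.Permutations"
begin

text \<open>
  Conventions: \<open>n\<close> is the rank, \<open>m \<ge> n\<close> the number of cluster and frozen variables together,
  and all indices start at 1.  An extended exchange matrix is a function \<open>B\<close> of which only the
  entries \<open>B i j\<close> with \<open>1 \<le> i \<le> m\<close>, \<open>1 \<le> j \<le> n\<close> matter, and the variables are given by a
  function \<open>x\<close> of which only the values at \<open>1, \<dots>, m\<close> matter: \<open>x 1, \<dots>, x n\<close> is the
  cluster and \<open>x (n+1), \<dots>, x m\<close> are the frozen variables.  The ambient field \<open>\<F>\<close> is the
  whole type \<open>'f\<close>.
\<close>

type_synonym 'f seed = "(nat \<Rightarrow> nat \<Rightarrow> int) \<times> (nat \<Rightarrow> 'f)"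


section \<open>The coefficient ring and the ambient field\<close>

text \<open>
  An element of the free abelian group on the frozen variables is encoded by its exponent
  vector, of type \<open>nat \<Rightarrow>\<^sub>0 int\<close> and supported on \<open>{n+1..m}\<close>; its rational group algebra
  consists of finitely supported rational combinations of such exponent vectors.
\<close>

definition group_algebra :: "nat \<Rightarrow> nat \<Rightarrow> ((nat \<Rightarrow>\<^sub>0 int) \<Rightarrow>\<^sub>0 rat) set" where
  "group_algebra n m = {p. \<forall>a\<in>Poly_Mapping.keys p. Poly_Mapping.keys a \<subseteq> {n+1..m}}"

definition laurent_eval :: "(nat \<Rightarrow> 'f::field_char_0) \<Rightarrow> ((nat \<Rightarrow>\<^sub>0 int) \<Rightarrow>\<^sub>0 rat) \<Rightarrow> 'f" where
  "laurent_eval x p =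
     (\<Sum>a\<in>Poly_Mapping.keys p. of_rat (Poly_Mapping.lookup p a) * (\<Prod>j\<in>Poly_Mapping.keys a. x j powi Poly_Mapping.lookup a j))"

text \<open>The copy of \<open>\<rat>\<P>\<close> inside \<open>\<F>\<close>.\<close>

definition QP :: "nat \<Rightarrow> nat \<Rightarrow> (nat \<Rightarrow> 'f::field_char_0) \<Rightarrow> 'f set" where
  "QP n m x = laurent_eval x ` group_algebra n m"

text \<open>Polynomials in the variables \<open>1, \<dots>, n\<close> with coefficients in a subset \<open>R\<close>.\<close>

definition polynomials :: "nat \<Rightarrow> 'f::field_char_0 set \<Rightarrow> ((nat \<Rightarrow>\<^sub>0 nat) \<Rightarrow>\<^sub>0 'f) set" where
  "polynomials n R = {f. \<forall>a\<in>Poly_Mapping.keys f. Poly_Mapping.keys a \<subseteq> {1..n} \<and> Poly_Mapping.lookup f a \<in> R}"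

definition poly_var :: "nat \<Rightarrow> ((nat \<Rightarrow>\<^sub>0 nat) \<Rightarrow>\<^sub>0 'f::field_char_0)" where
  "poly_var i = Poly_Mapping.single (Poly_Mapping.single i 1) 1"

definition poly_eval :: "(nat \<Rightarrow> 'f::field_char_0) \<Rightarrow> ((nat \<Rightarrow>\<^sub>0 nat) \<Rightarrow>\<^sub>0 'f) \<Rightarrow> 'f" where
  "poly_eval x f = (\<Sum>a\<in>Poly_Mapping.keys f. Poly_Mapping.lookup f a * (\<Prod>i\<in>Poly_Mapping.keys a. x i ^ Poly_Mapping.lookup a i))"

text \<open>
  The first conjunct says that \<open>\<rat>\<P>\<close> embeds into \<open>\<F>\<close>, the second that \<open>x 1, \<dots>, x n\<close> are
  algebraically independent over \<open>\<rat>\<P>\<close>, the third that they generate \<open>\<F>\<close> as a field over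
  \<open>\<rat>\<P>\<close>.  Together they also say that \<open>\<F>\<close> is a field of rational functions in \<open>n\<close> variables
  over \<open>\<rat>\<P>\<close>.
\<close>

definition free_generating :: "nat \<Rightarrow> nat \<Rightarrow> (nat \<Rightarrow> 'f::field_char_0) \<Rightarrow> bool" where
  "free_generating n m x \<longleftrightarrow>
     inj_on (laurent_eval x) (group_algebra n m) \<and>
     (\<forall>f\<in>polynomials n (QP n m x). poly_eval x f = 0 \<longrightarrow> f = 0) \<and>
     (\<forall>z. \<exists>f\<in>polynomials n (QP n m x). \<exists>g\<in>polynomials n (QP n m x).
        poly_eval x g \<noteq> 0 \<and> z = poly_eval x f / poly_eval x g)"


section \<open>Seeds and mutations\<close>

definition skew_symmetrizable :: "nat \<Rightarrow> (nat \<Rightarrow> nat \<Rightarrow> int) \<Rightarrow> bool" where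
  "skew_symmetrizable n B \<longleftrightarrow>
     (\<exists>d :: nat \<Rightarrow> int. (\<forall>i\<in>{1..n}. 0 < d i) \<and>
        (\<forall>i\<in>{1..n}. \<forall>j\<in>{1..n}. d i * B i j = - (d j * B j i)))"

definition is_seed :: "nat \<Rightarrow> nat \<Rightarrow> 'f::field_char_0 seed \<Rightarrow> bool" where
  "is_seed n m S \<longleftrightarrow> skew_symmetrizable n (fst S) \<and> free_generating n m (snd S)"

definition mutate_matrix :: "nat \<Rightarrow> (nat \<Rightarrow> nat \<Rightarrow> int) \<Rightarrow> (nat \<Rightarrow> nat \<Rightarrow> int)" where
  "mutate_matrix k B = (\<lambda>i j.
     if i = k \<or> j = k then - B i j
     else B i j + sgn (B i k) * max (B i k * B k j) 0)"

text \<open>The truncation \<open>nat\<close> realises the exponents \<open>max b 0\<close> and \<open>max (- b) 0\<close>.\<close>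

definition mutate_variables ::
    "nat \<Rightarrow> nat \<Rightarrow> (nat \<Rightarrow> nat \<Rightarrow> int) \<Rightarrow> (nat \<Rightarrow> 'f::field_char_0) \<Rightarrow> (nat \<Rightarrow> 'f)" where
  "mutate_variables m k B x =
     x(k := 1 / x k * ((\<Prod>i=1..m. x i ^ nat (B i k)) + (\<Prod>i=1..m. x i ^ nat (- B i k))))"

definition mutate :: "nat \<Rightarrow> nat \<Rightarrow> 'f::field_char_0 seed \<Rightarrow> 'f seed" where
  "mutate m k S = (mutate_matrix k (fst S), mutate_variables m k (fst S) (snd S))"

inductive_set mutation_class :: "nat \<Rightarrow> nat \<Rightarrow> 'f::field_char_0 seed \<Rightarrow> 'f seed set"
  for n m :: nat and S\<^sub>0 :: "'f::field_char_0 seed" where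
  initial: "S\<^sub>0 \<in> mutation_class n m S\<^sub>0"
| step: "S \<in> mutation_class n m S\<^sub>0 \<Longrightarrow> k \<in> {1..n} \<Longrightarrow> mutate m k S \<in> mutation_class n m S\<^sub>0"

definition cluster :: "nat \<Rightarrow> 'f::field_char_0 seed \<Rightarrow> 'f set" where
  "cluster n S = snd S ` {1..n}"

definition clusters :: "nat \<Rightarrow> nat \<Rightarrow> 'f::field_char_0 seed \<Rightarrow> 'f set set" where
  "clusters n m S\<^sub>0 = cluster n ` mutation_class n m S\<^sub>0"

definition cluster_variables :: "nat \<Rightarrow> nat \<Rightarrow> 'f::field_char_0 seed \<Rightarrow> 'f set" where
  "cluster_variables n m S\<^sub>0 = \<Union> (clusters n m S\<^sub>0)"


section \<open>Type C\<close>

definition cartan_counterpart :: "(nat \<Rightarrow> nat \<Rightarrow> int) \<Rightarrow> (nat \<Rightarrow> nat \<Rightarrow> int)" where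
  "cartan_counterpart B = (\<lambda>i j. if i = j then 2 else - \<bar>B i j\<bar>)"

definition cartan_matrix_C :: "nat \<Rightarrow> (nat \<Rightarrow> nat \<Rightarrow> int)" where
  "cartan_matrix_C n = (\<lambda>i j.
     if i = j then 2
     else if i + 1 = n \<and> j = n then - 2
     else if i + 1 = j \<or> j + 1 = i then - 1
     else 0)"

definition is_type_C :: "nat \<Rightarrow> nat \<Rightarrow> 'f::field_char_0 seed \<Rightarrow> bool" where
  "is_type_C n m S\<^sub>0 \<longleftrightarrow>
     (\<exists>S\<in>mutation_class n m S\<^sub>0. \<exists>p. p permutes {1..n} \<and>
        (\<forall>i\<in>{1..n}. \<forall>j\<in>{1..n}.
           cartan_counterpart (fst S) (p i) (p j) = cartan_matrix_C n i j))"


section \<open>Denominator vectors\<close>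

text \<open>
  A vector in \<open>\<int>\<^sup>n\<close> is a function that vanishes outside \<open>{1..n}\<close>; this makes the vector
  determined by \<open>is_denominator\<close> unique as a function.  Divisibility is divisibility of formal
  polynomials, and a quotient by a variable has the same coefficients as the dividend.
\<close>

definition is_denominator ::
    "nat \<Rightarrow> nat \<Rightarrow> (nat \<Rightarrow> 'f::field_char_0) \<Rightarrow> 'f \<Rightarrow> (nat \<Rightarrow> int) \<Rightarrow> bool" where
  "is_denominator n m x z d \<longleftrightarrow>
     (\<forall>i. i \<notin> {1..n} \<longrightarrow> d i = 0) \<and>
     (\<exists>f\<in>polynomials n (QP n m x).
        (\<forall>i\<in>{1..n}. \<not> poly_var i dvd f) \<and>
        z = poly_eval x f / (\<Prod>i=1..n. x i powi d i))"

definition den :: "nat \<Rightarrow> nat \<Rightarrow> (nat \<Rightarrow> 'f::field_char_0) \<Rightarrow> 'f \<Rightarrow> (nat \<Rightarrow> int)" where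
  "den n m x z = (THE d. is_denominator n m x z d)"

end

theory Submission
  imports Defs
begin

text \<open>
  Type \<open>C\<^sub>n\<close> is governed by the regular polygon with \<open>2N\<close> vertices, \<open>N = n + 1\<close>, and its
  triangulations that are symmetric under the half turn. Number the vertices modulo \<open>2N\<close>; the half
  turn is \<open>i \<mapsto> i + N\<close>. An orbit of diagonals is then an interval \<open>[i, j]\<close> of natural numbers with
  \<open>2 \<le> j - i \<le> N\<close>, taken modulo simultaneous shifts of its ends by \<open>N\<close>; the intervals of length
  \<open>N\<close> are the diameters. A symmetric triangulation contains exactly one diameter \<open>[r, r + N]\<close>, and
  what lies on one side of it is a binary tree with \<open>N\<close> leaves, whose inner nodes are the \<open>n\<close>
  orbits of diagonals. So a labelled triangulation is a number \<open>r\<close> together with a binary tree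
  whose inner nodes carry the labels \<open>1, \<dots>, n\<close>. A flip at a node other than the root is a rotation
  of the tree; the flip of the diameter interchanges the two subtrees of the root and moves \<open>r\<close> to
  the splitting point (\<open>realizes_rot\<close>, \<open>realizes_root_flip\<close>). In a seed whose Cartan counterpart
  has type \<open>C\<^sub>n\<close> the exchange matrix is that of a tree which is a path, and rotations turn this
  tree into a comb.

  The decisive point is that a cluster variable depends only on its interval and not on the
  mutations that lead to it, whatever the coefficients are. Starting from a seed whose tree is a
  comb one writes down vectors \<open>v\<^sub>i\<close> in a plane over the field with \<open>v\<^bsub>i+N\<^esub> = R v\<^sub>i\<close> for a fixed
  matrix \<open>R\<close> and puts \<open>X i j = det (v\<^sub>i, v\<^sub>j)\<close>. The Plucker relation between these determinants is
  the Ptolemy relation of the polygon without coefficients. All \<open>X i j\<close> are Laurent polynomials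
  with positive coefficients, so for each frozen variable the smallest exponent is a well defined
  number, additive on products and turning sums into minima; its negative \<open>E\<close> therefore satisfies
  the tropical Ptolemy relations. Dividing \<open>X i j\<close> by the corresponding frozen monomial gives
  \<open>\<Phi> i j\<close>. The exchange relations of \<open>\<Phi>\<close> have exactly the coefficients that the rows of frozen
  variables prescribe, because these rows are the shear coordinates of \<open>E\<close>, and shear coordinates
  of a function with tropical Ptolemy relations mutate like rows of an exchange matrix
  (\<open>frozen_row_rot\<close>, \<open>frozen_row_root_flip\<close>). Hence every seed of the mutation class has the
  cluster variables \<open>\<Phi>\<close> of the intervals of some tree.

  Now fix one seed, that is, one triangulation. Every \<open>\<Phi> i j\<close> is computed from it by Ptolemy
  relations in which only the diagonals of the triangulation occur as divisors (\<open>inside_laurent\<close>,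
  \<open>straddle_laurent\<close>). So \<open>\<Phi> i j\<close> is a Laurent polynomial with positive coefficients, and the
  negative of its smallest exponents, which is its denominator vector, obeys the tropical
  relations as well. So does the number of crossings with a fixed diagonal, counted as \<open>-1\<close> for
  the diagonal itself. Both have the same values on the triangulation, and therefore the component
  of the denominator vector at a diagonal is the number of crossings with that diagonal
  (\<open>den_compat_degree\<close>). This number is intrinsic to the two diagonals, it is nonnegative for
  different diagonals, and it is zero exactly if both lie in a common triangulation
  (\<open>compatible_tree\<close>); all triangulations are reached by flips (\<open>reached_all\<close>). Finally, different
  diagonals have different cluster variables, because their denominator vectors differ
  (\<open>Phi_inj\<close>), so that everything can be said in terms of cluster variables.
\<close>

section \<open>Laurent polynomials and algebraic independence\<close>

abbreviation lookup where "lookup \<equiv> Poly_Mapping.lookup"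
abbreviation keys where "keys \<equiv> Poly_Mapping.keys"
abbreviation single where "single \<equiv> Poly_Mapping.single"

definition laurent_monomial :: "(nat \<Rightarrow> 'f::field_char_0) \<Rightarrow> (nat \<Rightarrow>\<^sub>0 int) \<Rightarrow> 'f" where
  "laurent_monomial x a = (\<Prod>j\<in>keys a. x j powi lookup a j)"

lemma laurent_monomial_superset:
  assumes "finite S" "keys a \<subseteq> S"
  shows "laurent_monomial x a = (\<Prod>j\<in>S. x j powi lookup a j)"
  unfolding laurent_monomial_def using assms
  by (intro prod.mono_neutral_left) (auto simp: in_keys_iff)

lemma laurent_monomial_0 [simp]: "laurent_monomial x 0 = 1"
  by (simp add: laurent_monomial_def)

lemma laurent_monomial_add:
  assumes "\<forall>j\<in>keys a \<union> keys b. x j \<noteq> 0"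
  shows "laurent_monomial x (a + b) = laurent_monomial x a * laurent_monomial x b"
proof -
  let ?S = "keys a \<union> keys b"
  have "laurent_monomial x (a + b) = (\<Prod>j\<in>?S. x j powi lookup (a + b) j)"
    by (intro laurent_monomial_superset) (auto simp: Poly_Mapping.keys_add)
  also have "\<dots> = (\<Prod>j\<in>?S. x j powi lookup a j * x j powi lookup b j)"
    using assms by (intro prod.cong refl) (simp add: lookup_add power_int_add)
  also have "\<dots> = laurent_monomial x a * laurent_monomial x b"
    by (simp add: prod.distrib laurent_monomial_superset[of ?S])
  finally show ?thesis .
qed

lemma laurent_monomial_nonzero:
  assumes "\<forall>j\<in>keys a. x j \<noteq> 0"
  shows "laurent_monomial x a \<noteq> 0"
  using assms by (auto simp: laurent_monomial_def)

lemma laurent_monomial_single [simp]: "laurent_monomial x (single j e) = x j powi e"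
  by (simp add: laurent_monomial_def)

lemma laurent_monomial_cong: "(\<And>j. j \<in> keys a \<Longrightarrow> x j = y j) \<Longrightarrow> laurent_monomial x a = laurent_monomial y a"
  by (auto simp: laurent_monomial_def)

inductive_set laurent_ring :: "(nat \<Rightarrow> 'f::field_char_0) \<Rightarrow> nat set \<Rightarrow> 'f set"
  for x W where
  monomial: "keys a \<subseteq> W \<Longrightarrow> of_rat c * laurent_monomial x a \<in> laurent_ring x W"
| add: "\<lbrakk>z \<in> laurent_ring x W; w \<in> laurent_ring x W\<rbrakk> \<Longrightarrow> z + w \<in> laurent_ring x W"

text \<open>
  Equal monomials are collected, so that the inductive description of the ring gives sums over a
  set of exponent vectors, to which linear independence of monomials applies.
\<close>

lemma laurent_ring_normal_form:
  assumes "z \<in> laurent_ring x W"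
  shows "\<exists>A c. finite A \<and> (\<forall>a\<in>A. keys a \<subseteq> W) \<and> z = (\<Sum>a\<in>A. of_rat (c a) * laurent_monomial x a)"
  using assms
proof induction
  case (monomial a c)
  then show ?case by (intro exI[of _ "{a}"] exI[of _ "\<lambda>_. c"]) auto
next
  case (add z w)
  obtain A c where 1: "finite A" "\<forall>a\<in>A. keys a \<subseteq> W"
      "z = (\<Sum>a\<in>A. of_rat (c a) * laurent_monomial x a)"
    using add.IH(1) by (elim exE conjE) (rule that)
  obtain B d where 2: "finite B" "\<forall>a\<in>B. keys a \<subseteq> W"
      "w = (\<Sum>a\<in>B. of_rat (d a) * laurent_monomial x a)"
    using add.IH(2) by (elim exE conjE) (rule that)
  note * = 1 2
  have "z = (\<Sum>a\<in>A\<union>B. of_rat (if a \<in> A then c a else 0) * laurent_monomial x a)"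
    using * by (simp, intro sum.mono_neutral_cong_left) auto
  moreover have "w = (\<Sum>a\<in>A\<union>B. of_rat (if a \<in> B then d a else 0) * laurent_monomial x a)"
    using * by (simp, intro sum.mono_neutral_cong_left) auto
  ultimately have "z + w = (\<Sum>a\<in>A\<union>B.
      of_rat ((if a \<in> A then c a else 0) + (if a \<in> B then d a else 0)) * laurent_monomial x a)"
    by (simp only: sum.distrib[symmetric] of_rat_add distrib_right)
  with * show ?case
    by (intro exI[of _ "A \<union> B"]
        exI[of _ "\<lambda>a. (if a \<in> A then c a else 0) + (if a \<in> B then d a else 0)"]) auto
qed

lemma laurent_ringE:
  assumes "z \<in> laurent_ring x W"
  obtains A c where "finite A" "\<forall>a\<in>A. keys a \<subseteq> W"
    "z = (\<Sum>a\<in>A. of_rat (c a) * laurent_monomial x a)"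
  using laurent_ring_normal_form[OF assms] by (elim exE conjE) (rule that)

lemma laurent_ring_zero: "0 \<in> laurent_ring x W"
  using laurent_ring.monomial[of 0 W 0 x] by simp

lemma laurent_ring_one: "1 \<in> laurent_ring x W"
  using laurent_ring.monomial[of 0 W 1 x] by simp

lemma laurent_ring_laurent_monomial: "keys a \<subseteq> W \<Longrightarrow> laurent_monomial x a \<in> laurent_ring x W"
  using laurent_ring.monomial[of a W 1 x] by simp

lemma laurent_ring_sum:
  "(\<And>i. i \<in> I \<Longrightarrow> g i \<in> laurent_ring x W) \<Longrightarrow> sum g I \<in> laurent_ring x W"
  by (induction I rule: infinite_finite_induct)
     (auto intro: laurent_ring_zero laurent_ring.add)

lemma laurent_ring_mult:
  assumes "z \<in> laurent_ring x W" "w \<in> laurent_ring x W" "\<forall>j\<in>W. x j \<noteq> 0"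
  shows "z * w \<in> laurent_ring x W"
  using assms(1)
proof induction
  case (monomial a c)
  from assms(2) show ?case
  proof induction
    case (monomial b d)
    have "laurent_monomial x (a + b) = laurent_monomial x a * laurent_monomial x b"
      using assms(3) monomial \<open>keys a \<subseteq> W\<close> by (intro laurent_monomial_add) auto
    then have "of_rat c * laurent_monomial x a * (of_rat d * laurent_monomial x b) = of_rat (c * d)
        * laurent_monomial x (a + b)"
      by (simp add: of_rat_mult)
    moreover have "keys (a + b) \<subseteq> W"
      using monomial \<open>keys a \<subseteq> W\<close> Poly_Mapping.keys_add[of a b] by auto
    ultimately show ?case by (metis laurent_ring.monomial)
  next
    case (add z w)
    then show ?case by (simp add: distrib_left laurent_ring.add)
  qed
next
  case (add z w)
  then show ?case by (simp add: distrib_right laurent_ring.add)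
qed

lemma laurent_ring_power:
  "\<lbrakk>z \<in> laurent_ring x W; \<forall>j\<in>W. x j \<noteq> 0\<rbrakk> \<Longrightarrow> z ^ k \<in> laurent_ring x W"
  by (induction k) (auto intro: laurent_ring_one laurent_ring_mult)

lemma laurent_ring_cong:
  assumes "\<And>j. j \<in> W \<Longrightarrow> x j = y j"
  shows "laurent_ring x W = laurent_ring y W"
proof -
  have *: "laurent_ring x W \<subseteq> laurent_ring y W" if "\<And>j. j \<in> W \<Longrightarrow> x j = y j" for x y
  proof
    fix z assume "z \<in> laurent_ring x W"
    then show "z \<in> laurent_ring y W"
    proof induction
      case (monomial a c)
      then have "laurent_monomial x a = laurent_monomial y a" using that by (intro laurent_monomial_cong) auto
      then show ?case using monomial by (simp add: laurent_ring.monomial)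
    qed (rule laurent_ring.add)
  qed
  show ?thesis using *[of x y] *[of y x] assms by auto
qed

lemma lookup_sum_single:
  assumes "finite A"
  shows "lookup (\<Sum>a\<in>A. single a (c a)) b = (if b \<in> A then c b else 0)"
proof -
  have "lookup (\<Sum>a\<in>A. single a (c a)) b = (\<Sum>a\<in>A. if a = b then c a else 0)"
    by (simp add: lookup_sum lookup_single when_def)
  also have "\<dots> = (if b \<in> A then c b else 0)" using assms by simp
  finally show ?thesis .
qed

lemma sum_single_group_algebra:
  assumes "finite A" "\<forall>a\<in>A. keys a \<subseteq> {n+1..m}"
  shows "(\<Sum>a\<in>A. single a (c a)) \<in> group_algebra n m"
    and "laurent_eval x (\<Sum>a\<in>A. single a (c a)) = (\<Sum>a\<in>A. of_rat (c a) * laurent_monomial x a)"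
proof -
  let ?p = "\<Sum>a\<in>A. single a (c a)"
  have k: "keys ?p \<subseteq> A"
    using assms by (auto simp: in_keys_iff lookup_sum_single split: if_splits)
  then show "?p \<in> group_algebra n m" using assms by (auto simp: group_algebra_def)
  have "laurent_eval x ?p = (\<Sum>a\<in>keys ?p. of_rat (lookup ?p a) * laurent_monomial x a)"
    by (simp add: laurent_eval_def laurent_monomial_def)
  also have "\<dots> = (\<Sum>a\<in>A. of_rat (lookup ?p a) * laurent_monomial x a)"
    using k assms by (intro sum.mono_neutral_left) (auto simp: in_keys_iff)
  also have "\<dots> = (\<Sum>a\<in>A. of_rat (c a) * laurent_monomial x a)"
    using assms by (intro sum.cong) (auto simp: lookup_sum_single)
  finally show "laurent_eval x ?p = (\<Sum>a\<in>A. of_rat (c a) * laurent_monomial x a)" .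
qed

lemma QP_eq_laurent_ring: "QP n m x = laurent_ring x {n+1..m}"
proof
  show "QP n m x \<subseteq> laurent_ring x {n+1..m}"
    unfolding QP_def laurent_eval_def group_algebra_def laurent_monomial_def[symmetric]
    by (auto intro!: laurent_ring_sum laurent_ring.monomial)
  show "laurent_ring x {n+1..m} \<subseteq> QP n m x"
  proof
    fix z assume z: "z \<in> laurent_ring x {n+1..m}"
    obtain A c where *: "finite A" "\<forall>a\<in>A. keys a \<subseteq> {n+1..m}"
      "z = (\<Sum>a\<in>A. of_rat (c a) * laurent_monomial x a)" by (rule laurent_ringE[OF z])
    have "z = laurent_eval x (\<Sum>a\<in>A. single a (c a))"
      unfolding sum_single_group_algebra(2)[OF *(1,2)] by (rule *(3))
    moreover have "(\<Sum>a\<in>A. single a (c a)) \<in> group_algebra n m"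
      by (rule sum_single_group_algebra(1)[OF *(1,2)])
    ultimately show "z \<in> QP n m x" unfolding QP_def by (rule image_eqI)
  qed
qed

text \<open>
  Algebraic independence over \<open>\<rat>\<close> of the \<open>x j\<close> with \<open>j \<in> W\<close>, in the form of linear independence of
  Laurent monomials; the \<open>x j\<close> are then automatically different from 0.
\<close>

definition indep :: "(nat \<Rightarrow> 'f::field_char_0) \<Rightarrow> nat set \<Rightarrow> bool" where
  "indep x W \<longleftrightarrow> (\<forall>A c. finite A \<longrightarrow> (\<forall>a\<in>A. keys a \<subseteq> W) \<longrightarrow>
     (\<Sum>a\<in>A. of_rat (c a) * laurent_monomial x a) = 0 \<longrightarrow> (\<forall>a\<in>A. c a = 0))"

definition indep_over :: "(nat \<Rightarrow> 'f::field_char_0) \<Rightarrow> nat set \<Rightarrow> nat set \<Rightarrow> bool" where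
  "indep_over x U W \<longleftrightarrow> (\<forall>A r. finite A \<longrightarrow> (\<forall>a\<in>A. keys a \<subseteq> U \<and> r a \<in> laurent_ring x W) \<longrightarrow>
     (\<Sum>a\<in>A. r a * laurent_monomial x a) = 0 \<longrightarrow> (\<forall>a\<in>A. r a = 0))"

lemma indepD:
  "\<lbrakk>indep x W; finite A; \<And>a. a \<in> A \<Longrightarrow> keys a \<subseteq> W;
    (\<Sum>a\<in>A. of_rat (c a) * laurent_monomial x a) = 0; a \<in> A\<rbrakk> \<Longrightarrow> c a = 0"
  unfolding indep_def by blast

lemma indep_overD:
  "\<lbrakk>indep_over x U W; finite A; \<And>a. a \<in> A \<Longrightarrow> keys a \<subseteq> U;
    \<And>a. a \<in> A \<Longrightarrow> r a \<in> laurent_ring x W;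
    (\<Sum>a\<in>A. r a * laurent_monomial x a) = 0; a \<in> A\<rbrakk> \<Longrightarrow> r a = 0"
  unfolding indep_over_def by blast

lemma indep_subset: "indep x W \<Longrightarrow> V \<subseteq> W \<Longrightarrow> indep x V"
  unfolding indep_def by (meson subset_trans)

lemma indep_nonzero:
  assumes "indep x W" "j \<in> W"
  shows "x j \<noteq> 0"
proof
  assume "x j = 0"
  then have "(\<Sum>a\<in>{single j 1}. of_rat 1 * laurent_monomial x a) = 0" by simp
  with indepD[OF assms(1), of "{single j 1}" "\<lambda>_. 1"] assms(2)
  show False by auto
qed

definition restrict_exp :: "nat set \<Rightarrow> (nat \<Rightarrow>\<^sub>0 int) \<Rightarrow> (nat \<Rightarrow>\<^sub>0 int)" where
  "restrict_exp U a = (\<Sum>j\<in>keys a \<inter> U. single j (lookup a j))"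

lemma lookup_restrict_exp: "lookup (restrict_exp U a) j = (if j \<in> U then lookup a j else 0)"
  unfolding restrict_exp_def by (subst lookup_sum_single) (auto simp: in_keys_iff)

lemma keys_restrict_exp: "keys (restrict_exp U a) = keys a \<inter> U"
  by (auto simp: in_keys_iff lookup_restrict_exp split: if_splits)

lemma restrict_exp_split:
  assumes "keys a \<subseteq> U \<union> W" "U \<inter> W = {}"
  shows "restrict_exp U a + restrict_exp W a = a"
  using assms by (intro poly_mapping_eqI) (auto simp: lookup_add lookup_restrict_exp in_keys_iff)

lemma split_exponent_unique:
  fixes a b a' b' :: "nat \<Rightarrow>\<^sub>0 int"
  assumes "a + b = a' + b'" "U \<inter> W = {}" "keys a \<subseteq> U" "keys a' \<subseteq> U"
    "keys b \<subseteq> W" "keys b' \<subseteq> W"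
  shows "a = a' \<and> b = b'"
proof -
  have *: "restrict_exp U (a + b) = a" if "keys a \<subseteq> U" "keys b \<subseteq> W" for a b
  proof (rule poly_mapping_eqI)
    fix j
    show "lookup (restrict_exp U (a + b)) j = lookup a j"
    proof (cases "j \<in> U")
      case True
      then have "j \<notin> keys b" using that assms(2) by blast
      then show ?thesis using True by (simp add: lookup_restrict_exp lookup_add in_keys_iff)
    next
      case False
      then have "j \<notin> keys a" using that by blast
      then show ?thesis using False by (simp add: lookup_restrict_exp in_keys_iff)
    qed
  qed
  have "a = a'" using *[of a b] *[of a' b'] assms by simp
  with assms(1) show ?thesis by simp
qed

text \<open>
  A Laurent polynomial in \<open>U \<union> W\<close> is a Laurent polynomial in \<open>U\<close> with coefficients in \<open>W\<close>. The
  splitting is used with \<open>U\<close> the cluster and \<open>W\<close> the frozen variables, and with a single variable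
  in \<open>U\<close> when that variable is mutated.
\<close>

lemma indep_split:
  assumes "U \<inter> W = {}" "\<forall>j\<in>U \<union> W. x j \<noteq> 0"
  shows "indep x (U \<union> W) \<longleftrightarrow> indep x W \<and> indep_over x U W"
proof
  assume I: "indep x (U \<union> W)"
  have "indep_over x U W"
    unfolding indep_over_def
  proof (intro allI impI ballI)
    fix A r a
    assume A: "finite A" "\<forall>a\<in>A. keys a \<subseteq> U \<and> r a \<in> laurent_ring x W"
      and s: "(\<Sum>a\<in>A. r a * laurent_monomial x a) = 0" and a: "a \<in> A"
    from A(2) have "\<forall>a\<in>A. \<exists>B c. finite B \<and> (\<forall>a\<in>B. keys a \<subseteq> W) \<and>
        r a = (\<Sum>a\<in>B. of_rat (c a) * laurent_monomial x a)"
      by (blast intro: laurent_ring_normal_form)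
    then obtain B c where B: "\<And>a. a \<in> A \<Longrightarrow> finite (B a)"
      "\<And>a b. a \<in> A \<Longrightarrow> b \<in> B a \<Longrightarrow> keys b \<subseteq> W"
      "\<And>a. a \<in> A \<Longrightarrow> r a = (\<Sum>b\<in>B a. of_rat (c a b) * laurent_monomial x b)" by metis
    let ?f = "\<lambda>(a, b). a + b"
    let ?C = "Sigma A B"
    have inj: "inj_on ?f ?C"
    proof (rule inj_onI)
      fix p p' assume "p \<in> ?C" "p' \<in> ?C" "?f p = ?f p'"
      then obtain a b a' b' where "p = (a, b)" "p' = (a', b')" "a \<in> A" "a' \<in> A"
        "b \<in> B a" "b' \<in> B a'" "a + b = a' + b'" by auto
      then show "p = p'"
        using split_exponent_unique[of a b a' b', OF _ assms(1)] A(2) B(2) by simp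
    qed
    have "0 = (\<Sum>a\<in>A. (\<Sum>b\<in>B a. of_rat (c a b) * laurent_monomial x (a + b)))"
      unfolding s[symmetric]
    proof (intro sum.cong refl)
      fix a assume "a \<in> A"
      then have "laurent_monomial x (a + b) = laurent_monomial x a * laurent_monomial x b" if "b \<in> B a" for b
        using that A B assms by (intro laurent_monomial_add) blast
      then show "r a * laurent_monomial x a = (\<Sum>b\<in>B a. of_rat (c a b) * laurent_monomial x (a + b))"
        using \<open>a \<in> A\<close> B(3)[of a] by (simp add: sum_distrib_right mult_ac sum_distrib_left)
    qed
    also have "\<dots> = (\<Sum>q\<in>?C. of_rat (case q of (a, b) \<Rightarrow> c a b) * laurent_monomial x (?f q))"
      using A(1) B(1) by (subst sum.Sigma) (auto intro!: sum.cong)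
    also have "\<dots> = (\<Sum>e\<in>?f ` ?C. of_rat (case inv_into ?C ?f e of (a, b) \<Rightarrow> c a b) * laurent_monomial x e)"
      by (subst sum.reindex[OF inj]) (auto intro!: sum.cong simp: inv_into_f_f[OF inj])
    finally have s': "(\<Sum>e\<in>?f ` ?C. of_rat (case inv_into ?C ?f e of (a, b) \<Rightarrow> c a b) * laurent_monomial x e) = 0"
      by simp
    have "c a b = 0" if "b \<in> B a" for b
    proof -
      have "(case inv_into ?C ?f (?f (a, b)) of (a, b) \<Rightarrow> c a b) = 0"
      proof (rule indepD[OF I _ _ s'])
        show "finite (?f ` ?C)" using A(1) B(1) by auto
        show "?f (a, b) \<in> ?f ` ?C" using a that by blast
        fix e assume "e \<in> ?f ` ?C"
        then show "keys e \<subseteq> U \<union> W"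
          using A(2) B(2) Poly_Mapping.keys_add by fast
      qed
      also have "inv_into ?C ?f (?f (a, b)) = (a, b)"
        using a that by (intro inv_into_f_f[OF inj]) auto
      finally show ?thesis by simp
    qed
    with B(3)[OF a] show "r a = 0" by simp
  qed
  with I show "indep x W \<and> indep_over x U W" using indep_subset by blast
next
  assume I: "indep x W \<and> indep_over x U W"
  show "indep x (U \<union> W)"
    unfolding indep_def
  proof (intro allI impI ballI)
    fix A c a
    assume A: "finite A" "\<forall>a\<in>A. keys a \<subseteq> U \<union> W"
      and s: "(\<Sum>a\<in>A. of_rat (c a) * laurent_monomial x a) = 0" and a: "a \<in> A"
    define r where "r u = (\<Sum>a\<in>{a\<in>A. restrict_exp U a = u}. of_rat (c a) * laurent_monomial x (restrict_exp W a))"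
        for u
    have sp: "laurent_monomial x a = laurent_monomial x (restrict_exp U a) * laurent_monomial x (restrict_exp W a)"
        if "a \<in> A" for a
    proof -
      have "laurent_monomial x (restrict_exp U a + restrict_exp W a) = laurent_monomial x (restrict_exp U a)
          * laurent_monomial x (restrict_exp W a)"
        using assms(2) by (intro laurent_monomial_add) (auto simp: keys_restrict_exp)
      then show ?thesis using restrict_exp_split[of a U W] assms A that by auto
    qed
    have "0 = (\<Sum>u\<in>restrict_exp U ` A. \<Sum>a\<in>{a\<in>A. restrict_exp U a = u}. of_rat (c a) * laurent_monomial x a)"
      unfolding s[symmetric] by (rule sum.image_gen[OF A(1)])
    also have "\<dots> = (\<Sum>u\<in>restrict_exp U ` A. r u * laurent_monomial x u)"
      unfolding r_def sum_distrib_right by (intro sum.cong refl) (auto simp: sp)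
    finally have s': "(\<Sum>u\<in>restrict_exp U ` A. r u * laurent_monomial x u) = 0" by simp
    have "r (restrict_exp U a) = 0"
    proof (rule indep_overD[OF conjunct2[OF I] _ _ _ s'])
      fix u
      show "r u \<in> laurent_ring x W" unfolding r_def
        by (intro laurent_ring_sum laurent_ring.monomial) (auto simp: keys_restrict_exp)
      show "keys u \<subseteq> U" if "u \<in> restrict_exp U ` A"
        using that by (auto simp: keys_restrict_exp)
    qed (use A a in auto)
    let ?F = "{b\<in>A. restrict_exp U b = restrict_exp U a}"
    have inj: "inj_on (restrict_exp W) ?F"
    proof (rule inj_onI)
      fix b b' assume "b \<in> ?F" "b' \<in> ?F" "restrict_exp W b = restrict_exp W b'"
      then show "b = b'" using A(2) restrict_exp_split[OF _ assms(1)]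
        by (metis (mono_tags, lifting) mem_Collect_eq)
    qed
    have s'': "(\<Sum>b\<in>restrict_exp W ` ?F. of_rat (c (inv_into ?F (restrict_exp W) b)) * laurent_monomial x b) = 0"
      by (subst sum.reindex[OF inj], subst \<open>r (restrict_exp U a) = 0\<close>[symmetric], unfold r_def)
         (auto intro!: sum.cong simp: inv_into_f_f[OF inj])
    have "c (inv_into ?F (restrict_exp W) (restrict_exp W a)) = 0"
      using A a by (intro indepD[OF conjunct1[OF I] _ _ s'']) (auto simp: keys_restrict_exp)
    then show "c a = 0" using a inv_into_f_f[OF inj, of a] by simp
  qed
qed

text \<open>
  Mutation preserves independence: a relation for \<open>M / x k\<close> over the other variables becomes,
  after multiplication by a power of \<open>M\<close>, a relation for the inverse of \<open>x k\<close> with coefficients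
  that differ from the old ones by powers of \<open>M\<close>.
\<close>

lemma indep_replace:
  assumes I: "indep x (insert k W)" and k: "k \<notin> W" and M: "M \<in> laurent_ring x W" "M \<noteq> 0"
  shows "indep (x(k := M / x k)) (insert k W)"
proof -
  let ?y = "x(k := M / x k)"
  have nz: "\<forall>j\<in>insert k W. x j \<noteq> 0" using indep_nonzero[OF I] by blast
  then have nzy: "\<forall>j\<in>insert k W. ?y j \<noteq> 0" using M by auto
  have IW: "indep x W" and IO: "indep_over x {k} W"
    using I indep_split[of "{k}" W x] k nz by auto
  have lr: "laurent_ring ?y W = laurent_ring x W"
    using k by (intro laurent_ring_cong) auto
  have lm: "laurent_monomial ?y a = laurent_monomial x a" if "keys a \<subseteq> W" for a
    using k that by (intro laurent_monomial_cong) auto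
  have "indep ?y W"
    unfolding indep_def
  proof (intro allI impI ballI)
    fix A c a assume *: "finite A" "\<forall>a\<in>A. keys a \<subseteq> W" "a \<in> A"
       "(\<Sum>a\<in>A. of_rat (c a) * laurent_monomial ?y a) = 0"
    have "(\<Sum>a\<in>A. of_rat (c a) * laurent_monomial x a) = 0"
      unfolding *(4)[symmetric] using * lm by (intro sum.cong) auto
    then show "c a = 0" using indepD[OF IW, of A c a] * by blast
  qed
  moreover have "indep_over ?y {k} W"
    unfolding indep_over_def lr
  proof (intro allI impI ballI)
    fix A r a
    assume A: "finite A" "\<forall>a\<in>A. keys a \<subseteq> {k} \<and> r a \<in> laurent_ring x W"
      and s: "(\<Sum>a\<in>A. r a * laurent_monomial ?y a) = 0" and a: "a \<in> A"
    \<comment> \<open>A power of \<open>M\<close> that clears all negative exponents.\<close>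
    obtain J :: nat where J: "\<And>a. a \<in> A \<Longrightarrow> 0 \<le> int J + lookup a k"
    proof -
      have "finite ((\<lambda>a. nat \<bar>lookup a k\<bar>) ` A)" using A(1) by auto
      then obtain J where "\<forall>e\<in>(\<lambda>a. nat \<bar>lookup a k\<bar>) ` A. e \<le> J"
        by (meson Max_ge)
      then have "\<And>a. a \<in> A \<Longrightarrow> 0 \<le> int J + lookup a k" by fastforce
      with that show thesis by blast
    qed
    define r' where "r' a = r (- a) * M ^ nat (int J - lookup a k)" for a
    have e: "M ^ J * (r a * laurent_monomial ?y a) = r' (- a) * laurent_monomial x (- a)" if "a \<in> A" for a
    proof -
      let ?e = "lookup a k"
      have "laurent_monomial ?y a = (M / x k) powi ?e" using laurent_monomial_superset[of "{k}" a ?y] A that by auto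
      moreover have "laurent_monomial x (- a) = x k powi (- ?e)"
          using laurent_monomial_superset[of "{k}" "- a" x] A that by auto
      moreover have "M ^ nat (int J + ?e) = M ^ J * M powi ?e"
        using J[OF that] M(2) power_int_add[of M "int J" ?e] by (simp add: power_int_def)
      ultimately show ?thesis
        by (simp add: r'_def power_int_divide_distrib power_int_minus field_simps)
    qed
    have "0 = M ^ J * (\<Sum>a\<in>A. r a * laurent_monomial ?y a)" using s by simp
    also have "\<dots> = (\<Sum>a\<in>A. r' (- a) * laurent_monomial x (- a))" unfolding sum_distrib_left using e by auto
    also have "\<dots> = (\<Sum>a\<in>uminus ` A. r' a * laurent_monomial x a)" by (subst sum.reindex) auto
    finally have s': "(\<Sum>a\<in>uminus ` A. r' a * laurent_monomial x a) = 0" by simp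
    have "r' (- a) = 0"
    proof (rule indep_overD[OF IO _ _ _ s'])
      fix b assume "b \<in> uminus ` A"
      then have b: "- b \<in> A" by auto
      then show "keys b \<subseteq> {k}" using A(2) by fastforce
      show "r' b \<in> laurent_ring x W" unfolding r'_def
        using A(2) b nz M(1) by (intro laurent_ring_mult laurent_ring_power) auto
    qed (use A a in auto)
    then show "r a = 0" using M by (simp add: r'_def)
  qed
  ultimately show ?thesis using indep_split[of "{k}" W ?y] k nzy by auto
qed

section \<open>Positive Laurent polynomials and smallest exponents\<close>

text \<open>
  \<open>has_val x W z \<nu>\<close> says that \<open>z\<close> is a Laurent polynomial in the variables \<open>W\<close> with positive
  coefficients, and that \<open>\<nu> i\<close> is the smallest exponent of \<open>x i\<close> in it. Positivity is what makes
  the clause for sums correct: there is no cancellation.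
\<close>

inductive has_val :: "(nat \<Rightarrow> 'f::field_char_0) \<Rightarrow> nat set \<Rightarrow> 'f \<Rightarrow> (nat \<Rightarrow> int) \<Rightarrow> bool"
  for x W where
  monomial: "\<lbrakk>0 < c; keys a \<subseteq> W\<rbrakk> \<Longrightarrow> has_val x W (of_rat c * laurent_monomial x a) (lookup a)"
| add: "\<lbrakk>has_val x W z \<nu>; has_val x W w \<mu>\<rbrakk> \<Longrightarrow> has_val x W (z + w) (\<lambda>i. min (\<nu> i) (\<mu> i))"

lemma has_val_laurent_monomial: "keys a \<subseteq> W \<Longrightarrow> has_val x W (laurent_monomial x a) (lookup a)"
  using has_val.monomial[of 1 a W x] by simp

lemma has_val_one: "has_val x W 1 (\<lambda>_. 0)"
  using has_val_laurent_monomial[of 0 W x] by (simp add: zero_poly_mapping.rep_eq)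

lemma lookup_single_fun: "lookup (single j e) = (\<lambda>i. if i = j then e else 0)"
  by (auto simp: fun_eq_iff lookup_single when_def)

lemma has_val_var: "j \<in> W \<Longrightarrow> has_val x W (x j) (\<lambda>i. if i = j then 1 else 0)"
  using has_val_laurent_monomial[of "single j 1" W x] by (simp add: lookup_single_fun)

lemma has_val_inverse_var: "j \<in> W \<Longrightarrow> has_val x W (inverse (x j)) (\<lambda>i. if i = j then - 1 else 0)"
  using has_val_laurent_monomial[of "single j (- 1)" W x] by (simp add: lookup_single_fun)

lemma has_val_mult:
  assumes "has_val x W z \<nu>" "has_val x W w \<mu>" and nz: "\<forall>j\<in>W. x j \<noteq> 0"
  shows "has_val x W (z * w) (\<lambda>i. \<nu> i + \<mu> i)"
  using assms(1)
proof induction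
  case (monomial c a)
  from assms(2) show ?case
  proof induction
    case (monomial d b)
    have "of_rat c * laurent_monomial x a * (of_rat d * laurent_monomial x b) = of_rat (c * d) * laurent_monomial x (a
        + b)"
      using nz monomial(2) \<open>keys a \<subseteq> W\<close>
      by (subst laurent_monomial_add) (auto simp: of_rat_mult)
    moreover have "keys (a + b) \<subseteq> W"
      using monomial(2) \<open>keys a \<subseteq> W\<close> Poly_Mapping.keys_add[of a b] by blast
    moreover have "lookup (a + b) = (\<lambda>i. lookup a i + lookup b i)"
      by (simp add: lookup_add fun_eq_iff)
    ultimately show ?case
      using has_val.monomial[of "c * d" "a + b" W x] monomial(1) \<open>0 < c\<close> by simp
  next
    case (add z \<nu> w \<mu>)
    then show ?case using has_val.add[OF add.IH] by (simp add: distrib_left min_add_distrib_right)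
  qed
next
  case (add z \<nu> w' \<mu>)
  then show ?case using has_val.add[OF add.IH] by (simp add: distrib_right min_add_distrib_left)
qed

lemma has_val_normal_form:
  assumes "has_val x W z \<nu>"
  shows "\<exists>A c. finite A \<and> A \<noteq> {} \<and> (\<forall>a\<in>A. keys a \<subseteq> W \<and> 0 < c a) \<and>
    z = (\<Sum>a\<in>A. of_rat (c a) * laurent_monomial x a) \<and> \<nu> = (\<lambda>i. Min ((\<lambda>a. lookup a i) ` A))"
  using assms
proof induction
  case (monomial c a)
  then show ?case by (intro exI[of _ "{a}"] exI[of _ "\<lambda>_. c"]) auto
next
  case (add z \<nu> w \<mu>)
  obtain A c where 1: "finite A" "A \<noteq> {}" "\<forall>a\<in>A. keys a \<subseteq> W \<and> 0 < c a"
      "z = (\<Sum>a\<in>A. of_rat (c a) * laurent_monomial x a)" "\<nu> = (\<lambda>i. Min ((\<lambda>a. lookup a i) ` A))"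
    using add.IH(1) by (elim exE conjE) (rule that)
  obtain B d where 2: "finite B" "B \<noteq> {}" "\<forall>a\<in>B. keys a \<subseteq> W \<and> 0 < d a"
      "w = (\<Sum>a\<in>B. of_rat (d a) * laurent_monomial x a)" "\<mu> = (\<lambda>i. Min ((\<lambda>a. lookup a i) ` B))"
    using add.IH(2) by (elim exE conjE) (rule that)
  let ?e = "\<lambda>a. (if a \<in> A then c a else 0) + (if a \<in> B then d a else 0)"
  have "z = (\<Sum>a\<in>A\<union>B. of_rat (if a \<in> A then c a else 0) * laurent_monomial x a)"
    unfolding 1(4) using 1(1) 2(1) by (intro sum.mono_neutral_cong_left) auto
  moreover have "w = (\<Sum>a\<in>A\<union>B. of_rat (if a \<in> B then d a else 0) * laurent_monomial x a)"
    unfolding 2(4) using 1(1) 2(1) by (intro sum.mono_neutral_cong_left) auto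
  ultimately have s: "z + w = (\<Sum>a\<in>A\<union>B. of_rat (?e a) * laurent_monomial x a)"
    by (simp only: sum.distrib[symmetric] of_rat_add distrib_right)
  have "(\<lambda>i. min (\<nu> i) (\<mu> i)) = (\<lambda>i. Min ((\<lambda>a. lookup a i) ` (A \<union> B)))"
    using 1 2 by (auto simp: image_Un Min_Un)
  moreover have "\<forall>a\<in>A\<union>B. keys a \<subseteq> W \<and> 0 < ?e a"
    using 1(3) 2(3) by (auto simp: add_pos_pos)
  ultimately show ?case using 1(1,2) 2(1) s
    by (intro exI[of _ "A \<union> B"] exI[of _ ?e]) simp
qed

lemma has_valE:
  assumes "has_val x W z \<nu>"
  obtains A c where "finite A" "A \<noteq> {}" "\<forall>a\<in>A. keys a \<subseteq> W" "\<forall>a\<in>A. 0 < c a"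
    "z = (\<Sum>a\<in>A. of_rat (c a) * laurent_monomial x a)" "\<forall>i. \<nu> i = Min ((\<lambda>a. lookup a i) ` A)"
proof -
  obtain A c where 1: "finite A" "A \<noteq> {}" "\<forall>a\<in>A. keys a \<subseteq> W \<and> 0 < c a"
      "z = (\<Sum>a\<in>A. of_rat (c a) * laurent_monomial x a)" "\<nu> = (\<lambda>i. Min ((\<lambda>a. lookup a i) ` A))"
    using has_val_normal_form[OF assms] by (elim exE conjE) (rule that)
  show ?thesis
  proof (rule that[OF 1(1,2) _ _ 1(4)])
    show "\<forall>i. \<nu> i = Min ((\<lambda>a. lookup a i) ` A)" unfolding 1(5) by (rule allI) (rule refl)
  qed (use 1(3) in auto)
qed

lemma has_val_nonzero:
  assumes "indep x W" "has_val x W z \<nu>"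
  shows "z \<noteq> 0"
proof
  assume "z = 0"
  obtain A c where A0: "finite A" "A \<noteq> {}" "\<forall>a\<in>A. keys a \<subseteq> W" "\<forall>a\<in>A. 0 < c a"
    "z = (\<Sum>a\<in>A. of_rat (c a) * laurent_monomial x a)" "\<forall>i. \<nu> i = Min ((\<lambda>a. lookup a i) ` A)"
    by (rule has_valE[OF assms(2)])
  note A = A0(1,2) bspec[OF A0(3)] bspec[OF A0(4)] A0(5) spec[OF A0(6)]
  then obtain a where "a \<in> A" by blast
  with indepD[OF assms(1) A(1) A(3)] A \<open>z = 0\<close> show False by fastforce
qed

text \<open>
  By independence the set of exponent vectors that occur is determined by the value.
\<close>

lemma has_val_unique:
  assumes "indep x W" "has_val x W z \<nu>" "has_val x W z \<mu>"
  shows "\<nu> = \<mu>"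
proof -
  obtain A c where A0: "finite A" "A \<noteq> {}" "\<forall>a\<in>A. keys a \<subseteq> W" "\<forall>a\<in>A. 0 < c a"
    "z = (\<Sum>a\<in>A. of_rat (c a) * laurent_monomial x a)" "\<forall>i. \<nu> i = Min ((\<lambda>a. lookup a i) ` A)"
    by (rule has_valE[OF assms(2)])
  note 1 = A0(1,2) bspec[OF A0(3)] bspec[OF A0(4)] A0(5) spec[OF A0(6)]
  obtain B d where B0: "finite B" "B \<noteq> {}" "\<forall>a\<in>B. keys a \<subseteq> W" "\<forall>a\<in>B. 0 < d a"
    "z = (\<Sum>a\<in>B. of_rat (d a) * laurent_monomial x a)" "\<forall>i. \<mu> i = Min ((\<lambda>a. lookup a i) ` B)"
    by (rule has_valE[OF assms(3)])
  note 2 = B0(1,2) bspec[OF B0(3)] bspec[OF B0(4)] B0(5) spec[OF B0(6)]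
  let ?e = "\<lambda>a. (if a \<in> A then c a else 0) - (if a \<in> B then d a else 0)"
  have z1: "z = (\<Sum>a\<in>A\<union>B. of_rat (if a \<in> A then c a else 0) * laurent_monomial x a)"
    unfolding 1(5) using 1(1) 2(1) by (intro sum.mono_neutral_cong_left) auto
  have z2: "z = (\<Sum>a\<in>A\<union>B. of_rat (if a \<in> B then d a else 0) * laurent_monomial x a)"
    unfolding 2(5) using 1(1) 2(1) by (intro sum.mono_neutral_cong_left) auto
  have "(\<Sum>a\<in>A\<union>B. of_rat (?e a) * laurent_monomial x a) = z - z"
    by (subst (1) z1, subst z2) (simp only: sum_subtractf[symmetric] of_rat_diff left_diff_distrib)
  then have s0: "(\<Sum>a\<in>A\<union>B. of_rat (?e a) * laurent_monomial x a) = 0" by simp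
  have e: "?e a = 0" if "a \<in> A \<union> B" for a
  proof (rule indepD[OF assms(1) _ _ s0 that])
    show "keys b \<subseteq> W" if "b \<in> A \<union> B" for b
      using that 1(3)[of b] 2(3)[of b] by blast
  qed (use 1(1) 2(1) in simp)
  have "A = B"
    using e 1(4) 2(4) by (force split: if_splits)
  then show ?thesis using 1(6) 2(6) by auto
qed

section \<open>Denominator vectors as smallest exponents\<close>

definition power_product :: "(nat \<Rightarrow> 'f::field_char_0) \<Rightarrow> (nat \<Rightarrow>\<^sub>0 nat) \<Rightarrow> 'f" where
  "power_product x a = (\<Prod>j\<in>keys a. x j ^ lookup a j)"

lemma poly_eval_superset:
  assumes "finite S" "keys f \<subseteq> S"
  shows "poly_eval x f = (\<Sum>a\<in>S. lookup f a * power_product x a)"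
  unfolding poly_eval_def power_product_def using assms
  by (intro sum.mono_neutral_left) (auto simp: in_keys_iff)

lemma poly_eval_add: "poly_eval x (f + g) = poly_eval x f + poly_eval x g"
proof -
  let ?S = "keys f \<union> keys g"
  have "poly_eval x (f + g) = (\<Sum>a\<in>?S. lookup (f + g) a * power_product x a)"
    by (intro poly_eval_superset Poly_Mapping.keys_add) simp
  then show ?thesis
    by (simp add: lookup_add distrib_right sum.distrib poly_eval_superset[of ?S])
qed

lemma poly_eval_single: "poly_eval x (single e r) = r * power_product x e"
  using poly_eval_superset[of "{e}" "single e r" x] by simp

lemma poly_eval_sum_single:
  "poly_eval x (\<Sum>a\<in>A. single (e a) (r a)) = (\<Sum>a\<in>A. r a * power_product x (e a))"
proof (induction A rule: infinite_finite_induct)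
  case (insert a A)
  then show ?case by (simp add: poly_eval_add poly_eval_single)
qed (simp_all add: poly_eval_def)

definition int_exp :: "(nat \<Rightarrow>\<^sub>0 nat) \<Rightarrow> (nat \<Rightarrow>\<^sub>0 int)" where
  "int_exp = Poly_Mapping.map int"

definition nat_exp :: "(nat \<Rightarrow>\<^sub>0 int) \<Rightarrow> (nat \<Rightarrow>\<^sub>0 nat)" where
  "nat_exp = Poly_Mapping.map nat"

lemma lookup_int_exp [simp]: "lookup (int_exp e) j = int (lookup e j)"
  by (simp add: int_exp_def map.rep_eq when_def)

lemma lookup_nat_exp [simp]: "lookup (nat_exp e) j = nat (lookup e j)"
  by (simp add: nat_exp_def map.rep_eq when_def)

lemma keys_int_exp [simp]: "keys (int_exp e) = keys e"
  by (auto simp: in_keys_iff)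

lemma laurent_monomial_int_exp: "laurent_monomial x (int_exp e) = power_product x e"
  by (simp add: laurent_monomial_def power_product_def)

lemma power_product_nat_exp:
  assumes "\<And>j. 0 \<le> lookup a j"
  shows "power_product x (nat_exp a) = laurent_monomial x a"
proof -
  have "int_exp (nat_exp a) = a" using assms by (intro poly_mapping_eqI) simp
  then show ?thesis using laurent_monomial_int_exp[of x "nat_exp a"] by simp
qed

definition exp_vector :: "nat \<Rightarrow> (nat \<Rightarrow> int) \<Rightarrow> (nat \<Rightarrow>\<^sub>0 int)" where
  "exp_vector n d = (\<Sum>i=1..n. single i (d i))"

lemma lookup_exp_vector: "lookup (exp_vector n d) i = (if i \<in> {1..n} then d i else 0)"
  unfolding exp_vector_def by (subst lookup_sum_single) auto

lemma keys_exp_vector: "keys (exp_vector n d) \<subseteq> {1..n}"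
  by (auto simp: in_keys_iff lookup_exp_vector split: if_splits)

lemma laurent_monomial_exp_vector: "laurent_monomial x (exp_vector n d) = (\<Prod>i=1..n. x i powi d i)"
  by (subst laurent_monomial_superset[OF _ keys_exp_vector]) (auto simp: lookup_exp_vector)

text \<open>
  Coefficients in \<open>QP\<close> are Laurent polynomials in the frozen variables, and a Laurent relation in
  the cluster variables becomes a polynomial relation after multiplication by a large monomial.
\<close>

lemma free_generating_indep:
  assumes "free_generating n m x" and nm: "n \<le> m"
  shows "indep x {1..m}"
proof -
  have inj: "inj_on (laurent_eval x) (group_algebra n m)"
    and alg: "\<And>f. f \<in> polynomials n (QP n m x) \<Longrightarrow> poly_eval x f = 0 \<Longrightarrow> f = 0"
    using assms(1) unfolding free_generating_def by blast+
  have IW: "indep x {n+1..m}"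
    unfolding indep_def
  proof (intro allI impI ballI)
    fix A c a
    assume A: "finite A" "\<forall>a\<in>A. keys a \<subseteq> {n+1..m}"
       "(\<Sum>a\<in>A. of_rat (c a) * laurent_monomial x a) = 0" "a \<in> A"
    let ?p = "\<Sum>a\<in>A. single a (c a)"
    have "laurent_eval x ?p = laurent_eval x 0"
      unfolding sum_single_group_algebra(2)[OF A(1,2)] using A(3) by (simp add: laurent_eval_def)
    moreover have "0 \<in> group_algebra n m" by (simp add: group_algebra_def)
    ultimately have "?p = 0"
      using inj sum_single_group_algebra(1)[OF A(1,2), of c] by (meson inj_onD)
    then have "lookup ?p a = 0" by simp
    then show "c a = 0" using A by (simp add: lookup_sum_single)
  qed
  have nzU: "x i \<noteq> 0" if "i \<in> {1..n}" for i
  proof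
    assume "x i = 0"
    have "1 \<in> QP n m x" unfolding QP_eq_laurent_ring by (rule laurent_ring_one)
    then have "poly_var i \<in> polynomials n (QP n m x)"
      using that by (auto simp: polynomials_def poly_var_def)
    moreover have "poly_eval x (poly_var i) = 0"
      using \<open>x i = 0\<close> by (simp add: poly_var_def poly_eval_single power_product_def)
    ultimately have "poly_var i = (0 :: (nat \<Rightarrow>\<^sub>0 nat) \<Rightarrow>\<^sub>0 'a)" using alg by blast
    then have "lookup (poly_var i :: (nat \<Rightarrow>\<^sub>0 nat) \<Rightarrow>\<^sub>0 'a) (single i 1) = 0" by simp
    then show False by (simp add: poly_var_def)
  qed
  have U: "{1..n} \<union> {n+1..m} = {1..m}" using nm by auto
  have nz: "\<forall>j\<in>{1..n} \<union> {n+1..m}. x j \<noteq> 0" using nzU indep_nonzero[OF IW] by blast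
  have "indep_over x {1..n} {n+1..m}"
    unfolding indep_over_def
  proof (intro allI impI ballI)
    fix A r a
    assume A: "finite A" "\<forall>a\<in>A. keys a \<subseteq> {1..n} \<and> r a \<in> laurent_ring x {n+1..m}"
      "(\<Sum>a\<in>A. r a * laurent_monomial x a) = 0" and a: "a \<in> A"
    \<comment> \<open>Adding \<open>M\<close> to all exponents makes them nonnegative.\<close>
    define M where "M = (\<Sum>a\<in>A. \<Sum>j\<in>{1..n}. \<bar>lookup a j\<bar>)"
    have M: "\<bar>lookup a j\<bar> \<le> M" if "a \<in> A" "j \<in> {1..n}" for a j
    proof -
      have "\<bar>lookup a j\<bar> \<le> (\<Sum>j\<in>{1..n}. \<bar>lookup a j\<bar>)"
        using that by (intro member_le_sum) auto
      also have "\<dots> \<le> M" unfolding M_def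
        using that A(1) by (intro member_le_sum[of a A]) (auto intro: sum_nonneg)
      finally show ?thesis .
    qed
    define s where "s = exp_vector n (\<lambda>_. M)"
    define e where "e a = nat_exp (a + s)" for a
    have pos: "0 \<le> lookup (a + s) j" if "a \<in> A" for a j
    proof (cases "j \<in> {1..n}")
      case True
      then show ?thesis using M[OF that True] by (simp add: lookup_add s_def lookup_exp_vector)
    next
      case False
      then have "j \<notin> keys a" using A(2) that by blast
      then show ?thesis using False by (auto simp: lookup_add s_def lookup_exp_vector in_keys_iff)
    qed
    have inj: "inj_on e A"
    proof (rule inj_onI)
      fix a b assume ab: "a \<in> A" "b \<in> A" "e a = e b"
      show "a = b"
      proof (rule poly_mapping_eqI)
        fix j
        have "nat (lookup (a + s) j) = nat (lookup (b + s) j)"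
          using ab(3) unfolding e_def by (metis lookup_nat_exp)
        then show "lookup a j = lookup b j"
          using pos[OF ab(1), of j] pos[OF ab(2), of j] by (simp add: lookup_add)
      qed
    qed
    define f where "f = (\<Sum>u\<in>e ` A. single u (r (inv_into A e u)))"
    have lf: "lookup f u = (if u \<in> e ` A then r (inv_into A e u) else 0)" for u
      unfolding f_def using A(1) by (subst lookup_sum_single) auto
    have "f \<in> polynomials n (QP n m x)"
      unfolding polynomials_def QP_eq_laurent_ring
    proof (intro CollectI ballI)
      fix u assume "u \<in> keys f"
      then obtain b where b: "b \<in> A" "u = e b" by (auto simp: in_keys_iff lf split: if_splits)
      have "keys u \<subseteq> {1..n}"
      proof
        fix j assume j: "j \<in> keys u"
        show "j \<in> {1..n}"
        proof (rule ccontr)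
          assume nj: "j \<notin> {1..n}"
          then have "j \<notin> keys b" using A(2) b(1) by blast
          then have "lookup u j = 0" using nj unfolding b(2) e_def lookup_nat_exp
            by (auto simp: lookup_add s_def lookup_exp_vector in_keys_iff)
          with j show False by (simp add: in_keys_iff)
        qed
      qed
      then show "keys u \<subseteq> {1..n} \<and> lookup f u \<in> laurent_ring x {n+1..m}"
        using b A(2) inv_into_f_f[OF inj] by (auto simp: lf)
    qed
    moreover have "poly_eval x f = 0"
    proof -
      have "poly_eval x f = (\<Sum>b\<in>A. r b * power_product x (e b))"
        unfolding f_def poly_eval_sum_single
        by (subst sum.reindex[OF inj]) (auto simp: inv_into_f_f[OF inj] intro!: sum.cong)
      also have "\<dots> = (\<Sum>b\<in>A. r b * laurent_monomial x b * laurent_monomial x s)"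
      proof (intro sum.cong refl)
        fix b assume b: "b \<in> A"
        have "power_product x (e b) = laurent_monomial x (b + s)" unfolding e_def using pos[OF b]
            by (rule power_product_nat_exp)
        also have "\<dots> = laurent_monomial x b * laurent_monomial x s"
          using A(2) b nzU keys_exp_vector[of n "\<lambda>_. M"] by (intro laurent_monomial_add) (unfold s_def, blast)
        finally show "r b * power_product x (e b) = r b * laurent_monomial x b * laurent_monomial x s" by simp
      qed
      also have "\<dots> = 0" using A(3) by (simp add: sum_distrib_right[symmetric])
      finally show ?thesis .
    qed
    ultimately have "f = 0" by (rule alg)
    then have "lookup f (e a) = 0" by simp
    then show "r a = 0" using a inv_into_f_f[OF inj a] by (simp add: lf)
  qed
  with IW indep_split[OF _ nz] show ?thesis unfolding U by simp
qed

lemma poly_mapping_sum_monomials: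
  "(f :: 'a \<Rightarrow>\<^sub>0 'b::comm_monoid_add) = (\<Sum>u\<in>keys f. single u (lookup f u))"
proof (rule poly_mapping_eqI)
  fix b
  have "lookup (\<Sum>u\<in>keys f. single u (lookup f u)) b
      = (\<Sum>u\<in>keys f. if u = b then lookup f u else 0)"
    by (simp add: lookup_sum lookup_single when_def)
  also have "\<dots> = lookup f b" by (simp add: in_keys_iff)
  finally show "lookup f b =
    lookup (\<Sum>u\<in>keys f. single u (lookup f u)) b" by simp
qed

lemma poly_var_dvd_iff:
  fixes f :: "(nat \<Rightarrow>\<^sub>0 nat) \<Rightarrow>\<^sub>0 'f::field_char_0"
  shows "poly_var i dvd f \<longleftrightarrow> (\<forall>u\<in>keys f. 1 \<le> lookup u i)"
proof
  assume "poly_var i dvd f"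
  then obtain g where g: "f = poly_var i * g" by (auto simp: dvd_def)
  show "\<forall>u\<in>keys f. 1 \<le> lookup u i"
  proof
    fix u assume "u \<in> keys f"
    then have "u \<in> {a + b |a b. a \<in> keys (poly_var i :: (nat \<Rightarrow>\<^sub>0 nat) \<Rightarrow>\<^sub>0 'f) \<and> b \<in> keys g}"
      unfolding g using Poly_Mapping.keys_mult by fastforce
    then obtain b where "u = single i 1 + b" by (auto simp: poly_var_def)
    then show "1 \<le> lookup u i" by (simp add: lookup_add)
  qed
next
  assume *: "\<forall>u\<in>keys f. 1 \<le> lookup u i"
  have "single i 1 + (u - single i 1) = u" if "u \<in> keys f" for u
    using * that by (intro poly_mapping_eqI) (auto simp: lookup_add lookup_minus lookup_single when_def)
  then have "f = poly_var i * (\<Sum>u\<in>keys f. single (u - single i 1) (lookup f u))"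
    by (subst (1) poly_mapping_sum_monomials)
       (simp add: sum_distrib_left poly_var_def mult_single)
  then show "poly_var i dvd f" by (rule dvdI)
qed

lemma indep_over_support:
  assumes I: "indep_over x U W" and A: "finite A" "\<And>a. a \<in> A \<Longrightarrow> keys a \<subseteq> U"
      "\<And>a. a \<in> A \<Longrightarrow> r a \<in> laurent_ring x W" "\<And>a. a \<in> A \<Longrightarrow> r a \<noteq> 0"
    and B: "finite B" "\<And>a. a \<in> B \<Longrightarrow> keys a \<subseteq> U"
      "\<And>a. a \<in> B \<Longrightarrow> s a \<in> laurent_ring x W" "\<And>a. a \<in> B \<Longrightarrow> s a \<noteq> 0"
    and nz: "\<forall>j\<in>W. x j \<noteq> 0"
    and eq: "(\<Sum>a\<in>A. r a * laurent_monomial x a) = (\<Sum>a\<in>B. s a * laurent_monomial x a)"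
  shows "A = B"
proof -
  let ?e = "\<lambda>a. (if a \<in> A then r a else 0) - (if a \<in> B then s a else 0)"
  have 1: "(\<Sum>a\<in>A. r a * laurent_monomial x a) = (\<Sum>a\<in>A\<union>B. (if a \<in> A then r a else 0) * laurent_monomial x a)"
    using A(1) B(1) by (intro sum.mono_neutral_cong_left) auto
  have 2: "(\<Sum>a\<in>B. s a * laurent_monomial x a) = (\<Sum>a\<in>A\<union>B. (if a \<in> B then s a else 0) * laurent_monomial x a)"
    using A(1) B(1) by (intro sum.mono_neutral_cong_left) auto
  have s: "(\<Sum>a\<in>A\<union>B. ?e a * laurent_monomial x a) = 0"
    unfolding left_diff_distrib sum_subtractf 1[symmetric] 2[symmetric] eq by simp
  have neg: "- z \<in> laurent_ring x W" if "z \<in> laurent_ring x W" for z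
    using laurent_ring_mult[OF laurent_ring.monomial[of 0 W "-1"] that nz] by simp
  have d: "z - w \<in> laurent_ring x W" if "z \<in> laurent_ring x W" "w \<in> laurent_ring x W" for z w
    using laurent_ring.add[OF that(1) neg[OF that(2)]] by simp
  have "?e a = 0" if "a \<in> A \<union> B" for a
  proof (rule indep_overD[OF I _ _ _ s that])
    show "?e b \<in> laurent_ring x W" for b
      using A(3)[of b] B(3)[of b] by (intro d) (auto intro: laurent_ring_zero)
    show "keys b \<subseteq> U" if "b \<in> A \<union> B" for b
      using A(2)[of b] B(2)[of b] that by blast
  qed (use A(1) B(1) in auto)
  then show "A = B" using A(4) B(4) by (force split: if_splits)
qed

text \<open>
  Multiplying \<open>z\<close> by the monomial whose exponents are the \<open>- \<nu> i\<close> gives a polynomial in the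
  cluster variables, and some term of it avoids \<open>x i\<close>; the coefficient of that term is a positive
  combination of frozen monomials, hence not zero. For uniqueness, two presentations of \<open>z\<close> have
  the same set of exponents in the cluster variables, and the smallest \<open>i\<close>-th exponent in a
  presentation with denominator exponent \<open>d i\<close> is \<open>- d i\<close>.
\<close>

lemma den_eq_has_val:
  assumes I: "indep x {1..m}" and nm: "n \<le> m" and z: "has_val x {1..m} z \<nu>"
  shows "den n m x z = (\<lambda>i. if i \<in> {1..n} then - \<nu> i else 0)"
proof -
  obtain A c where A0: "finite A" "A \<noteq> {}" "\<forall>a\<in>A. keys a \<subseteq> {1..m}" "\<forall>a\<in>A. 0 < c a"
    "z = (\<Sum>a\<in>A. of_rat (c a) * laurent_monomial x a)" "\<forall>i. \<nu> i = Min ((\<lambda>a. lookup a i) ` A)"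
    by (rule has_valE[OF z])
  note A = A0(1,2) bspec[OF A0(3)] bspec[OF A0(4)] A0(5) spec[OF A0(6)]
  let ?U = "{1..n}" and ?W = "{n+1..m}"
  have UW: "?U \<union> ?W = {1..m}" "?U \<inter> ?W = {}" using nm by auto
  have nz: "\<forall>j\<in>{1..m}. x j \<noteq> 0" using indep_nonzero[OF I] by blast
  have IO: "indep_over x ?U ?W" and IW: "indep x ?W"
    using indep_split[OF UW(2), of x] nz I unfolding UW(1) by auto
  have ge: "\<nu> i \<le> lookup a i" if "a \<in> A" for a i
    unfolding A(6) using A(1) that by auto
  have attained: "\<exists>a\<in>A. lookup a i = \<nu> i" for i
  proof -
    have "\<nu> i \<in> (\<lambda>a. lookup a i) ` A" unfolding A(6) using A(1,2) by (intro Min_in) auto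
    then show ?thesis by auto
  qed
  \<comment> \<open>The coefficient in \<open>QP\<close> collected from the terms in \<open>B\<close>; positivity prevents it from vanishing.\<close>
  define coef where "coef B = (\<Sum>a\<in>B. of_rat (c a) * laurent_monomial x (restrict_exp ?W a))" for B
  have coef_ring: "coef B \<in> laurent_ring x ?W" for B
    unfolding coef_def by (intro laurent_ring_sum laurent_ring.monomial) (auto simp: keys_restrict_exp)
  have coef_nonzero: "coef B \<noteq> 0" if "B \<subseteq> A" "B \<noteq> {}" for B
  proof -
    have "finite B" using that A(1) finite_subset by blast
    then have "\<exists>\<mu>. has_val x ?W (coef B) \<mu>"
      using that(2,1)
    proof (induction B rule: finite_ne_induct)
      case (singleton a)
      then show ?case unfolding coef_def
        using has_val.monomial[of "c a" "restrict_exp ?W a" ?W x] A(4)[of a] by (auto simp: keys_restrict_exp)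
    next
      case (insert a B)
      then obtain \<mu> where \<mu>: "has_val x ?W (coef B) \<mu>" by auto
      have "has_val x ?W (of_rat (c a) * laurent_monomial x (restrict_exp ?W a)) (lookup (restrict_exp ?W a))"
        using A(4)[of a] insert by (intro has_val.monomial) (auto simp: keys_restrict_exp)
      from has_val.add[OF this \<mu>] show ?case
        using insert by (auto simp: coef_def)
    qed
    then show ?thesis using has_val_nonzero[OF IW] by blast
  qed
  have split: "laurent_monomial x a = laurent_monomial x (restrict_exp ?U a) * laurent_monomial x (restrict_exp ?W a)"
      if "a \<in> A" for a
  proof -
    have "restrict_exp ?U a + restrict_exp ?W a = a"
      using A(3)[OF that] UW by (intro restrict_exp_split) auto
    moreover have "laurent_monomial x (restrict_exp ?U a + restrict_exp ?W a) = laurent_monomial x (restrict_exp ?U a)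
        * laurent_monomial x (restrict_exp ?W a)"
      using nz nm by (intro laurent_monomial_add) (auto simp: keys_restrict_exp)
    ultimately show ?thesis by simp
  qed
  have ev_nz: "laurent_monomial x (exp_vector n d) \<noteq> 0" for d
    using nz nm keys_exp_vector[of n d] by (intro laurent_monomial_nonzero) force
  have is_den_iff: "is_denominator n m x z d \<longleftrightarrow> (\<forall>i. i \<notin> ?U \<longrightarrow> d i = 0) \<and>
     (\<exists>f\<in>polynomials n (laurent_ring x ?W). (\<forall>i\<in>?U. \<not> poly_var i dvd f) \<and>
        z * laurent_monomial x (exp_vector n d) = poly_eval x f)" for d
    unfolding is_denominator_def QP_eq_laurent_ring laurent_monomial_exp_vector[symmetric]
    using ev_nz[of d] by (metis eq_divide_eq)
  let ?d = "\<lambda>i. if i \<in> ?U then - \<nu> i else 0"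
  define e where "e a = nat_exp (restrict_exp ?U a + exp_vector n ?d)" for a
  have e_nonneg: "0 \<le> lookup (restrict_exp ?U a + exp_vector n ?d) j" if "a \<in> A" for a j
    using ge[OF that, of j] by (simp add: lookup_add lookup_restrict_exp lookup_exp_vector)
  define f where "f = (\<Sum>a\<in>A. single (e a) (of_rat (c a) * laurent_monomial x (restrict_exp ?W a)))"
  have lf: "lookup f u = coef {a\<in>A. e a = u}" for u
    unfolding f_def coef_def
    by (simp add: lookup_sum lookup_single when_def sum.If_cases[OF A(1)] Int_def)
  have kf: "u \<in> e ` A" if "u \<in> keys f" for u
  proof (rule ccontr)
    assume "u \<notin> e ` A"
    then have "{a\<in>A. e a = u} = {}" by auto
    then have "lookup f u = 0" unfolding lf by (simp only: coef_def sum.empty)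
    with that show False by (simp add: in_keys_iff)
  qed
  have "f \<in> polynomials n (laurent_ring x ?W)"
    unfolding polynomials_def
  proof (intro CollectI ballI conjI)
    fix u assume "u \<in> keys f"
    then obtain a where "u = e a" using kf by blast
    then show "keys u \<subseteq> ?U"
      by (auto simp: e_def in_keys_iff lookup_add lookup_restrict_exp lookup_exp_vector split: if_splits)
    show "lookup f u \<in> laurent_ring x ?W" unfolding lf by (rule coef_ring)
  qed
  moreover have "\<not> poly_var i dvd f" if i: "i \<in> ?U" for i
  proof -
    obtain a where a: "a \<in> A" "lookup a i = \<nu> i" using attained by blast
    have "e a \<in> keys f"
      unfolding in_keys_iff lf using a by (intro coef_nonzero) auto
    moreover have "lookup (e a) i = 0"
      using a i by (simp add: e_def lookup_add lookup_restrict_exp lookup_exp_vector)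
    ultimately show ?thesis unfolding poly_var_dvd_iff by force
  qed
  moreover have "z * laurent_monomial x (exp_vector n ?d) = poly_eval x f"
    unfolding f_def poly_eval_sum_single A(5) sum_distrib_right
  proof (intro sum.cong refl)
    fix a assume a: "a \<in> A"
    have "power_product x (e a) = laurent_monomial x (restrict_exp ?U a + exp_vector n ?d)"
      unfolding e_def using e_nonneg[OF a] by (rule power_product_nat_exp)
    also have "\<dots> = laurent_monomial x (restrict_exp ?U a) * laurent_monomial x (exp_vector n ?d)"
      using nz nm keys_exp_vector[of n ?d] by (intro laurent_monomial_add) (force simp: keys_restrict_exp)
    finally show "of_rat (c a) * laurent_monomial x a * laurent_monomial x (exp_vector n ?d)
        = of_rat (c a) * laurent_monomial x (restrict_exp ?W a) * power_product x (e a)"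
      using split[OF a] by simp
  qed
  ultimately have "\<exists>f\<in>polynomials n (laurent_ring x ?W). (\<forall>i\<in>?U. \<not> poly_var i dvd f) \<and>
      z * laurent_monomial x (exp_vector n ?d) = poly_eval x f" by blast
  then have ex: "is_denominator n m x z ?d" unfolding is_den_iff by simp
  have "d = ?d" if d: "is_denominator n m x z d" for d
  proof -
    obtain g where d0: "\<And>i. i \<notin> ?U \<Longrightarrow> d i = 0" and g: "g \<in> polynomials n (laurent_ring x ?W)"
      and nd: "\<And>i. i \<in> ?U \<Longrightarrow> \<not> poly_var i dvd g" and gz: "z * laurent_monomial x (exp_vector n d) = poly_eval x g"
      using d unfolding is_den_iff by blast
    let ?D = "exp_vector n d"
    \<comment> \<open>The exponents, in the cluster variables, of the Laurent expansion given by the other presentation.\<close>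
    define P where "P = (\<lambda>u. int_exp u - ?D) ` keys g"
    have inj: "inj_on (\<lambda>u. int_exp u - ?D) (keys g)"
    proof (rule inj_onI)
      fix u v assume "int_exp u - ?D = int_exp v - ?D"
      then have "int_exp u = int_exp v" by simp
      then have "int (lookup u j) = int (lookup v j)" for j
        by (metis lookup_int_exp)
      then show "u = v" by (intro poly_mapping_eqI) simp
    qed
    have kg: "keys u \<subseteq> ?U" "lookup g u \<in> laurent_ring x ?W"
      if "u \<in> keys g" for u using g that unfolding polynomials_def by auto
    let ?s = "\<lambda>w. lookup g (inv_into (keys g) (\<lambda>u. int_exp u - ?D) w)"
    have kP: "keys (int_exp u - ?D) \<subseteq> ?U" if "u \<in> keys g" for u
      using kg(1)[OF that] keys_exp_vector[of n d] Poly_Mapping.keys_diff[of "int_exp u" ?D] by auto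
    have "z * laurent_monomial x ?D = (\<Sum>u\<in>keys g. lookup g u * power_product x u)"
      unfolding gz by (rule poly_eval_superset) auto
    also have "\<dots> = (\<Sum>u\<in>keys g. lookup g u * laurent_monomial x (int_exp u - ?D)) * laurent_monomial x ?D"
      unfolding sum_distrib_right
    proof (intro sum.cong refl)
      fix u assume u: "u \<in> keys g"
      have "laurent_monomial x (int_exp u - ?D + ?D) = laurent_monomial x (int_exp u - ?D) * laurent_monomial x ?D"
        using nz nm keys_exp_vector[of n d] kP[OF u] by (intro laurent_monomial_add) force
      then show "lookup g u * power_product x u
          = lookup g u * laurent_monomial x (int_exp u - ?D) * laurent_monomial x ?D"
        by (simp add: laurent_monomial_int_exp)
    qed
    finally have "z = (\<Sum>u\<in>keys g. lookup g u * laurent_monomial x (int_exp u - ?D))"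
      using ev_nz[of d] by simp
    also have "\<dots> = (\<Sum>w\<in>P. ?s w * laurent_monomial x w)"
      unfolding P_def by (subst sum.reindex[OF inj]) (auto simp: inv_into_f_f[OF inj] intro!: sum.cong)
    finally have z1: "z = (\<Sum>w\<in>P. ?s w * laurent_monomial x w)" .
    have "z = (\<Sum>v\<in>restrict_exp ?U ` A. \<Sum>a\<in>{a\<in>A. restrict_exp ?U a = v}. of_rat (c a) * laurent_monomial x a)"
      unfolding A(5) by (rule sum.image_gen[OF A(1)])
    also have "\<dots> = (\<Sum>v\<in>restrict_exp ?U ` A. coef {a\<in>A. restrict_exp ?U a = v} * laurent_monomial x v)"
      unfolding coef_def sum_distrib_right by (intro sum.cong refl) (auto simp: split)
    finally have z2: "z = (\<Sum>v\<in>restrict_exp ?U ` A. coef {a\<in>A. restrict_exp ?U a = v} * laurent_monomial x v)" .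
    have Peq: "P = restrict_exp ?U ` A"
    proof (rule indep_over_support[OF IO])
      show "(\<Sum>w\<in>P. ?s w * laurent_monomial x w) = (\<Sum>v\<in>restrict_exp ?U ` A. coef {a\<in>A. restrict_exp ?U a = v}
          * laurent_monomial x v)"
        using z1 z2 by simp
      show "?s w \<in> laurent_ring x ?W" if "w \<in> P" for w
        using that kg(2) by (auto simp: P_def inv_into_f_f[OF inj])
      show "?s w \<noteq> 0" if "w \<in> P" for w
        using that by (auto simp: P_def inv_into_f_f[OF inj] in_keys_iff)
      show "coef {a\<in>A. restrict_exp ?U a = v} \<noteq> 0" if "v \<in> restrict_exp ?U ` A" for v
        using that by (intro coef_nonzero) auto
      show "coef {a\<in>A. restrict_exp ?U a = v} \<in> laurent_ring x ?W" for v by (rule coef_ring)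
    qed (use A(1) nz nm kP in \<open>auto simp: P_def keys_restrict_exp\<close>)
    have "d i = - \<nu> i" if i: "i \<in> ?U" for i
    proof -
      obtain u where u: "u \<in> keys g" "lookup u i = 0"
        using nd[OF i] unfolding poly_var_dvd_iff by force
      then have "int_exp u - ?D \<in> restrict_exp ?U ` A" using Peq by (auto simp: P_def)
      then obtain a where a: "a \<in> A" "int_exp u - ?D = restrict_exp ?U a" by blast
      have "lookup a i = - d i"
        using arg_cong[OF a(2), of "\<lambda>p. lookup p i"] i u(2)
        by (simp add: lookup_minus lookup_restrict_exp lookup_exp_vector)
      then have 1: "\<nu> i \<le> - d i" using ge[OF a(1), of i] by simp
      obtain b where b: "b \<in> A" "lookup b i = \<nu> i" using attained by blast
      then obtain v where v: "restrict_exp ?U b = int_exp v - ?D" using Peq by (auto simp: P_def)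
      have "\<nu> i = int (lookup v i) - d i"
        using arg_cong[OF v, of "\<lambda>p. lookup p i"] i b(2)
        by (simp add: lookup_minus lookup_restrict_exp lookup_exp_vector)
      with 1 show ?thesis by simp
    qed
    with d0 show "d = ?d" by auto
  qed
  with ex show ?thesis unfolding den_def by (intro the_equality) blast+
qed

section \<open>Binary trees and rotations\<close>

datatype (labels: 'a) btree = Leaf | Node "'a btree" 'a "'a btree"

primrec leaves :: "'a btree \<Rightarrow> nat" where
  "leaves Leaf = 1"
| "leaves (Node l p r) = leaves l + leaves r"

primrec distinct_labels :: "'a btree \<Rightarrow> bool" where
  "distinct_labels Leaf \<longleftrightarrow> True"
| "distinct_labels (Node l p r) \<longleftrightarrow> p \<notin> labels l \<and> p \<notin> labels r \<and> labels l \<inter> labels r = {} \<and> distinct_labels l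
    \<and> distinct_labels r"

text \<open>
  The value 0 for a leaf stands for an edge of the polygon, which carries no cluster variable;
  labels of nodes are positive, and all statements about matrices are restricted to positive
  indices.
\<close>

primrec root_label :: "nat btree \<Rightarrow> nat" where
  "root_label Leaf = 0"
| "root_label (Node l p r) = p"

text \<open>
  The node \<open>k\<close> changes from the left to the right child of its parent \<open>p\<close>, or conversely. The
  subtrees \<open>A\<close>, \<open>Q\<close>, \<open>S\<close> keep their order, so that only the interval of \<open>k\<close> changes: this is a
  flip.
\<close>

inductive rot :: "'a \<Rightarrow> 'a btree \<Rightarrow> 'a btree \<Rightarrow> bool" where
  rotR: "rot k (Node (Node A k Q) p S) (Node A p (Node Q k S))"
| rotL: "rot k (Node A p (Node Q k S)) (Node (Node A k Q) p S)"
| left: "rot k l l' \<Longrightarrow> rot k (Node l p r) (Node l' p r)"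
| right: "rot k r r' \<Longrightarrow> rot k (Node l p r) (Node l p r')"

lemma leaves_pos [simp]: "0 < leaves t"
  by (induction t) auto

lemma leaves_neq_0 [simp]: "leaves t \<noteq> 0"
  using leaves_pos[of t] by linarith

lemma rot_leaves: "rot k t t' \<Longrightarrow> leaves t' = leaves t"
  by (induction rule: rot.induct) auto

lemma rot_set: "rot k t t' \<Longrightarrow> labels t' = labels t"
  by (induction rule: rot.induct) auto

lemma rot_distinct_labels: "rot k t t' \<Longrightarrow> distinct_labels t \<Longrightarrow> distinct_labels t'"
  by (induction rule: rot.induct) (auto simp: rot_set)

lemma rot_sym: "rot k t t' \<Longrightarrow> rot k t' t"
  by (induction rule: rot.induct) (auto intro: rot.intros)

lemma rot_root_label: "rot k t t' \<Longrightarrow> root_label t' = root_label t"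
  by (induction rule: rot.induct) auto

lemma rot_label: "rot k t t' \<Longrightarrow> distinct_labels t \<Longrightarrow> k \<in> labels t \<and> k \<noteq> root_label t"
  by (induction rule: rot.induct) auto

lemma rot_exists:
  assumes "k \<in> labels t" "k \<noteq> root_label t"
  shows "\<exists>t'. rot k t t'"
  using assms
proof (induction t)
  case (Node l p r)
  then consider (l) "k \<in> labels l" | (r) "k \<in> labels r" by auto
  then show ?case
  proof cases
    case l
    then show ?thesis
    proof (cases "k = root_label l")
      case True
      with l obtain A Q where "l = Node A k Q" by (cases l) auto
      then show ?thesis by (auto intro: rot.rotR)
    next
      case False
      then obtain t' where "rot k l t'" using Node.IH(1) l by blast
      then show ?thesis by (blast intro: rot.left)
    qed
  next
    case r
    then show ?thesis
    proof (cases "k = root_label r")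
      case True
      with r obtain A Q where "r = Node A k Q" by (cases r) auto
      then show ?thesis by (auto intro: rot.rotL)
    next
      case False
      then obtain t' where "rot k r t'" using Node.IH(2) r by blast
      then show ?thesis by (blast intro: rot.right)
    qed
  qed
qed simp

lemma rot_map_lift:
  assumes "rot k (map_btree f t) s"
  shows "\<exists>k' t'. rot k' t t' \<and> map_btree f t' = s"
  using assms
proof (induction k "map_btree f t" s arbitrary: t rule: rot.induct)
  case (rotR k A Q p S)
  then obtain l p' S' where "t = Node l p' S'" "map_btree f l = Node A k Q" "f p' = p" "map_btree f S' = S"
    by (cases t) auto
  moreover then obtain A' k' Q' where "l = Node A' k' Q'" "map_btree f A' = A" "f k' = k" "map_btree f Q' = Q"
    by (cases l) auto
  ultimately show ?case using rot.rotR[of k' A' Q' p' S'] by force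
next
  case (rotL k A p Q S)
  then obtain l p' A' where "t = Node A' p' l" "map_btree f l = Node Q k S" "f p' = p" "map_btree f A' = A"
    by (cases t) auto
  moreover then obtain S' k' Q' where "l = Node Q' k' S'" "map_btree f S' = S" "f k' = k" "map_btree f Q' = Q"
    by (cases l) auto
  ultimately show ?case using rot.rotL[of k' A' p' Q' S'] by force
next
  case (left k l l' p r)
  then obtain l1 p1 r1 where t: "t = Node l1 p1 r1" "map_btree f l1 = l" "f p1 = p" "map_btree f r1 = r"
    by (cases t) auto
  with left(2)[of l1] obtain k' t' where "rot k' l1 t'" "map_btree f t' = l'" by auto
  then show ?case using t rot.left[of k' l1 t' p1 r1] by (intro exI[of _ k'] exI[of _ "Node t' p1 r1"]) auto
next
  case (right k r r' l p)
  then obtain l1 p1 r1 where t: "t = Node l1 p1 r1" "map_btree f l1 = l" "f p1 = p" "map_btree f r1 = r"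
    by (cases t) auto
  with right(2)[of r1] obtain k' t' where "rot k' r1 t'" "map_btree f t' = r'" by auto
  then show ?case using t rot.right[of k' r1 t' l1 p1] by (intro exI[of _ k'] exI[of _ "Node l1 p1 t'"]) auto
qed

text \<open>
  In a left comb all intervals of nodes start at the same vertex: it is a fan triangulation of the
  half polygon.
\<close>

primrec left_comb :: "'a btree \<Rightarrow> bool" where
  "left_comb Leaf \<longleftrightarrow> True"
| "left_comb (Node l p r) \<longleftrightarrow> left_comb l \<and> r = Leaf"

abbreviation rots :: "'a btree \<Rightarrow> 'a btree \<Rightarrow> bool" where
  "rots \<equiv> (\<lambda>t t'. \<exists>k. rot k t t')\<^sup>*\<^sup>*"

lemma rots_left: "rots l l' \<Longrightarrow> rots (Node l p r) (Node l' p r)"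
proof (induction rule: rtranclp_induct)
  case (step y z)
  then have "\<exists>k. rot k (Node y p r) (Node z p r)" by (blast intro: rot.left)
  with step(3) show ?case by (rule rtranclp.rtrancl_into_rtrancl)
qed simp

lemma rots_sym: "rots t t' \<Longrightarrow> rots t' t"
proof (induction rule: rtranclp_induct)
  case (step y z)
  then have "\<exists>k. rot k z y" by (blast intro: rot_sym)
  then show ?case using step(3) by (rule converse_rtranclp_into_rtranclp)
qed simp

text \<open>
  Rotating the right child of the root to the left shrinks the right subtree; when the right
  subtree is a leaf, the left one is treated by induction.
\<close>

lemma rots_left_comb: "\<exists>t'. rots t t' \<and> left_comb t'"
proof (induction "leaves t" arbitrary: t rule: less_induct)
  case outer: less
  show ?case
  proof (cases t)
    case (Node l p r)
    have "\<exists>t'. rots (Node l p r) t' \<and> left_comb t'" if "leaves l + leaves r = leaves t" for l r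
      using that
    proof (induction "leaves r" arbitrary: l r rule: less_induct)
      case less
      show ?case
      proof (cases r)
        case Leaf
        have "leaves l < leaves t" using less.prems Leaf by simp
        then obtain l' where "rots l l'" "left_comb l'" using outer by blast
        then show ?thesis using rots_left[of l l' p Leaf] Leaf
          by (intro exI[of _ "Node l' p Leaf"]) auto
      next
        case (Node Q k S)
        have "leaves S < leaves r" using Node by simp
        moreover have "leaves (Node l k Q) + leaves S = leaves t" using less.prems Node by simp
        ultimately obtain t' where t': "rots (Node (Node l k Q) p S) t'" "left_comb t'"
          using less.hyps by blast
        have "\<exists>k'. rot k' (Node l p r) (Node (Node l k Q) p S)" unfolding Node by (blast intro: rot.rotL)
        then have "rots (Node l p r) t'" using t'(1) by (rule converse_rtranclp_into_rtranclp)
        with t' show ?thesis by blast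
      qed
    qed
    then show ?thesis using Node by simp
  qed auto
qed

section \<open>Exchange matrices of trees\<close>

text \<open>
  The contribution to the exchange matrix of the triangle whose sides are a node \<open>p\<close> and its
  children \<open>l\<close> and \<open>q\<close>: a cyclic orientation of the three sides. The root is a diameter, hence it
  lies in this triangle and in its image under the half turn, and the orbits of \<open>l\<close> and \<open>q\<close>
  consist of two diagonals each: this doubles the column of the root, \<open>c = 2\<close>. For the other nodes
  \<open>c = 1\<close>.
\<close>

definition triangle :: "int \<Rightarrow> nat \<Rightarrow> nat \<Rightarrow> nat \<Rightarrow> nat \<Rightarrow> nat \<Rightarrow> int" where
  "triangle c p l q i j = (if i = l \<and> j = p then c else 0) - (if i = q \<and> j = p then c else 0)
     - (if i = p \<and> j = l then 1 else 0) + (if i = p \<and> j = q then 1 else 0)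
     + (if i = q \<and> j = l then 1 else 0) - (if i = l \<and> j = q then 1 else 0)"

primrec tree_matrix :: "int \<Rightarrow> nat btree \<Rightarrow> nat \<Rightarrow> nat \<Rightarrow> int" where
  "tree_matrix c Leaf = (\<lambda>i j. 0)"
| "tree_matrix c (Node l p r) = (\<lambda>i j. triangle c p (root_label l) (root_label r) i j + tree_matrix 1 l i j
    + tree_matrix 1 r i j)"

lemma root_label_in: "root_label t \<noteq> 0 \<Longrightarrow> root_label t \<in> labels t"
  by (cases t) auto

lemma root_label_neq: "x \<noteq> 0 \<Longrightarrow> x \<notin> labels t \<Longrightarrow> root_label t \<noteq> x"
  using root_label_in by metis

lemma root_label_disjoint: "labels t \<inter> labels u = {} \<Longrightarrow> root_label t = root_label u \<Longrightarrow> root_label t = 0"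
  using root_label_in by (metis IntI empty_iff)

lemma rotation_labels:
  assumes "distinct_labels (Node (Node A k Q) p S)" "0 \<notin> labels (Node (Node A k Q) p S)"
  shows "k \<noteq> 0" "k \<notin> labels A" "k \<notin> labels Q" "k \<notin> labels S"
    and "p \<noteq> 0" "0 \<notin> labels A" "0 \<notin> labels Q" "0 \<notin> labels S"
    and "p \<noteq> k" "root_label A \<noteq> p" "root_label A \<noteq> k" "root_label Q \<noteq> p" "root_label Q \<noteq> k" "root_label S \<noteq> p"
        "root_label S \<noteq> k"
    and "root_label A = root_label Q \<Longrightarrow> root_label A = 0" "root_label A = root_label S \<Longrightarrow> root_label A = 0"
        "root_label Q = root_label S \<Longrightarrow> root_label Q = 0"
  using assms by (auto simp: root_label_neq intro: root_label_disjoint)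

lemma triangle_outside:
  "i \<noteq> p \<Longrightarrow> i \<noteq> l \<Longrightarrow> i \<noteq> q \<Longrightarrow> triangle c p l q i j = 0"
  "j \<noteq> p \<Longrightarrow> j \<noteq> l \<Longrightarrow> j \<noteq> q \<Longrightarrow> triangle c p l q i j = 0"
  by (auto simp: triangle_def)

lemma tree_matrix_outside:
  "i \<noteq> 0 \<Longrightarrow> i \<notin> labels t \<Longrightarrow> tree_matrix c t i j = 0"
  "i \<noteq> 0 \<Longrightarrow> i \<notin> labels t \<Longrightarrow> tree_matrix c t j i = 0"
proof (induction t arbitrary: c)
  case (Node l p r)
  {
    case 1
    then have "i \<noteq> root_label l" "i \<noteq> root_label r" using root_label_in[of l] root_label_in[of r] by auto
    with 1 Node show ?case by (simp add: triangle_outside)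
  next
    case 2
    then have "i \<noteq> root_label l" "i \<noteq> root_label r" using root_label_in[of l] root_label_in[of r] by auto
    with 2 Node show ?case by (simp add: triangle_outside)
  }
qed auto

text \<open>
  Summands that vanish in the row and in the column of \<open>k\<close> are not affected by the mutation at
  \<open>k\<close>. So only the two triangles with side \<open>k\<close> matter.
\<close>

lemma mutate_matrix_local:
  assumes "Y i k = 0" "Y k j = 0" "B i j = X i j + Y i j" "B i k = X i k + Y i k" "B k j = X k j + Y k j"
  shows "mutate_matrix k B i j = mutate_matrix k X i j + Y i j"
  using assms by (auto simp: mutate_matrix_def)

text \<open>
  The flip inside a quadrilateral with sides \<open>p\<close>, \<open>a\<close>, \<open>q\<close>, \<open>s\<close>: the two triangles on one diagonal
  are exchanged for the two triangles on the other. Sides that are edges of the polygon have the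
  label 0, which may occur repeatedly.
\<close>

lemma triangle_flip:
  assumes ne: "p \<noteq> k" "a \<noteq> p" "a \<noteq> k" "q \<noteq> p" "q \<noteq> k" "s \<noteq> p" "s \<noteq> k"
    and z: "a = q \<Longrightarrow> a = 0" "a = s \<Longrightarrow> a = 0" "q = s \<Longrightarrow> q = 0" and c: "0 < c" and "i \<noteq> 0" "j \<noteq> 0"
  shows "mutate_matrix k (\<lambda>i j. triangle c p k s i j + triangle 1 k a q i j) i j = triangle c p a k i j
      + triangle 1 k q s i j"
    and "mutate_matrix k (\<lambda>i j. triangle c p a k i j + triangle 1 k q s i j) i j = triangle c p k s i j
        + triangle 1 k a q i j"
proof -
  have cases: thesis
    if "\<lbrakk>i = p; i \<noteq> k; i \<noteq> a; i \<noteq> q; i \<noteq> s\<rbrakk> \<Longrightarrow> thesis" "\<lbrakk>i = k; i \<noteq> p; i \<noteq> a; i \<noteq> q; i \<noteq> s\<rbrakk> \<Longrightarrow> thesis"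
      "\<lbrakk>i = a; i \<noteq> p; i \<noteq> k; i \<noteq> q; i \<noteq> s\<rbrakk> \<Longrightarrow> thesis" "\<lbrakk>i = q; i \<noteq> p; i \<noteq> k; i \<noteq> a; i \<noteq> s\<rbrakk> \<Longrightarrow> thesis"
      "\<lbrakk>i = s; i \<noteq> p; i \<noteq> k; i \<noteq> a; i \<noteq> q\<rbrakk> \<Longrightarrow> thesis" "\<lbrakk>i \<noteq> s; i \<noteq> p; i \<noteq> k; i \<noteq> a; i \<noteq> q\<rbrakk> \<Longrightarrow> thesis"
      "i \<noteq> 0"
    for thesis i using that ne z by metis
  note I = cases[of i, OF _ _ _ _ _ _ \<open>i \<noteq> 0\<close>] and J = cases[of j, OF _ _ _ _ _ _ \<open>j \<noteq> 0\<close>]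
  have m: "max (- c) 0 = 0" "max c 0 = c" "sgn c = 1" using c by auto
  show "mutate_matrix k (\<lambda>i j. triangle c p k s i j + triangle 1 k a q i j) i j = triangle c p a k i j
      + triangle 1 k q s i j"
    unfolding mutate_matrix_def triangle_def
    by (rule I; rule J) (simp_all add: ne ne[symmetric] m)
  show "mutate_matrix k (\<lambda>i j. triangle c p a k i j + triangle 1 k q s i j) i j = triangle c p k s i j
      + triangle 1 k a q i j"
    unfolding mutate_matrix_def triangle_def
    by (rule I; rule J) (simp_all add: ne ne[symmetric] m)
qed

lemma triangle_root_flip:
  assumes ne: "l \<noteq> k" "q \<noteq> k" and z: "l = q \<Longrightarrow> l = 0" and "i \<noteq> 0" "j \<noteq> 0"
  shows "mutate_matrix k (triangle 2 k l q) i j = triangle 2 k q l i j"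
proof -
  have cases: thesis
    if "\<lbrakk>i = k; i \<noteq> l; i \<noteq> q\<rbrakk> \<Longrightarrow> thesis" "\<lbrakk>i = l; i \<noteq> k; i \<noteq> q\<rbrakk> \<Longrightarrow> thesis"
      "\<lbrakk>i = q; i \<noteq> k; i \<noteq> l\<rbrakk> \<Longrightarrow> thesis" "\<lbrakk>i \<noteq> k; i \<noteq> l; i \<noteq> q\<rbrakk> \<Longrightarrow> thesis" "i \<noteq> 0"
    for thesis i using that ne z by metis
  note I = cases[of i, OF _ _ _ _ \<open>i \<noteq> 0\<close>] and J = cases[of j, OF _ _ _ _ \<open>j \<noteq> 0\<close>]
  show ?thesis
    unfolding mutate_matrix_def triangle_def
    by (rule I; rule J) (simp_all add: ne ne[symmetric])
qed

lemma tree_matrix_rot: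
  assumes "rot k t t'" "distinct_labels t" "0 \<notin> labels t" "0 < c" "i \<noteq> 0" "j \<noteq> 0"
  shows "mutate_matrix k (tree_matrix c t) i j = tree_matrix c t' i j"
  using assms
proof (induction arbitrary: c rule: rot.induct)
  case (rotR k A Q p S)
  let ?X = "\<lambda>i j. triangle c p k (root_label S) i j + triangle 1 k (root_label A) (root_label Q) i j"
  let ?Y = "\<lambda>i j. tree_matrix 1 A i j + tree_matrix 1 Q i j + tree_matrix 1 S i j"
  have distinct_labels: "distinct_labels (Node (Node A k Q) p S)" "0 \<notin> labels (Node (Node A k Q) p S)" using rotR
      by auto
  note k = rotation_labels(1-4)[OF distinct_labels]
  have "mutate_matrix k (tree_matrix c (Node (Node A k Q) p S)) i j = mutate_matrix k ?X i j + ?Y i j"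
    using k by (intro mutate_matrix_local) (auto simp: tree_matrix_outside)
  also have "mutate_matrix k ?X i j = triangle c p (root_label A) k i j
      + triangle 1 k (root_label Q) (root_label S) i j"
    using rotR rotation_labels(9-18)[OF distinct_labels] by (intro triangle_flip) blast+
  finally show ?case by simp
next
  case (rotL k A p Q S)
  let ?X = "\<lambda>i j. triangle c p (root_label A) k i j + triangle 1 k (root_label Q) (root_label S) i j"
  let ?Y = "\<lambda>i j. tree_matrix 1 A i j + tree_matrix 1 Q i j + tree_matrix 1 S i j"
  have distinct_labels: "distinct_labels (Node (Node A k Q) p S)" "0 \<notin> labels (Node (Node A k Q) p S)" using rotL
      by auto
  note k = rotation_labels(1-4)[OF distinct_labels]
  have "mutate_matrix k (tree_matrix c (Node A p (Node Q k S))) i j = mutate_matrix k ?X i j + ?Y i j"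
    using k by (intro mutate_matrix_local) (auto simp: tree_matrix_outside)
  also have "mutate_matrix k ?X i j = triangle c p k (root_label S) i j
      + triangle 1 k (root_label A) (root_label Q) i j"
    using rotL rotation_labels(9-18)[OF distinct_labels] by (intro triangle_flip) blast+
  finally show ?case by simp
next
  case (left k l l' p r)
  have k: "k \<noteq> 0" "k \<in> labels l" "k \<noteq> root_label l" "k \<notin> labels r" "k \<noteq> p"
    using left rot_label[OF left(1)] by auto
  then have "k \<noteq> root_label r" using root_label_neq[of k r] by blast
  note k = k this
  let ?Y = "\<lambda>i j. triangle c p (root_label l) (root_label r) i j + tree_matrix 1 r i j"
  have "mutate_matrix k (tree_matrix c (Node l p r)) i j = mutate_matrix k (tree_matrix 1 l) i j + ?Y i j"
    using k by (intro mutate_matrix_local) (auto simp: tree_matrix_outside triangle_outside)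
  also have "mutate_matrix k (tree_matrix 1 l) i j = tree_matrix 1 l' i j" using left by auto
  finally show ?case using rot_root_label[OF left(1)] by simp
next
  case (right k r r' l p)
  have k: "k \<noteq> 0" "k \<in> labels r" "k \<noteq> root_label r" "k \<notin> labels l" "k \<noteq> p"
    using right rot_label[OF right(1)] by auto
  then have "k \<noteq> root_label l" using root_label_neq[of k l] by blast
  note k = k this
  let ?Y = "\<lambda>i j. triangle c p (root_label l) (root_label r) i j + tree_matrix 1 l i j"
  have "mutate_matrix k (tree_matrix c (Node l p r)) i j = mutate_matrix k (tree_matrix 1 r) i j + ?Y i j"
    using k by (intro mutate_matrix_local) (auto simp: tree_matrix_outside triangle_outside)
  also have "mutate_matrix k (tree_matrix 1 r) i j = tree_matrix 1 r' i j" using right by auto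
  finally show ?case using rot_root_label[OF right(1)] by simp
qed

lemma tree_matrix_root_flip:
  assumes "distinct_labels (Node l k r)" "0 \<notin> labels (Node l k r)" "i \<noteq> 0" "j \<noteq> 0"
  shows "mutate_matrix k (tree_matrix 2 (Node l k r)) i j = tree_matrix 2 (Node r k l) i j"
proof -
  let ?Y = "\<lambda>i j. tree_matrix 1 l i j + tree_matrix 1 r i j"
  have k: "k \<noteq> 0" "k \<notin> labels l" "k \<notin> labels r" using assms by auto
  have "mutate_matrix k (tree_matrix 2 (Node l k r)) i j = mutate_matrix k (triangle 2 k (root_label l) (root_label
      r)) i j + ?Y i j"
    using k by (intro mutate_matrix_local) (auto simp: tree_matrix_outside)
  also have "mutate_matrix k (triangle 2 k (root_label l) (root_label r)) i j
      = triangle 2 k (root_label r) (root_label l) i j"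
    using assms k by (intro triangle_root_flip) (auto simp: root_label_neq intro: root_label_disjoint)
  finally show ?thesis by simp
qed

section \<open>Intervals and frozen rows\<close>

text \<open>
  The leaves of a tree are the unit intervals from \<open>a\<close> on, that is, edges of the polygon.
\<close>

primrec intervals :: "nat \<Rightarrow> 'a btree \<Rightarrow> ('a \<times> nat \<times> nat) set" where
  "intervals a Leaf = {}"
| "intervals a (Node l p r) = insert (p, a, a + leaves l + leaves r) (intervals a l \<union> intervals (a + leaves l) r)"

lemma intervals_bounds: "(k, i, j) \<in> intervals a t \<Longrightarrow> a \<le> i \<and> i + 2 \<le> j \<and> j \<le> a + leaves t \<and> k \<in> labels t"
proof (induction t arbitrary: a)
  case (Node l p r)
  have "1 \<le> leaves l" "1 \<le> leaves r" using leaves_pos[of l] leaves_pos[of r] by linarith+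
  with Node.IH(1)[of a] Node.IH(2)[of "a + leaves l"] Node.prems show ?case by auto
qed simp

lemma interval_of_label: "k \<in> labels t \<Longrightarrow> \<exists>i j. (k, i, j) \<in> intervals a t"
  by (induction t arbitrary: a) (auto, blast+)

lemma intervals_unique: "distinct_labels t \<Longrightarrow> (k, i, j) \<in> intervals a t \<Longrightarrow> (k, i', j') \<in> intervals a t \<Longrightarrow> i = i' \<and> j
    = j'"
proof (induction t arbitrary: a)
  case (Node l p r)
  then show ?case
    using intervals_bounds[of k i j a l] intervals_bounds[of k i' j' a l]
      intervals_bounds[of k i j "a + leaves l" r] intervals_bounds[of k i' j' "a + leaves l" r] by auto
qed simp

lemma intervals_inj: "distinct_labels t \<Longrightarrow> (k, i, j) \<in> intervals a t \<Longrightarrow> (k', i, j) \<in> intervals a t \<Longrightarrow> k = k'"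
proof (induction t arbitrary: a)
  case (Node l p r)
  have "0 < leaves l" "0 < leaves r" by simp_all
  with Node show ?case
    using intervals_bounds[of k i j a l] intervals_bounds[of k' i j a l]
      intervals_bounds[of k i j "a + leaves l" r] intervals_bounds[of k' i j "a + leaves l" r] by auto
qed simp

lemma leaves_map [simp]: "leaves (map_btree f t) = leaves t"
  by (induction t) auto

lemma intervals_map: "intervals a (map_btree f t) = (\<lambda>(k, i, j). (f k, i, j)) ` intervals a t"
  by (induction t arbitrary: a) (auto simp: image_Un)

lemma intervals_root_label: "t \<noteq> Leaf \<Longrightarrow> (root_label t, a, a + leaves t) \<in> intervals a t"
  by (cases t) auto

lemma intervals_rot: "rot k t t' \<Longrightarrow> (k', i, j) \<in> intervals a t' \<Longrightarrow> k' \<noteq> k \<Longrightarrow> (k', i, j) \<in> intervals a t"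
proof (induction arbitrary: a rule: rot.induct)
  case (left k l l' p r)
  then show ?case using rot_leaves[OF left(1)] by auto
next
  case (right k r r' l p)
  then show ?case using rot_leaves[OF right(1)] by auto
qed (auto simp: add_ac)

text \<open>
  The row of a frozen variable: the shear coordinates of a function \<open>E\<close> on intervals, written as a
  sum over the triangles of the tree. The shear coordinate of a diagonal of a quadrilateral is the
  difference of the sums of \<open>E\<close> over the two pairs of opposite sides. At the root \<open>c = 2\<close> as in
  \<open>triangle\<close>, and \<open>\<kappa>\<close> corrects for the fact that \<open>E\<close> is invariant under the half turn only up to
  the constant \<open>\<kappa>\<close>.
\<close>

primrec frozen_row :: "(nat \<Rightarrow> nat \<Rightarrow> int) \<Rightarrow> int \<Rightarrow> int \<Rightarrow> nat \<Rightarrow> nat btree \<Rightarrow> nat \<Rightarrow> int" where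
  "frozen_row E c \<kappa> a Leaf = (\<lambda>j. 0)"
| "frozen_row E c \<kappa> a (Node l p r) = (\<lambda>j.
     (if j = p then c * (E (a + leaves l) (a + leaves l + leaves r) - E a (a + leaves l)) - \<kappa> else 0)
   + (if j = root_label l then E a (a + leaves l + leaves r) - E (a + leaves l) (a + leaves l + leaves r) else 0)
   + (if j = root_label r then E a (a + leaves l) - E a (a + leaves l + leaves r) else 0)
   + frozen_row E 1 0 a l j + frozen_row E 1 0 (a + leaves l) r j)"

definition mutate_row :: "nat \<Rightarrow> (nat \<Rightarrow> int) \<Rightarrow> (nat \<Rightarrow> int) \<Rightarrow> nat \<Rightarrow> int" where
  "mutate_row k r b j = (if j = k then - r k else r j + sgn (r k) * max (r k * b j) 0)"

lemma mutate_matrix_row: "f \<noteq> k \<Longrightarrow> mutate_matrix k B f j = mutate_row k (B f) (B k) j"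
  by (auto simp: mutate_matrix_def mutate_row_def)

lemma frozen_row_outside: "j \<noteq> 0 \<Longrightarrow> j \<notin> labels t \<Longrightarrow> frozen_row E c \<kappa> a t j = 0"
proof (induction t arbitrary: a c \<kappa>)
  case (Node l p r)
  have "j \<noteq> root_label l" "j \<noteq> root_label r" using Node.prems root_label_neq[of j l] root_label_neq[of j r] by auto
  with Node show ?case by simp
qed simp

lemma mutate_row_local:
  assumes "y k = 0" "z j = 0 \<or> j = k" "r j = x j + y j" "r k = x k" "b j = b' j + z j"
  shows "mutate_row k r b j = mutate_row k x b' j + y j"
  using assms by (auto simp: mutate_row_def)

definition max_ptolemy :: "(nat \<Rightarrow> nat \<Rightarrow> int) \<Rightarrow> nat \<Rightarrow> nat \<Rightarrow> nat \<Rightarrow> nat \<Rightarrow> bool" where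
  "max_ptolemy E a b c d \<longleftrightarrow> E a c + E b d = max (E a b + E c d) (E a d + E b c)"

text \<open>
  With \<open>w\<close> the shear coordinate of the flipped diagonal, the Ptolemy relation says that the sum of
  \<open>E\<close> over the two diagonals exceeds the sum over one pair of opposite sides by \<open>max w 0\<close>; this is
  the increment prescribed by the mutation rule.
\<close>

lemma frozen_row_flip:
  assumes ne: "p \<noteq> k" "a \<noteq> p" "a \<noteq> k" "q \<noteq> p" "q \<noteq> k" "s \<noteq> p" "s \<noteq> k"
    and z: "a = q \<Longrightarrow> a = 0" "a = s \<Longrightarrow> a = 0" "q = s \<Longrightarrow> q = 0" and c: "0 < c" and "j \<noteq> 0"
    and E: "eac + ebd = max (eab + ecd) (ead + ebc)"
  shows "mutate_row k
      (\<lambda>j. (if j = p then c * (ecd - eac) - \<kappa> else 0) + (if j = k then ead - ecd else 0) + (if j = s then eac - ead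
          else 0)
         + ((if j = k then ebc - eab else 0) + (if j = a then eac - ebc else 0) + (if j = q then eab - eac else 0)))
      (\<lambda>j. triangle c p k s k j + triangle 1 k a q k j) j
    = (if j = p then c * (ebd - eab) - \<kappa> else 0) + (if j = a then ead - ebd else 0) + (if j = k then eab - ead else 0)
         + ((if j = k then ecd - ebc else 0) + (if j = q then ebd - ecd else 0) + (if j = s then ebc - ebd else 0))"
    (is ?th1)
    and "mutate_row k
      (\<lambda>j. (if j = p then c * (ebd - eab) - \<kappa> else 0) + (if j = a then ead - ebd else 0) + (if j = k then eab - ead
          else 0)
         + ((if j = k then ecd - ebc else 0) + (if j = q then ebd - ecd else 0) + (if j = s then ebc - ebd else 0)))
      (\<lambda>j. triangle c p a k k j + triangle 1 k q s k j) j
    = (if j = p then c * (ecd - eac) - \<kappa> else 0) + (if j = k then ead - ecd else 0) + (if j = s then eac - ead else 0)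
         + ((if j = k then ebc - eab else 0) + (if j = a then eac - ebc else 0) + (if j = q then eab - eac else 0))"
    (is ?th2)
proof -
  have cases: thesis
    if "\<lbrakk>j = p; j \<noteq> k; j \<noteq> a; j \<noteq> q; j \<noteq> s\<rbrakk> \<Longrightarrow> thesis" "\<lbrakk>j = k; j \<noteq> p; j \<noteq> a; j \<noteq> q; j \<noteq> s\<rbrakk> \<Longrightarrow> thesis"
      "\<lbrakk>j = a; j \<noteq> p; j \<noteq> k; j \<noteq> q; j \<noteq> s\<rbrakk> \<Longrightarrow> thesis" "\<lbrakk>j = q; j \<noteq> p; j \<noteq> k; j \<noteq> a; j \<noteq> s\<rbrakk> \<Longrightarrow> thesis"
      "\<lbrakk>j = s; j \<noteq> p; j \<noteq> k; j \<noteq> a; j \<noteq> q\<rbrakk> \<Longrightarrow> thesis" "\<lbrakk>j \<noteq> s; j \<noteq> p; j \<noteq> k; j \<noteq> a; j \<noteq> q\<rbrakk> \<Longrightarrow> thesis"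
    for thesis using that ne z \<open>j \<noteq> 0\<close> by metis
  \<comment> \<open>The shear coordinate of the flipped diagonal.\<close>
  define w where "w = ead + ebc - eab - ecd"
  have ebd: "ebd = max w 0 + eab + ecd - eac" using E unfolding w_def by linarith
  have ead: "ead = w - ebc + eab + ecd" unfolding w_def by simp
  consider "w = 0" | "w > 0" "w * c > 0" "\<not> w * c < 0" | "w < 0" "w * c < 0" "\<not> w * c > 0"
    using c mult_pos_pos[of w c] mult_neg_pos[of w c] by linarith
  note wcases = this
  show ?th1
    unfolding mutate_row_def triangle_def
    by (rule cases; rule wcases; simp add: ne ne[symmetric] ebd ead; simp add: max_def algebra_simps)
  show ?th2
    unfolding mutate_row_def triangle_def
    by (rule cases; rule wcases; simp add: ne ne[symmetric] ebd ead; simp add: max_def algebra_simps)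
qed

lemma frozen_row_shift:
  assumes "\<And>i j. a \<le> i \<Longrightarrow> i < j \<Longrightarrow> j \<le> a + leaves t \<Longrightarrow> E (i + N) (j + N) = E i j + \<kappa>"
  shows "frozen_row E c \<kappa>' (a + N) t j = frozen_row E c \<kappa>' a t j"
  using assms
proof (induction t arbitrary: a c \<kappa>')
  case (Node l p r)
  have l: "frozen_row E 1 0 (a + N) l j = frozen_row E 1 0 a l j" using Node.prems by (intro Node.IH) auto
  have r: "frozen_row E 1 0 (a + leaves l + N) r j = frozen_row E 1 0 (a + leaves l) r j" using Node.prems
      by (intro Node.IH) auto
  have "a + N + leaves l = a + leaves l + N" "a + N + leaves l + leaves r = a + leaves l + leaves r + N" by simp_all
  then show ?case
    using l r Node.prems[of a "a + leaves l"] Node.prems[of "a + leaves l" "a + leaves l + leaves r"]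
      Node.prems[of a "a + leaves l + leaves r"] leaves_pos[of l] leaves_pos[of r] by (simp add: algebra_simps)
qed simp

lemma frozen_row_rot:
  assumes "rot k t t'" "distinct_labels t" "0 \<notin> labels t" "0 < c" "j \<noteq> 0"
    "\<And>b0 b1 b2 b3. \<lbrakk>a \<le> b0; b0 < b1; b1 < b2; b2 < b3; b3 \<le> a + leaves t\<rbrakk> \<Longrightarrow> max_ptolemy E b0 b1 b2 b3"
  shows "mutate_row k (frozen_row E c \<kappa> a t) (tree_matrix c t k) j = frozen_row E c \<kappa> a t' j"
  using assms
proof (induction arbitrary: a c \<kappa> rule: rot.induct)
  case (rotR k A Q p S)
  have distinct_labels: "distinct_labels (Node (Node A k Q) p S)" "0 \<notin> labels (Node (Node A k Q) p S)" using rotR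
      by auto
  note k = rotation_labels(1-4)[OF distinct_labels] and * = rotation_labels(5-8)[OF distinct_labels]
    and ne = rotation_labels(9-15)[OF distinct_labels] and z = rotation_labels(16-18)[OF distinct_labels]
  have "max_ptolemy E a (a + leaves A) (a + leaves A + leaves Q) (a + leaves A + leaves Q + leaves S)"
    using leaves_pos[of A] leaves_pos[of Q] leaves_pos[of S] by (intro rotR) auto
  note fl = frozen_row_flip(1)[OF ne z \<open>0 < c\<close> \<open>j \<noteq> 0\<close> this[unfolded max_ptolemy_def], of \<kappa>]
  let ?y = "\<lambda>j. frozen_row E 1 0 a A j + frozen_row E 1 0 (a + leaves A) Q j + frozen_row E 1 0 (a + leaves A
      + leaves Q) S j"
  show ?case
    by (rule trans[OF mutate_row_local[where y = ?y and z =
        "\<lambda>j. tree_matrix 1 A k j + tree_matrix 1 Q k j + tree_matrix 1 S k j"]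
          trans[OF arg_cong[OF fl, of "\<lambda>v. v + ?y j"]]])
      (use k ne in \<open>simp_all add: frozen_row_outside tree_matrix_outside add_ac\<close>)
next
  case (rotL k A p Q S)
  have distinct_labels: "distinct_labels (Node (Node A k Q) p S)" "0 \<notin> labels (Node (Node A k Q) p S)" using rotL
      by auto
  note k = rotation_labels(1-4)[OF distinct_labels] and * = rotation_labels(5-8)[OF distinct_labels]
    and ne = rotation_labels(9-15)[OF distinct_labels] and z = rotation_labels(16-18)[OF distinct_labels]
  have "max_ptolemy E a (a + leaves A) (a + leaves A + leaves Q) (a + leaves A + leaves Q + leaves S)"
    using leaves_pos[of A] leaves_pos[of Q] leaves_pos[of S] by (intro rotL) auto
  note fl = frozen_row_flip(2)[OF ne z \<open>0 < c\<close> \<open>j \<noteq> 0\<close> this[unfolded max_ptolemy_def], of \<kappa>]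
  let ?y = "\<lambda>j. frozen_row E 1 0 a A j + frozen_row E 1 0 (a + leaves A) Q j + frozen_row E 1 0 (a + leaves A
      + leaves Q) S j"
  show ?case
    by (rule trans[OF mutate_row_local[where y = ?y and z =
        "\<lambda>j. tree_matrix 1 A k j + tree_matrix 1 Q k j + tree_matrix 1 S k j"]
          trans[OF arg_cong[OF fl, of "\<lambda>v. v + ?y j"]]])
      (use k ne in \<open>simp_all add: frozen_row_outside tree_matrix_outside add_ac\<close>)
next
  case (left k l l' p r)
  have k: "k \<noteq> 0" "k \<in> labels l" "k \<noteq> root_label l" "k \<notin> labels r" "k \<noteq> p"
    using left rot_label[OF left(1)] by auto
  then have "k \<noteq> root_label r" using root_label_neq[of k r] by blast
  note k = k this
  let ?x = "frozen_row E 1 0 a l"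
  let ?y = "\<lambda>j. frozen_row E c \<kappa> a (Node l p r) j - ?x j"
  have "mutate_row k (frozen_row E c \<kappa> a (Node l p r)) (tree_matrix c (Node l p r) k) j
      = mutate_row k ?x (tree_matrix 1 l k) j + ?y j"
    using k by (intro mutate_row_local[where z =
        "\<lambda>j. triangle c p (root_label l) (root_label r) k j + tree_matrix 1 r k j"])
       (simp_all add: frozen_row_outside tree_matrix_outside triangle_outside)
  also have "mutate_row k ?x (tree_matrix 1 l k) j = frozen_row E 1 0 a l' j"
    using left(3-6) by (intro left(2)) (auto intro: left(7))
  finally show ?case using rot_root_label[OF left(1)] rot_leaves[OF left(1)] by simp
next
  case (right k r r' l p)
  have k: "k \<noteq> 0" "k \<in> labels r" "k \<noteq> root_label r" "k \<notin> labels l" "k \<noteq> p"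
    using right rot_label[OF right(1)] by auto
  then have "k \<noteq> root_label l" using root_label_neq[of k l] by blast
  note k = k this
  let ?x = "frozen_row E 1 0 (a + leaves l) r"
  let ?y = "\<lambda>j. frozen_row E c \<kappa> a (Node l p r) j - ?x j"
  have "mutate_row k (frozen_row E c \<kappa> a (Node l p r)) (tree_matrix c (Node l p r) k) j
      = mutate_row k ?x (tree_matrix 1 r k) j + ?y j"
    using k by (intro mutate_row_local[where z =
        "\<lambda>j. triangle c p (root_label l) (root_label r) k j + tree_matrix 1 l k j"])
       (simp_all add: frozen_row_outside tree_matrix_outside triangle_outside)
  also have "mutate_row k ?x (tree_matrix 1 r k) j = frozen_row E 1 0 (a + leaves l) r' j"
    using right(3-6) by (intro right(2)) (auto intro: right(7))
  finally show ?case using rot_root_label[OF right(1)] rot_leaves[OF right(1)] by simp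
qed

text \<open>
  Here the left subtree reappears shifted by \<open>N\<close>. The shift adds \<open>\<kappa>\<close> to all values of \<open>E\<close> and
  leaves its shear coordinates unchanged.
\<close>

lemma frozen_row_root_flip:
  assumes "distinct_labels (Node l k r)" "0 \<notin> labels (Node l k r)" "j \<noteq> 0"
    and N: "N = leaves l + leaves r"
    and shift: "\<And>i j. i < j \<Longrightarrow> j \<le> i + N \<Longrightarrow> E (i + N) (j + N) = E i j + \<kappa>"
    and rel: "E a (a + N) + E (a + leaves l) (a + leaves l + N) = max (2 * E a (a + leaves l) + \<kappa>) (2 * E (a
        + leaves l) (a + N))"
  shows "mutate_row k (frozen_row E 2 \<kappa> a (Node l k r)) (tree_matrix 2 (Node l k r) k) j = frozen_row E 2 \<kappa> (a
      + leaves l) (Node r k l) j"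
proof -
  let ?b = "a + leaves l"
  have k: "k \<noteq> 0" "k \<notin> labels l" "k \<notin> labels r" using assms by auto
  have ne: "k \<noteq> root_label l" "k \<noteq> root_label r" using k root_label_neq[of k l] root_label_neq[of k r] by auto
  have dj: "root_label l = root_label r \<Longrightarrow> root_label l = 0" using assms root_label_disjoint by auto
  have e1: "E ?b (?b + leaves r + leaves l) = max (2 * E a ?b + \<kappa>) (2 * E ?b (a + N)) - E a (a + N)"
    using rel unfolding N by (simp add: add_ac)
  have e2: "E (?b + leaves r) (?b + leaves r + leaves l) = E a ?b + \<kappa>"
    using shift[of a ?b] leaves_pos[of l] unfolding N by (simp add: add_ac)
  have e3: "frozen_row E 1 0 (?b + leaves r) l j = frozen_row E 1 0 a l j"
    using frozen_row_shift[of a l E N \<kappa> 1 0 j] shift unfolding N by (simp add: add_ac)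
  define w where "w = 2 * (E ?b (a + N) - E a ?b) - \<kappa>"
  have e4: "E ?b (?b + leaves r) = E ?b (a + N)" unfolding N by (simp add: add_ac)
  have eN: "a + leaves l + leaves r = a + N" unfolding N by simp
  have row: "frozen_row E 2 \<kappa> a (Node l k r) k = w" using k ne by (simp add: frozen_row_outside w_def eN)
  have b: "tree_matrix 2 (Node l k r) k j = (if j = root_label r then 1 else if j = root_label l then - 1 else 0)"
    using k ne dj \<open>j \<noteq> 0\<close> by (auto simp: tree_matrix_outside triangle_def)
  have mx: "max (2 * E a ?b + \<kappa>) (2 * E ?b (a + N)) = 2 * E a ?b + \<kappa> + max w 0"
    unfolding w_def by simp
  have lt: "sgn w * max w 0 = max w 0" "sgn w * max (- w) 0 = w - max w 0"
    by (auto simp: sgn_if max_def)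
  consider "j = k" "j \<noteq> root_label l" "j \<noteq> root_label r" | "j = root_label l" "j \<noteq> k" "j \<noteq> root_label r"
    | "j = root_label r" "j \<noteq> k" "j \<noteq> root_label l" | "j \<noteq> k" "j \<noteq> root_label l" "j \<noteq> root_label r"
    using ne dj \<open>j \<noteq> 0\<close> by metis
  then show ?thesis
  proof cases
    case 1
    then show ?thesis unfolding mutate_row_def row using k
      by (simp add: frozen_row_outside w_def e2 e4)
  next
    case 2
    then have "mutate_row k (frozen_row E 2 \<kappa> a (Node l k r)) (tree_matrix 2 (Node l k r) k) j
       = E a (a + N) - E ?b (a + N) + frozen_row E 1 0 a l j + frozen_row E 1 0 ?b r j + (w - max w 0)"
      unfolding mutate_row_def row b by (simp add: lt eN)
    also have "\<dots> = frozen_row E 2 \<kappa> ?b (Node r k l) j"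
      using 2 e3 by (simp add: e1 e2 e4 mx) (simp add: w_def)
    finally show ?thesis .
  next
    case 3
    then have "mutate_row k (frozen_row E 2 \<kappa> a (Node l k r)) (tree_matrix 2 (Node l k r) k) j
       = E a ?b - E a (a + N) + frozen_row E 1 0 a l j + frozen_row E 1 0 ?b r j + max w 0"
      unfolding mutate_row_def row b by (simp add: lt eN)
    also have "\<dots> = frozen_row E 2 \<kappa> ?b (Node r k l) j"
      using 3 e3 by (simp add: e1 e2 e4 mx)
    finally show ?thesis .
  next
    case 4
    then show ?thesis unfolding mutate_row_def row b by (simp add: e3)
  qed
qed

section \<open>The quadrilateral of a rotation\<close>

text \<open>
  Sides of triangles: either an edge of the polygon, with label 0, or a node.
\<close>

definition edge :: "nat \<Rightarrow> nat btree \<Rightarrow> nat \<Rightarrow> nat \<Rightarrow> nat \<Rightarrow> bool" where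
  "edge a t u i j \<longleftrightarrow> (u = 0 \<and> j = Suc i) \<or> (u \<noteq> 0 \<and> (u, i, j) \<in> intervals a t)"

lemma edge_root_label: "0 \<notin> labels t \<Longrightarrow> edge a t (root_label t) a (a + leaves t)"
  by (cases t) (auto simp: edge_def)

lemma edge_left: "edge a l u i j \<Longrightarrow> edge a (Node l p r) u i j"
  and edge_right: "edge (a + leaves l) r u i j \<Longrightarrow> edge a (Node l p r) u i j"
  by (auto simp: edge_def)

text \<open>
  The diagonal \<open>k\<close> of \<open>t\<close> and the diagonal \<open>k\<close> of \<open>t'\<close> are the two diagonals of the quadrilateral
  with vertices \<open>b0 < b1 < b2 < b3\<close>. The sign \<open>s\<close> tells which of the two belongs to \<open>t\<close>; it is the
  sign by which the column \<open>k\<close> and the shear coordinate at \<open>k\<close> differ in the two cases. The column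
  records the exchange relation.
\<close>

definition flip_quadrilateral where
  "flip_quadrilateral c a t t' k b0 b1 b2 b3 u01 u23 u03 u12 s \<longleftrightarrow>
     a \<le> b0 \<and> b0 < b1 \<and> b1 < b2 \<and> b2 < b3 \<and> b3 \<le> a + leaves t \<and>
     distinct (filter (\<lambda>u. u \<noteq> 0) [k, u01, u23, u03, u12]) \<and>
     edge a t u01 b0 b1 \<and> edge a t u23 b2 b3 \<and> edge a t u03 b0 b3 \<and> edge a t u12 b1 b2 \<and>
     (s = 1 \<and> (k, b0, b2) \<in> intervals a t \<and> (k, b1, b3) \<in> intervals a t' \<or>
      s = -1 \<and> (k, b1, b3) \<in> intervals a t \<and> (k, b0, b2) \<in> intervals a t') \<and>
     (\<forall>i. i \<noteq> 0 \<longrightarrow> tree_matrix c t i k = s * (of_bool (i = u01) + of_bool (i = u23) - of_bool (i = u03) - of_bool (i =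
         u12))) \<and>
     (\<forall>E \<kappa>. frozen_row E c \<kappa> a t k = s * (E b0 b3 + E b1 b2 - E b0 b1 - E b2 b3))"

lemma rot_flip_quadrilateral:
  assumes "rot k t t'" "distinct_labels t" "0 \<notin> labels t"
  shows "\<exists>b0 b1 b2 b3 u01 u23 u03 u12 s. flip_quadrilateral c a t t' k b0 b1 b2 b3 u01 u23 u03 u12 (s :: int)"
  using assms
proof (induction arbitrary: a c rule: rot.induct)
  case (rotR k A Q p S)
  have distinct_labels: "distinct_labels (Node (Node A k Q) p S)" "0 \<notin> labels (Node (Node A k Q) p S)" using rotR
      by auto
  note k = rotation_labels(1-4)[OF distinct_labels] and * = rotation_labels(5-8)[OF distinct_labels]
    and ne = rotation_labels(9-15)[OF distinct_labels] and z = rotation_labels(16-18)[OF distinct_labels]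
  have "flip_quadrilateral c a (Node (Node A k Q) p S) (Node A p (Node Q k S)) k
      a (a + leaves A) (a + leaves A + leaves Q) (a + leaves A + leaves Q + leaves S) (root_label A) (root_label S) p
          (root_label Q) 1"
    unfolding flip_quadrilateral_def
  proof (intro conjI disjI1 allI impI)
    show "distinct (filter (\<lambda>u. u \<noteq> 0) [k, root_label A, root_label S, p, root_label Q])"
      using k * ne z by auto
    show "edge a (Node (Node A k Q) p S) (root_label A) a (a + leaves A)"
      by (intro edge_left edge_root_label *)
    show "edge a (Node (Node A k Q) p S) (root_label Q) (a + leaves A) (a + leaves A + leaves Q)"
      by (intro edge_left edge_right edge_root_label *)
    have "edge (a + (leaves A + leaves Q)) S (root_label S) (a + (leaves A + leaves Q)) (a + (leaves A + leaves Q)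
        + leaves S)"
      by (intro edge_root_label *)
    then show "edge a (Node (Node A k Q) p S) (root_label S) (a + leaves A + leaves Q) (a + leaves A + leaves Q
        + leaves S)"
      using edge_right[of a "Node A k Q" S "root_label S" _ _ p] by (simp add: add_ac)
    show "edge a (Node (Node A k Q) p S) p a (a + leaves A + leaves Q + leaves S)"
      using * by (simp add: edge_def add_ac)
    show "tree_matrix c (Node (Node A k Q) p S) i k =
      1 * (of_bool (i = root_label A) + of_bool (i = root_label S) - of_bool (i = p) - of_bool (i = root_label
          Q))" if "i \<noteq> 0" for i
      using k ne that by (simp add: tree_matrix_outside triangle_def ne[symmetric] of_bool_def)
    show "frozen_row E c \<kappa> a (Node (Node A k Q) p S) k = 1 * (E a (a + leaves A + leaves Q + leaves S) + E (a
        + leaves A) (a + leaves A + leaves Q)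
       - E a (a + leaves A) - E (a + leaves A + leaves Q) (a + leaves A + leaves Q + leaves S))" for E \<kappa>
      using k ne by (simp add: frozen_row_outside ne[symmetric] add_ac)
  qed (auto simp: add_ac)
  then show ?case by blast
next
  case (rotL k A p Q S)
  have distinct_labels: "distinct_labels (Node (Node A k Q) p S)" "0 \<notin> labels (Node (Node A k Q) p S)" using rotL
      by auto
  note k = rotation_labels(1-4)[OF distinct_labels] and * = rotation_labels(5-8)[OF distinct_labels]
    and ne = rotation_labels(9-15)[OF distinct_labels] and z = rotation_labels(16-18)[OF distinct_labels]
  have "flip_quadrilateral c a (Node A p (Node Q k S)) (Node (Node A k Q) p S) k
      a (a + leaves A) (a + leaves A + leaves Q) (a + leaves A + leaves Q + leaves S) (root_label A) (root_label S) p
          (root_label Q) (- 1)"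
    unfolding flip_quadrilateral_def
  proof (intro conjI disjI2 allI impI)
    show "distinct (filter (\<lambda>u. u \<noteq> 0) [k, root_label A, root_label S, p, root_label Q])"
      using k * ne z by auto
    show "edge a (Node A p (Node Q k S)) (root_label A) a (a + leaves A)"
      by (intro edge_left edge_root_label *)
    show "edge a (Node A p (Node Q k S)) (root_label Q) (a + leaves A) (a + leaves A + leaves Q)"
      by (intro edge_right edge_left edge_root_label *)
    show "edge a (Node A p (Node Q k S)) (root_label S) (a + leaves A + leaves Q) (a + leaves A + leaves Q
        + leaves S)"
      by (intro edge_right edge_root_label *)
    show "edge a (Node A p (Node Q k S)) p a (a + leaves A + leaves Q + leaves S)"
      using * by (simp add: edge_def add_ac)
    show "tree_matrix c (Node A p (Node Q k S)) i k =
      - 1 * (of_bool (i = root_label A) + of_bool (i = root_label S) - of_bool (i = p) - of_bool (i = root_label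
          Q))" if "i \<noteq> 0" for i
      using k ne that by (simp add: tree_matrix_outside triangle_def ne[symmetric] of_bool_def)
    show "frozen_row E c \<kappa> a (Node A p (Node Q k S)) k = - 1 * (E a (a + leaves A + leaves Q + leaves S) + E (a
        + leaves A) (a + leaves A + leaves Q)
       - E a (a + leaves A) - E (a + leaves A + leaves Q) (a + leaves A + leaves Q + leaves S))" for E \<kappa>
      using k ne by (simp add: frozen_row_outside ne[symmetric] add_ac)
  qed (auto simp: add_ac)
  then show ?case by blast
next
  case (left k l l' p r)
  have k: "k \<noteq> 0" "k \<in> labels l" "k \<noteq> root_label l" "k \<notin> labels r" "k \<noteq> p"
    using left rot_label[OF left(1)] by auto
  then have "k \<noteq> root_label r" using root_label_neq[of k r] by blast
  note k = k this
  obtain b0 b1 b2 b3 u01 u23 u03 u12 s where q: "flip_quadrilateral 1 a l l' k b0 b1 b2 b3 u01 u23 u03 u12 (s :: int)"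
    using left(2)[of 1 a] left(3,4) by auto
  have col: "tree_matrix c (Node l p r) i k = tree_matrix 1 l i k" if "i \<noteq> 0" for i
    using k that by (simp add: tree_matrix_outside triangle_outside)
  have row: "frozen_row E c \<kappa> a (Node l p r) k = frozen_row E 1 0 a l k" for E \<kappa>
    using k by (simp add: frozen_row_outside)
  have "flip_quadrilateral c a (Node l p r) (Node l' p r) k b0 b1 b2 b3 u01 u23 u03 u12 s"
    using q col row unfolding flip_quadrilateral_def by (auto intro: edge_left)
  then show ?case by blast
next
  case (right k r r' l p)
  have k: "k \<noteq> 0" "k \<in> labels r" "k \<noteq> root_label r" "k \<notin> labels l" "k \<noteq> p"
    using right rot_label[OF right(1)] by auto
  then have "k \<noteq> root_label l" using root_label_neq[of k l] by blast
  note k = k this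
  obtain b0 b1 b2 b3 u01 u23 u03 u12 s where q:
      "flip_quadrilateral 1 (a + leaves l) r r' k b0 b1 b2 b3 u01 u23 u03 u12 (s :: int)"
    using right(2)[of 1 "a + leaves l"] right(3,4) by auto
  have col: "tree_matrix c (Node l p r) i k = tree_matrix 1 r i k" if "i \<noteq> 0" for i
    using k that by (simp add: tree_matrix_outside triangle_outside)
  have row: "frozen_row E c \<kappa> a (Node l p r) k = frozen_row E 1 0 (a + leaves l) r k" for E \<kappa>
    using k by (simp add: frozen_row_outside)
  have "flip_quadrilateral c a (Node l p r) (Node l p r') k b0 b1 b2 b3 u01 u23 u03 u12 s"
    using q col row unfolding flip_quadrilateral_def by (auto intro: edge_right simp: add_ac)
  then show ?case by blast
qed

section \<open>Seeds realized by triangulations\<close>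

lemma leaves_card: "distinct_labels t \<Longrightarrow> leaves t = Suc (card (labels t))"
proof (induction t)
  case (Node l p r)
  have f: "finite (labels t)" for t :: "'a btree" by (induction t) auto
  have "card (insert p (labels l \<union> labels r)) = Suc (card (labels l) + card (labels r))"
    using Node.prems f by (simp add: card_Un_disjoint)
  then show ?case using Node by simp
qed simp

lemma intervals_shift: "intervals (a + N) t = (\<lambda>(k, i, j). (k, i + N, j + N)) ` intervals a t"
proof (induction t arbitrary: a)
  case (Node l p r)
  have "intervals (a + N + leaves l) r = intervals (a + leaves l + N) r" by (simp add: add_ac)
  then show ?case using Node[of a] Node(2)[of "a + leaves l"] by (simp add: image_Un add_ac)
qed simp

text \<open>
  Functions on the diagonals of the polygon with Ptolemy relations. The relation \<open>R1\<close> concerns a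
  quadrilateral that fits into half of the polygon. The relation \<open>R2\<close> concerns a diameter and a
  diagonal \<open>[s, p + N]\<close> that crosses it; two of the sides of that quadrilateral have been replaced
  by their images under the half turn. For \<open>p = s\<close> both diagonals are diameters and \<open>R2\<close> is the
  exchange relation at the root. The exponents in the coefficients are the shear coordinates of
  \<open>E f\<close> and their negatives, truncated at 0.
\<close>

locale coeff_polygon =
  fixes n m :: nat and \<Phi> :: "nat \<Rightarrow> nat \<Rightarrow> 'f::field_char_0" and E :: "nat \<Rightarrow> nat \<Rightarrow> nat \<Rightarrow> int"
    and \<kappa> :: "nat \<Rightarrow> int" and q :: "nat \<Rightarrow> 'f" and N :: nat
  assumes n: "1 \<le> n" "n \<le> m" and N: "N = Suc n"
    and Phi_nz: "\<lbrakk>i < j; j \<le> i + N\<rbrakk> \<Longrightarrow> \<Phi> i j \<noteq> 0"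
    and Phi_shift: "\<lbrakk>i < j; j \<le> i + N\<rbrakk> \<Longrightarrow> \<Phi> (i + N) (j + N) = \<Phi> i j"
    and Phi_unit: "\<Phi> i (Suc i) = 1"
    and E_shift: "\<lbrakk>f \<in> {n+1..m}; i < j; j \<le> i + N\<rbrakk> \<Longrightarrow> E f (i + N) (j + N) = E f i j + \<kappa> f"
    and E_max_ptolemy: "\<lbrakk>f \<in> {n+1..m}; a < b; b < c; c < d; d \<le> a + N\<rbrakk> \<Longrightarrow> max_ptolemy (E f) a b c d"
    and E_root: "\<lbrakk>f \<in> {n+1..m}; r < s; s < r + N\<rbrakk> \<Longrightarrow>
      E f r (r + N) + E f s (s + N) = max (2 * E f r s + \<kappa> f) (2 * E f s (r + N))"
    and R1: "\<lbrakk>a < b; b < c; c < d; d \<le> a + N\<rbrakk> \<Longrightarrow>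
      \<Phi> a c * \<Phi> b d =
        (\<Prod>f=n+1..m. q f ^ nat (E f a d + E f b c - E f a b - E f c d)) * (\<Phi> a b * \<Phi> c d)
      + (\<Prod>f=n+1..m. q f ^ nat (- (E f a d + E f b c - E f a b - E f c d))) * (\<Phi> a d * \<Phi> b c)"
    and R2: "\<lbrakk>r < p; p \<le> s; s < r + N\<rbrakk> \<Longrightarrow>
      \<Phi> r (r + N) * \<Phi> s (p + N) =
        (\<Prod>f=n+1..m. q f ^ nat (E f s (r + N) + E f p (r + N) - E f r s - E f r p - \<kappa> f)) * (\<Phi> r s * \<Phi> r p)
      + (\<Prod>f=n+1..m. q f ^ nat (- (E f s (r + N) + E f p (r + N) - E f r s - E f r p - \<kappa> f)))
          * (\<Phi> s (r + N) * \<Phi> p (r + N))"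
begin

definition realizes :: "nat \<Rightarrow> nat btree \<Rightarrow> 'f seed \<Rightarrow> bool" where
  "realizes r t S \<longleftrightarrow> distinct_labels t \<and> labels t = {1..n} \<and>
     (\<forall>i\<in>{1..n}. \<forall>j\<in>{1..n}. fst S i j = tree_matrix 2 t i j) \<and>
     (\<forall>f\<in>{n+1..m}. \<forall>j\<in>{1..n}. fst S f j = frozen_row (E f) 2 (\<kappa> f) r t j) \<and>
     (\<forall>k i j. (k, i, j) \<in> intervals r t \<longrightarrow> snd S k = \<Phi> i j) \<and>
     (\<forall>f\<in>{n+1..m}. snd S f = q f)"

lemma realizes_leaves: "realizes r t S \<Longrightarrow> leaves t = N"
  using leaves_card unfolding realizes_def N by fastforce

text \<open>
  The monomials of an exchange relation read off from a column of the form given by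
  \<open>flip_quadrilateral\<close>.
\<close>

lemma prod_indicator:
  fixes x :: "nat \<Rightarrow> 'f"
  assumes "u \<le> n" "v \<le> n" "w \<le> n" "y \<le> n" and d: "distinct (filter (\<lambda>u. u \<noteq> 0) [u, v, w, y])"
  shows "(\<Prod>i=1..n. x i ^ nat (of_bool (i = u) + of_bool (i = v) - of_bool (i = w) - of_bool (i = y)))
    = (if u = 0 then 1 else x u) * (if v = 0 then 1 else x v)"
proof -
  have "(\<Prod>i=1..n. x i ^ nat (of_bool (i = u) + of_bool (i = v) - of_bool (i = w) - of_bool (i = y)))
    = (\<Prod>i=1..n. (if i = u then x i else 1) * (if i = v then x i else 1))"
    using d by (intro prod.cong refl) (auto split: if_splits)
  also have "\<dots> = (\<Prod>i=1..n. if i = u then x i else 1) * (\<Prod>i=1..n. if i = v then x i else 1)"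
    by (rule prod.distrib)
  also have "(\<Prod>i=1..n. if i = u then x i else 1) = (if u = 0 then 1 else x u)" if "u \<le> n" for u
    using that by (subst prod.delta) auto
  finally show ?thesis using assms by simp
qed

lemma prod_split: "(\<Prod>i=1..m. g i) = (\<Prod>i=1..n. g i) * (\<Prod>i=n+1..m. g i)" for g :: "nat \<Rightarrow> 'f"
proof -
  have "{1..m} = {1..n} \<union> {n+1..m}" using n by auto
  then show ?thesis by (simp add: prod.union_disjoint)
qed

lemma mutate_snd_other: "k \<noteq> i \<Longrightarrow> snd (mutate m k S) i = snd S i"
  by (simp add: mutate_def mutate_variables_def)

lemma mutate_snd_new:
  assumes "snd S k * v = (\<Prod>i=1..m. snd S i ^ nat (fst S i k)) + (\<Prod>i=1..m. snd S i ^ nat (- fst S i k))"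
    "snd S k \<noteq> 0"
  shows "snd (mutate m k S) k = v"
  using assms by (simp add: mutate_def mutate_variables_def field_simps)

text \<open>
  The column of \<open>k\<close> is that of the quadrilateral around \<open>k\<close>, so the exchange relation is \<open>R1\<close>, and
  the matrix mutates by \<open>tree_matrix_rot\<close> and \<open>frozen_row_rot\<close>.
\<close>

lemma realizes_rot:
  assumes R: "realizes r t S" and rot: "rot k t t'"
  shows "realizes r t' (mutate m k S)"
proof -
  have distinct_labels: "distinct_labels t" and set: "labels t = {1..n}"
    and B: "\<And>i j. i \<in> {1..n} \<Longrightarrow> j \<in> {1..n} \<Longrightarrow> fst S i j = tree_matrix 2 t i j"
    and F: "\<And>f j. f \<in> {n+1..m} \<Longrightarrow> j \<in> {1..n} \<Longrightarrow> fst S f j = frozen_row (E f) 2 (\<kappa> f) r t j"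
    and X: "\<And>k i j. (k, i, j) \<in> intervals r t \<Longrightarrow> snd S k = \<Phi> i j"
    and Q: "\<And>f. f \<in> {n+1..m} \<Longrightarrow> snd S f = q f"
    using R unfolding realizes_def by blast+
  have lvt: "leaves t = N" using realizes_leaves[OF R] .
  have z: "0 \<notin> labels t" using set by simp
  have k: "k \<in> {1..n}" using rot_label[OF rot distinct_labels] set by simp
  have dl': "distinct_labels t'" "labels t' = {1..n}"
      using rot_distinct_labels[OF rot distinct_labels] rot_set[OF rot] set by auto
  have trop: "max_ptolemy (E f) b0 b1 b2 b3"
      if "f \<in> {n+1..m}" "r \<le> b0" "b0 < b1" "b1 < b2" "b2 < b3" "b3 \<le> r + leaves t" for f b0 b1 b2 b3
    using that lvt by (intro E_max_ptolemy) auto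
  obtain b0 b1 b2 b3 u01 u23 u03 u12 and s :: int where qd:
      "flip_quadrilateral 2 r t t' k b0 b1 b2 b3 u01 u23 u03 u12 s"
    using rot_flip_quadrilateral[OF rot distinct_labels z] by blast
  have b: "r \<le> b0" "b0 < b1" "b1 < b2" "b2 < b3" "b3 \<le> r + N" using qd lvt unfolding flip_quadrilateral_def by auto
  have dist: "distinct (filter (\<lambda>u. u \<noteq> 0) [k, u01, u23, u03, u12])" using qd unfolding flip_quadrilateral_def
      by blast
  have ed: "edge r t u01 b0 b1" "edge r t u23 b2 b3" "edge r t u03 b0 b3" "edge r t u12 b1 b2"
    using qd unfolding flip_quadrilateral_def by blast+
  have cs: "s = 1 \<and> (k, b0, b2) \<in> intervals r t \<and> (k, b1, b3) \<in> intervals r t' \<or>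
      s = -1 \<and> (k, b1, b3) \<in> intervals r t \<and> (k, b0, b2) \<in> intervals r
          t'" using qd unfolding flip_quadrilateral_def by blast
  have col: "fst S i k = s * (of_bool (i = u01) + of_bool (i = u23) - of_bool (i = u03) - of_bool (i = u12))"
    if "i \<in> {1..n}" for i using qd B[OF that k] that unfolding flip_quadrilateral_def by simp
  let ?sh = "\<lambda>f. E f b0 b3 + E f b1 b2 - E f b0 b1 - E f b2 b3"
  have row: "fst S f k = s * ?sh f" if "f \<in> {n+1..m}" for f
    using qd F[OF that k] unfolding flip_quadrilateral_def by simp
  let ?x = "\<lambda>u. if u = 0 then 1 else snd S u"
  have ex: "?x u = \<Phi> i j" "u \<le> n" if "edge r t u i j" for u i j
    using that X intervals_bounds[of u i j r t] set Phi_unit by (auto simp: edge_def)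
  have P1: "(\<Prod>i=1..n. snd S i ^ nat (of_bool (i = u01) + of_bool (i = u23) - of_bool (i = u03) - of_bool (i = u12)))
      = \<Phi> b0 b1 * \<Phi> b2 b3"
    using ex[OF ed(1)] ex[OF ed(2)] ex(2)[OF ed(3)] ex(2)[OF ed(4)] dist
    by (subst prod_indicator) (auto split: if_splits)
  have "(\<Prod>i=1..n. snd S i ^ nat (of_bool (i = u03) + of_bool (i = u12) - of_bool (i = u01) - of_bool (i = u23)))
      = \<Phi> b0 b3 * \<Phi> b1 b2"
    using ex[OF ed(3)] ex[OF ed(4)] ex(2)[OF ed(1)] ex(2)[OF ed(2)] dist
    by (subst prod_indicator) (auto split: if_splits)
  then have P2: "(\<Prod>i=1..n. snd S i ^ nat (- (of_bool (i = u01) + of_bool (i = u23) - of_bool (i = u03) - of_bool (i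
      = u12))))
      = \<Phi> b0 b3 * \<Phi> b1 b2" by (simp add: algebra_simps)
  let ?cl = "\<lambda>i. of_bool (i = u01) + of_bool (i = u23) - of_bool (i = u03) - of_bool (i = u12) :: int"
  have full: "(\<Prod>i=1..m. snd S i ^ nat (s' * fst S i k)) =
       (\<Prod>i=1..n. snd S i ^ nat (s' * (s * ?cl i))) * (\<Prod>f=n+1..m. q f ^ nat (s' * (s * ?sh f)))" for s'
    unfolding prod_split by (intro arg_cong2[where f = "(*)"] prod.cong refl) (auto simp: col row Q)
  have "(\<Prod>i=1..m. snd S i ^ nat (fst S i k)) + (\<Prod>i=1..m. snd S i ^ nat (- fst S i k)) = \<Phi> b0 b2 * \<Phi> b1 b3"
  proof -
    have "s = 1 \<or> s = -1" using cs by blast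
    then show ?thesis
      unfolding R1[OF b(2,3,4) order_trans[OF b(5) add_right_mono[OF b(1)]]]
      using full[of 1] full[of "-1"] P1 P2 by (auto simp: mult_ac)
  qed
  note ex_rel = this
  have new: "snd (mutate m k S) k = \<Phi> i j" if "(k, i, j) \<in> intervals r t'" for i j
    using cs
  proof (elim disjE conjE)
    assume "s = 1" and *: "(k, b0, b2) \<in> intervals r t" "(k, b1, b3) \<in> intervals r t'"
    then have "i = b1" "j = b3" using intervals_unique[OF dl'(1) that *(2)] by auto
    then show ?thesis
      using X[OF *(1)] ex_rel b Phi_nz[of b0 b2] by (intro mutate_snd_new) auto
  next
    assume "s = -1" and *: "(k, b1, b3) \<in> intervals r t" "(k, b0, b2) \<in> intervals r t'"
    then have "i = b0" "j = b2" using intervals_unique[OF dl'(1) that *(2)] by auto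
    then show ?thesis
      using X[OF *(1)] ex_rel b Phi_nz[of b1 b3] by (intro mutate_snd_new) (auto simp: mult.commute)
  qed
  show ?thesis
    unfolding realizes_def
  proof (intro conjI ballI allI impI)
    fix i j assume ij: "i \<in> {1..n}" "j \<in> {1..n}"
    have "mutate_matrix k (fst S) i j = mutate_matrix k (tree_matrix 2 t) i j"
      using ij k B by (simp add: mutate_matrix_def)
    also have "\<dots> = tree_matrix 2 t' i j" using ij distinct_labels z by (intro tree_matrix_rot[OF rot]) auto
    finally show "fst (mutate m k S) i j = tree_matrix 2 t' i j" by (simp add: mutate_def)
  next
    fix f j assume fj: "f \<in> {n+1..m}" "j \<in> {1..n}"
    have "mutate_matrix k (fst S) f j = mutate_row k (fst S f) (fst S k) j"
      using fj k by (intro mutate_matrix_row) auto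
    also have "\<dots> = mutate_row k (frozen_row (E f) 2 (\<kappa> f) r t) (tree_matrix 2 t k) j"
      using F[OF fj(1)] B[OF k] fj k by (simp add: mutate_row_def)
    also have "\<dots> = frozen_row (E f) 2 (\<kappa> f) r t' j"
      using fj distinct_labels z trop[OF fj(1)] by (intro frozen_row_rot[OF rot]) auto
    finally show "fst (mutate m k S) f j = frozen_row (E f) 2 (\<kappa> f) r t' j" by (simp add: mutate_def)
  next
    fix k' i j assume *: "(k', i, j) \<in> intervals r t'"
    show "snd (mutate m k S) k' = \<Phi> i j"
    proof (cases "k' = k")
      case False
      then show ?thesis using X[OF intervals_rot[OF rot * False]] mutate_snd_other[of k k' S] by simp
    qed (use new * in blast)
  next
    fix f assume "f \<in> {n+1..m}"
    then show "snd (mutate m k S) f = q f" using Q k mutate_snd_other[of k f S] by auto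
  qed (use dl' in auto)
qed

text \<open>
  The same for the diameter, with the exchange relation \<open>R2\<close> for \<open>p = s\<close>. The left subtree moves
  by \<open>N\<close>, which changes neither \<open>\<Phi>\<close> nor the shear coordinates.
\<close>

lemma realizes_root_flip:
  assumes R: "realizes r (Node l k u) S"
  shows "realizes (r + leaves l) (Node u k l) (mutate m k S)"
proof -
  let ?t = "Node l k u" and ?t' = "Node u k l" and ?s = "r + leaves l"
  have distinct_labels: "distinct_labels ?t" and set: "labels ?t = {1..n}"
    and B: "\<And>i j. i \<in> {1..n} \<Longrightarrow> j \<in> {1..n} \<Longrightarrow> fst S i j = tree_matrix 2 ?t i j"
    and F: "\<And>f j. f \<in> {n+1..m} \<Longrightarrow> j \<in> {1..n} \<Longrightarrow> fst S f j = frozen_row (E f) 2 (\<kappa> f) r ?t j"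
    and X: "\<And>k i j. (k, i, j) \<in> intervals r ?t \<Longrightarrow> snd S k = \<Phi> i j"
    and Q: "\<And>f. f \<in> {n+1..m} \<Longrightarrow> snd S f = q f"
    using R unfolding realizes_def by blast+
  have lvt: "leaves l + leaves u = N" using realizes_leaves[OF R] by simp
  have z: "0 \<notin> labels ?t" using set by simp
  have k: "k \<in> {1..n}" using set by auto
  have kl: "k \<noteq> 0" "k \<notin> labels l" "k \<notin> labels u" using distinct_labels k by auto
  have ne: "root_label l \<noteq> k" "root_label u \<noteq> k" using kl by (simp_all add: root_label_neq)
  have dj: "root_label l = root_label u \<Longrightarrow> root_label l = 0" using distinct_labels root_label_disjoint by auto
  have s: "r < ?s" "?s < r + N" using lvt leaves_pos[of l] leaves_pos[of u] by linarith+
  have le: "root_label l \<le> n" "root_label u \<le> n" using root_label_in[of l] root_label_in[of u] set by fastforce+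
  let ?x = "\<lambda>v. if v = 0 then 1 else snd S v"
  have xl: "?x (root_label l) = \<Phi> r ?s"
  proof (cases l)
    case Leaf then show ?thesis using Phi_unit by simp
  next
    case (Node l1 p l2)
    then show ?thesis using X[of p r ?s] z by (auto simp: add_ac)
  qed
  have xu: "?x (root_label u) = \<Phi> ?s (r + N)"
  proof (cases u)
    case Leaf then show ?thesis using Phi_unit[of ?s] lvt
        by (metis One_nat_def add.assoc leaves.simps(1) root_label.simps(1) add_Suc_right add_0_right)
  next
    case (Node l1 p l2)
    then show ?thesis using X[of p ?s "r + N"] z lvt by (auto simp: add_ac)
  qed
  have col: "fst S i k = (of_bool (i = root_label l) + of_bool (i = root_label l)) - (of_bool (i = root_label u)
      + of_bool (i = root_label u))"
    if "i \<in> {1..n}" for i using B[OF that k] that kl ne by (auto simp: tree_matrix_outside triangle_def)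
  let ?sh = "\<lambda>f. E f ?s (r + N) + E f ?s (r + N) - E f r ?s - E f r ?s - \<kappa> f"
  have row: "fst S f k = ?sh f" if "f \<in> {n+1..m}" for f
    using F[OF that k] kl ne lvt[symmetric] by (simp add: frozen_row_outside algebra_simps)
  have sq: "(\<Prod>i=1..n. snd S i ^ nat ((of_bool (i = v) + of_bool (i = v)) - (of_bool (i = w) + of_bool (i = w))))
      = ?x v * ?x v"
    if "v \<le> n" "v = w \<Longrightarrow> v = 0" for v w
  proof -
    have "(\<Prod>i=1..n. snd S i ^ nat ((of_bool (i = v) + of_bool (i = v)) - (of_bool (i = w) + of_bool (i = w))))
      = (\<Prod>i=1..n. (if i = v then snd S i * snd S i else 1))"
    proof (intro prod.cong refl)
      fix i assume i: "i \<in> {1..n}"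
      have "\<not> (i = v \<and> i = w)" using that(2) i by auto
      then consider "i = v" "i \<noteq> w" | "i \<noteq> v" "i = w" | "i \<noteq> v" "i \<noteq> w" by blast
      then show "snd S i ^ nat ((of_bool (i = v) + of_bool (i = v)) - (of_bool (i = w) + of_bool (i = w)))
          = (if i = v then snd S i * snd S i else 1)"
        by cases (simp_all add: power2_eq_square)
    qed
    also have "\<dots> = ?x v * ?x v" using that(1) by (subst prod.delta) auto
    finally show ?thesis .
  qed
  have p1: "(\<Prod>i=1..m. snd S i ^ nat (fst S i k)) = (\<Prod>f=n+1..m. q f ^ nat (?sh f)) * (\<Phi> r ?s * \<Phi> r ?s)"
  proof -
    have "(\<Prod>i=1..n. snd S i ^ nat (fst S i k)) = \<Phi> r ?s * \<Phi> r ?s"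
      using sq[of "root_label l" "root_label u"] le dj unfolding xl by (simp add: col)
    moreover have "(\<Prod>i=n+1..m. snd S i ^ nat (fst S i k)) = (\<Prod>f=n+1..m. q f ^ nat (?sh f))"
      by (intro prod.cong refl) (simp add: row Q)
    ultimately show ?thesis unfolding prod_split by simp
  qed
  have p2: "(\<Prod>i=1..m. snd S i ^ nat (- fst S i k)) = (\<Prod>f=n+1..m. q f ^ nat (- ?sh f)) * (\<Phi> ?s (r + N) * \<Phi> ?s (r + N))"
  proof -
    have "(\<Prod>i=1..n. snd S i ^ nat (- fst S i k)) = \<Phi> ?s (r + N) * \<Phi> ?s (r + N)"
      using sq[of "root_label u" "root_label l"] le dj unfolding xu by (simp add: col)
    moreover have "(\<Prod>i=n+1..m. snd S i ^ nat (- fst S i k)) = (\<Prod>f=n+1..m. q f ^ nat (- ?sh f))"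
      by (intro prod.cong refl) (simp add: row Q)
    ultimately show ?thesis unfolding prod_split by simp
  qed
  have new: "snd (mutate m k S) k = \<Phi> ?s (?s + N)"
  proof (rule mutate_snd_new)
    have xk: "snd S k = \<Phi> r (r + N)" using X[of k r "r + N"] lvt by (simp add: add_ac)
    show "snd S k * \<Phi> ?s (?s + N) = (\<Prod>i=1..m. snd S i ^ nat (fst S i k)) + (\<Prod>i=1..m. snd S i ^ nat (- fst S i k))"
      unfolding xk p1 p2 by (rule R2[OF s(1) order_refl s(2)])
    show "snd S k \<noteq> 0" unfolding xk using N by (intro Phi_nz) auto
  qed
  show ?thesis
    unfolding realizes_def
  proof (intro conjI ballI allI impI)
    fix i j assume ij: "i \<in> {1..n}" "j \<in> {1..n}"
    have "mutate_matrix k (fst S) i j = mutate_matrix k (tree_matrix 2 ?t) i j"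
      using ij k B by (simp add: mutate_matrix_def)
    also have "\<dots> = tree_matrix 2 ?t' i j" using ij distinct_labels z by (intro tree_matrix_root_flip) auto
    finally show "fst (mutate m k S) i j = tree_matrix 2 ?t' i j" by (simp add: mutate_def)
  next
    fix f j assume fj: "f \<in> {n+1..m}" "j \<in> {1..n}"
    have "mutate_matrix k (fst S) f j = mutate_row k (fst S f) (fst S k) j"
      using fj k by (intro mutate_matrix_row) auto
    also have "\<dots> = mutate_row k (frozen_row (E f) 2 (\<kappa> f) r ?t) (tree_matrix 2 ?t k) j"
      using F[OF fj(1)] B[OF k] fj k by (simp add: mutate_row_def)
    also have "\<dots> = frozen_row (E f) 2 (\<kappa> f) ?s ?t' j"
      using fj distinct_labels z lvt E_shift[OF fj(1)] E_root[OF fj(1) s]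
          by (intro frozen_row_root_flip[where N = N]) auto
    finally show "fst (mutate m k S) f j = frozen_row (E f) 2 (\<kappa> f) ?s ?t' j" by (simp add: mutate_def)
  next
    fix k' i j assume *: "(k', i, j) \<in> intervals ?s ?t'"
    have sN: "?s + leaves u = r + N" using lvt by simp
    have "(k', i, j) = (k, ?s, ?s + leaves u + leaves l) \<or> (k', i, j) \<in> intervals ?s u \<or> (k', i, j) \<in> intervals (r
        + N) l"
      using * unfolding intervals.simps sN by blast
    then consider "k' = k" "i = ?s" "j = ?s + N" | "(k', i, j) \<in> intervals ?s u"
      | i' j' where "(k', i', j') \<in> intervals r l" "i = i' + N" "j = j' + N"
      unfolding intervals_shift[of r N l] using lvt by auto
    then show "snd (mutate m k S) k' = \<Phi> i j"
    proof cases
      case 1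
      then show ?thesis using new by simp
    next
      case 2
      then have "k' \<noteq> k" using intervals_bounds[OF 2] kl by auto
      then show ?thesis using X[of k' i j] 2 mutate_snd_other[of k k' S] by auto
    next
      case 3
      then have "k' \<noteq> k" using intervals_bounds[OF 3(1)] kl by auto
      moreover have "\<Phi> i j = \<Phi> i' j'" unfolding 3 using intervals_bounds[OF 3(1)] lvt by (intro Phi_shift) auto
      ultimately show ?thesis using X[of k' i' j'] 3 mutate_snd_other[of k k' S] by auto
    qed
  next
    fix f assume "f \<in> {n+1..m}"
    then show "snd (mutate m k S) f = q f" using Q k mutate_snd_other[of k f S] by auto
  qed (use distinct_labels set in auto)
qed

end

section \<open>Crossing numbers inside a half polygon\<close>

text \<open>
  The number of crossings of the chords \<open>[i, j]\<close> and \<open>[k, l]\<close> of a polygon, with the value \<open>-1\<close> if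
  they coincide. This convention is the one for which the tropical Ptolemy relation also holds for
  quadrilaterals that have \<open>[k, l]\<close> as a side or as a diagonal.
\<close>

definition crossing :: "nat \<Rightarrow> nat \<Rightarrow> nat \<Rightarrow> nat \<Rightarrow> int" where
  "crossing k l i j = (if i = k \<and> j = l then - 1
     else if (i < k \<and> k < j \<and> j < l) \<or> (k < i \<and> i < l \<and> l < j) then 1 else 0)"

text \<open>
  All positions of \<open>k\<close> and \<open>l\<close> relative to the four vertices are checked.
\<close>

lemma crossing_max_ptolemy:
  assumes "a < b" "b < c" "c < d" "k < l"
  shows "max_ptolemy (crossing k l) a b c d"
proof -
  consider "k < a" | "k = a" | "a < k" "k < b" | "k = b" | "b < k" "k < c" | "k = c"
    | "c < k" "k < d" | "k = d" | "d < k" by linarith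
  note K = this
  consider "l < a" | "l = a" | "a < l" "l < b" | "l = b" | "b < l" "l < c" | "l = c"
    | "c < l" "l < d" | "l = d" | "d < l" by linarith
  note L = this
  show ?thesis unfolding max_ptolemy_def crossing_def
    by (rule K; rule L; use assms in simp)
qed

lemma crossing_unit: "k + 2 \<le> l \<Longrightarrow> crossing k l i (Suc i) = 0"
  by (auto simp: crossing_def)

lemma crossing_outside: "i < j \<Longrightarrow> j \<le> k \<or> l \<le> i \<or> (k \<le> i \<and> j \<le> l \<and> (i, j) \<noteq> (k, l)) \<or> (i \<le> k \<and> l \<le> j \<and> (i, j) \<noteq> (k, l))
    \<Longrightarrow> crossing k l i j = 0"
  by (auto simp: crossing_def)

lemma intervals_laminar:
  "distinct_labels t \<Longrightarrow> (k, k1, k2) \<in> intervals a t \<Longrightarrow> (k', i, j) \<in> intervals a t \<Longrightarrow>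
     k = k' \<or> (i, j) \<noteq> (k1, k2) \<and> (j \<le> k1 \<or> k2 \<le> i \<or> k1 \<le> i \<and> j \<le> k2 \<or> i \<le> k1 \<and> k2 \<le> j)"
proof (induction t arbitrary: a)
  case (Node l p r)
  have pos: "0 < leaves l" "0 < leaves r" by simp_all
  have cases: "k = p \<and> k1 = a \<and> k2 = a + leaves l + leaves r
      \<or> (k, k1, k2) \<in> intervals a l \<and> a \<le> k1 \<and> k1 + 2 \<le> k2 \<and> k2 \<le> a + leaves l
      \<or> (k, k1, k2) \<in> intervals (a + leaves l) r \<and> a + leaves l \<le> k1 \<and> k1 + 2 \<le> k2 \<and> k2 \<le> a + leaves l + leaves r"
    if "(k, k1, k2) \<in> intervals a (Node l p r)" for k k1 k2
    using that intervals_bounds[of k k1 k2 a l] intervals_bounds[of k k1 k2 "a + leaves l" r] by auto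
  note IH = Node.IH(1)[of a] Node.IH(2)[of "a + leaves l"]
  show ?case
    using cases[OF Node.prems(2)] cases[OF Node.prems(3)] IH Node.prems(1) pos
    by (elim disjE conjE) auto
qed simp

lemma intervals_crossing:
  assumes "distinct_labels t" "(k, k1, k2) \<in> intervals a t" "(k', i, j) \<in> intervals a t"
  shows "crossing k1 k2 i j = (if k = k' then - 1 else 0)"
proof (cases "k = k'")
  case True
  then show ?thesis using intervals_unique[OF assms(1,2)] assms(3) by (auto simp: crossing_def)
next
  case False
  then show ?thesis using intervals_laminar[OF assms] intervals_bounds[OF assms(3)] crossing_outside[of i j k1 k2]
      by auto
qed

text \<open>
  From the diagonals of a triangulation all other diagonals are obtained by Ptolemy relations in
  which one of the two diagonals of the quadrilateral belongs to the triangulation. At a node that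
  splits at \<open>b\<close>, an interval that contains \<open>b\<close> in its interior is first treated if it starts at
  the left end of the node, by the quadrilateral whose known diagonal is the right child; then in
  general, with the left child as known diagonal.
\<close>

lemma tree_closure:
  fixes Q :: "nat \<Rightarrow> nat \<Rightarrow> bool"
  assumes unit: "\<And>i. Q i (Suc i)"
    and node: "\<And>k i j. (k, i, j) \<in> I \<Longrightarrow> Q i j"
    and step: "\<And>k b0 b1 b2 b3. \<lbrakk>a0 \<le> b0; b0 < b1; b1 < b2; b2 < b3; b3 \<le> d0; Q b0 b1; Q b2 b3; Q b0 b3; Q b1 b2\<rbrakk> \<Longrightarrow>
        ((k, b0, b2) \<in> I \<longrightarrow> Q b1 b3) \<and> ((k, b1, b3) \<in> I \<longrightarrow> Q b0 b2)"
    and "intervals a t \<subseteq> I" "a0 \<le> a" "a + leaves t \<le> d0" "a \<le> i" "i < j" "j \<le> a + leaves t"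
  shows "Q i j"
  using assms(4-9)
proof (induction t arbitrary: a i j)
  case Leaf
  then have "i = a" "j = Suc a" by auto
  then show ?case using unit by simp
next
  case (Node l p r)
  let ?b = "a + leaves l" and ?d = "a + leaves l + leaves r"
  have pos: "0 < leaves l" "0 < leaves r" by simp_all
  have L: "Q i j" if "a \<le> i" "i < j" "j \<le> ?b" for i j
    using Node.prems that by (intro Node.IH(1)) auto
  have R: "Q i j" if "?b \<le> i" "i < j" "j \<le> ?d" for i j
    using Node.prems that by (intro Node.IH(2)) auto
  have root_label: "Q a ?d" using Node.prems(1) by (intro node[of p]) simp
  \<comment> \<open>Intervals that start at the left end of the node and cross its right child.\<close>
  have start: "Q a j" if "?b < j" "j \<le> ?d" for j
  proof (cases "j = ?d")
    case False
    then have "r \<noteq> Leaf" using that by auto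
    then obtain k where "(k, ?b, ?d) \<in> intervals ?b r" by (cases r) (auto simp: add_ac)
    then have "(k, ?b, ?d) \<in> I" using Node.prems(1) by auto
    then show ?thesis using that False pos L[of a ?b] R[of j ?d] R[of ?b j] root_label Node.prems(2,3)
        step[of a ?b j ?d k] by auto
  qed (use root_label in simp)
  show ?case
  proof (cases "j \<le> ?b \<or> ?b \<le> i")
    case True
    then show ?thesis using L[of i j] R[of i j] Node.prems(4-6) by auto
  next
    case False
    show ?thesis
    proof (cases "i = a")
      case True
      then show ?thesis using start False Node.prems(6) by auto
    next
      case ia: False
      then have "l \<noteq> Leaf" using False Node.prems(4) by auto
      then obtain k where "(k, a, ?b) \<in> intervals a l" by (cases l) (auto simp: add_ac)
      then have "(k, a, ?b) \<in> I" using Node.prems(1) by auto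
      then show ?thesis using False ia Node.prems(2-6) L[of a i] R[of ?b j] start[of j] L[of i ?b]
          step[of a i ?b j k] by auto
    qed
  qed
qed

section \<open>Laurent expansions in a triangulation\<close>

text \<open>
  Only the smallest exponents of the cluster variables are recorded; frozen monomials thus have
  the value 0.
\<close>

definition cluster_val :: "nat \<Rightarrow> nat \<Rightarrow> (nat \<Rightarrow> 'f::field_char_0) \<Rightarrow> 'f \<Rightarrow> (nat \<Rightarrow> int) \<Rightarrow> bool" where
  "cluster_val n m x z \<phi> \<longleftrightarrow> (\<exists>\<nu>. has_val x {1..m} z \<nu> \<and> (\<forall>k\<in>{1..n}. \<nu> k = \<phi> k))"

lemma cluster_val_cong: "(\<And>k. k \<in> {1..n} \<Longrightarrow> \<phi> k = \<psi> k) \<Longrightarrow> cluster_val n m x z \<phi> \<Longrightarrow> cluster_val n m x z \<psi>"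
  unfolding cluster_val_def by auto

lemma cluster_val_add: "cluster_val n m x z \<phi> \<Longrightarrow> cluster_val n m x w \<psi> \<Longrightarrow> cluster_val n m x (z
    + w) (\<lambda>k. min (\<phi> k) (\<psi> k))"
  unfolding cluster_val_def by (metis (mono_tags, lifting) has_val.add)

lemma cluster_val_mult:
  assumes "\<forall>j\<in>{1..m}. x j \<noteq> 0" "cluster_val n m x z \<phi>" "cluster_val n m x w \<psi>"
  shows "cluster_val n m x (z * w) (\<lambda>k. \<phi> k + \<psi> k)"
proof -
  obtain \<nu> \<mu> where "has_val x {1..m} z \<nu>" "\<forall>k\<in>{1..n}. \<nu> k = \<phi> k"
    "has_val x {1..m} w \<mu>" "\<forall>k\<in>{1..n}. \<mu> k = \<psi> k" using assms unfolding cluster_val_def by blast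
  with has_val_mult[of x "{1..m}" z \<nu> w \<mu>] assms(1) show ?thesis unfolding cluster_val_def by auto
qed

lemma cluster_val_one: "cluster_val n m x 1 (\<lambda>_. 0)"
  unfolding cluster_val_def using has_val_one by blast

lemma cluster_val_var: "j \<in> {1..m} \<Longrightarrow> cluster_val n m x (x j) (\<lambda>k. if k = j then 1 else 0)"
  unfolding cluster_val_def using has_val_var[of j "{1..m}" x] by blast

lemma cluster_val_inverse_var: "j \<in> {1..m} \<Longrightarrow> cluster_val n m x (inverse (x j)) (\<lambda>k. if k = j then - 1 else 0)"
  unfolding cluster_val_def using has_val_inverse_var[of j "{1..m}" x] by blast

lemma cluster_val_frozen:
  assumes "\<forall>j\<in>{1..m}. x j \<noteq> 0" "\<And>f. f \<in> {n+1..m} \<Longrightarrow> q f = x f"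
  shows "cluster_val n m x (\<Prod>f=n+1..m. q f ^ g f) (\<lambda>_. 0)"
proof -
  have pw: "cluster_val n m x (q f ^ k) (\<lambda>_. 0)" if "f \<in> {n+1..m}" for f k
  proof (induction k)
    case (Suc k)
    have "cluster_val n m x (q f) (\<lambda>_. 0)"
      using cluster_val_cong[OF _ cluster_val_var[of f m n x]] that assms(2)[OF that] by auto
    then show ?case using cluster_val_mult[OF assms(1) _ Suc] by fastforce
  qed (simp add: cluster_val_one)
  have "cluster_val n m x (\<Prod>f\<in>F. q f ^ g f) (\<lambda>_. 0)" if "F \<subseteq> {n+1..m}" for F
    using finite_subset[OF that finite_atLeastAtMost] that
  proof (induction F rule: finite_induct)
    case (insert f F)
    then show ?case using cluster_val_mult[OF assms(1) pw[of f "g f"], of "\<Prod>f\<in>F. q f ^ g f" "\<lambda>_. 0"] by simp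
  qed (simp add: cluster_val_one)
  then show ?thesis by blast
qed

text \<open>
  The smallest exponents of an element that is obtained from an exchange relation by division by
  one variable.
\<close>

lemma cluster_val_exchange:
  assumes nz: "\<forall>j\<in>{1..m}. x j \<noteq> 0" and q: "\<And>f. f \<in> {n+1..m} \<Longrightarrow> q f = x f"
    and eq: "x j * z = (\<Prod>f=n+1..m. q f ^ g f) * (z1 * z2) + (\<Prod>f=n+1..m. q f ^ h f) * (z3 * z4)"
    and vals: "cluster_val n m x z1 \<phi>1" "cluster_val n m x z2 \<phi>2" "cluster_val n m x z3 \<phi>3" "cluster_val n m x z4 \<phi>4"
    and j: "j \<in> {1..m}"
    and \<phi>: "\<And>k. k \<in> {1..n} \<Longrightarrow> \<phi> k = min (\<phi>1 k + \<phi>2 k) (\<phi>3 k + \<phi>4 k) - (if k = j then 1 else 0)"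
  shows "cluster_val n m x z \<phi>"
proof -
  note mult = cluster_val_mult[OF nz]
  have "cluster_val n m x (inverse (x j) * ((\<Prod>f=n+1..m. q f ^ g f) * (z1 * z2) + (\<Prod>f=n+1..m. q f ^ h f) * (z3 * z4)))
    (\<lambda>k. (if k = j then - 1 else 0) + min (0 + (\<phi>1 k + \<phi>2 k)) (0 + (\<phi>3 k + \<phi>4 k)))"
    by (intro mult cluster_val_add cluster_val_inverse_var cluster_val_frozen vals j nz q)
  moreover have "inverse (x j) * ((\<Prod>f=n+1..m. q f ^ g f) * (z1 * z2) + (\<Prod>f=n+1..m. q f ^ h f) * (z3 * z4)) = z"
    using eq[symmetric] nz j by simp
  ultimately have "cluster_val n m x z (\<lambda>k. (if k = j then - 1 else 0) + min (0 + (\<phi>1 k + \<phi>2 k)) (0 + (\<phi>3 k + \<phi>4 k)))"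
    by (simp only:)
  then show ?thesis by (rule cluster_val_cong[rotated]) (simp only: \<phi>, simp)
qed

context coeff_polygon
begin

definition congruent_iv :: "nat \<Rightarrow> nat \<Rightarrow> nat \<Rightarrow> nat \<Rightarrow> bool" where
  "congruent_iv i j k l \<longleftrightarrow> (\<exists>s s'. i + s * N = k + s' * N \<and> j + s * N = l + s' * N)"

text \<open>
  The number of points in which a diagonal of the orbit of \<open>[i, j]\<close> meets the orbit of \<open>[k, l]\<close>.
  Modulo shifts, \<open>[i, j]\<close> meets \<open>[k, l]\<close> at most once with the right end and at most once with the
  left end of \<open>[k, l]\<close> in its interior. If \<open>[k, l]\<close> is a diameter, then each crossing appears in
  both ways, because \<open>k\<close> and \<open>l\<close> differ by \<open>N\<close>, but it is one crossing; so the first way is not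
  counted.
\<close>

definition compat_degree :: "nat \<Rightarrow> nat \<Rightarrow> nat \<Rightarrow> nat \<Rightarrow> int" where
  "compat_degree k l i j = (if congruent_iv i j k l then - 1
     else (if l = k + N then 0
           else of_bool (\<exists>s s'. k + s' * N < i + s * N \<and> i + s * N < l + s' * N \<and> l + s' * N < j + s * N))
        + of_bool (\<exists>s s'. i + s * N < k + s' * N \<and> k + s' * N < j + s * N \<and> j + s * N < l + s' * N))"

lemma N2: "2 \<le> N" using n N by simp

lemma Phi_shift_mult: "i < j \<Longrightarrow> j \<le> i + N \<Longrightarrow> \<Phi> (i + s * N) (j + s * N) = \<Phi> i j"
proof (induction s)
  case (Suc s)
  then show ?case using Phi_shift[of "i + s * N" "j + s * N"] by (simp add: add_ac)
qed simp

lemma shift_trichotomy: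
  fixes s s' :: nat
  shows "s' * N = s * N \<or> s' * N = s * N + N \<or> s * N + 2 * N \<le> s' * N \<or> s' * N + N \<le> s * N"
proof -
  have "s' = s \<or> s' = Suc s \<or> s + 2 \<le> s' \<or> Suc s' \<le> s" by linarith
  then show ?thesis
    using mult_le_mono1[of "s + 2" s' N] mult_le_mono1[of "Suc s'" s N] by (auto simp: algebra_simps)
qed

text \<open>
  The smallest exponents and the negative crossing numbers agree on the triangulation and satisfy
  the same tropical relations.
\<close>

lemma inside_laurent:
  assumes R: "realizes r t S" and I: "indep (snd S) {1..m}"
    and lohi: "\<And>k. k \<in> {1..n} \<Longrightarrow> (k, lo k, hi k) \<in> intervals r t" and ij: "r \<le> i" "i < j" "j \<le> r + N"
  shows "cluster_val n m (snd S) (\<Phi> i j) (\<lambda>k. - crossing (lo k) (hi k) i j)"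
proof -
  let ?x = "snd S" and ?\<phi> = "\<lambda>i j k. - crossing (lo k) (hi k) i j"
  have distinct_labels: "distinct_labels t" and set: "labels t = {1..n}" and X:
      "\<And>k i j. (k, i, j) \<in> intervals r t \<Longrightarrow> ?x k = \<Phi> i j"
    and Q: "\<And>f. f \<in> {n+1..m} \<Longrightarrow> q f = ?x f" using R unfolding realizes_def by auto
  have lvt: "leaves t = N" using realizes_leaves[OF R] .
  have nz: "\<forall>j\<in>{1..m}. ?x j \<noteq> 0" using indep_nonzero[OF I] by blast
  have nm: "k \<in> {1..m}" if "k \<in> {1..n}" for k using that n by auto
  have trop: "max_ptolemy (crossing (lo k) (hi k)) b0 b1 b2 b3" if "k \<in> {1..n}" "b0 < b1" "b1 < b2" "b2 < b3"
      for k b0 b1 b2 b3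
    using that intervals_bounds[OF lohi[OF that(1)]] by (intro crossing_max_ptolemy) auto
  have dn: "crossing (lo k) (hi k) i j = (if k = k' then - 1 else 0)" if "k \<in> {1..n}" "(k', i, j) \<in> intervals r t"
      for k k' i j
    using intervals_crossing[OF distinct_labels lohi[OF that(1)] that(2)] .
  show ?thesis
  proof (rule tree_closure[where t = t and a = r and I = "intervals r t" and Q =
      "\<lambda>i j. cluster_val n m ?x (\<Phi> i j) (?\<phi> i j)"])
    show "cluster_val n m ?x (\<Phi> i (Suc i)) (?\<phi> i (Suc i))" for i
      unfolding Phi_unit using intervals_bounds[OF lohi]
          by (intro cluster_val_cong[OF _ cluster_val_one]) (simp add: crossing_unit)
    show "cluster_val n m ?x (\<Phi> i j) (?\<phi> i j)" if *: "(k, i, j) \<in> intervals r t" for k i j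
    proof -
      have "k \<in> {1..n}" using intervals_bounds[OF *] set by simp
      from cluster_val_cong[OF _ cluster_val_var[OF nm[OF this]], of n "?\<phi> i j" ?x] show ?thesis
        unfolding X[OF *] using dn[OF _ *] by auto
    qed
    fix k b0 b1 b2 b3
    assume b: "r \<le> b0" "b0 < b1" "b1 < b2" "b2 < b3" "b3 \<le> r + N"
      and h: "cluster_val n m ?x (\<Phi> b0 b1) (?\<phi> b0 b1)" "cluster_val n m ?x (\<Phi> b2 b3) (?\<phi> b2 b3)"
          "cluster_val n m ?x (\<Phi> b0 b3) (?\<phi> b0 b3)" "cluster_val n m ?x (\<Phi> b1 b2) (?\<phi> b1 b2)"
    have "b3 \<le> b0 + N" using b by simp
    note ex = R1[OF b(2-4) this]
    have flip: "cluster_val n m ?x (\<Phi> i' j') (?\<phi> i' j')"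
      if *: "(k, i, j) \<in> intervals r t" and eq: "\<Phi> i j * \<Phi> i' j' = \<Phi> b0 b2 * \<Phi> b1 b3"
        and sum: "\<And>k. crossing (lo k) (hi k) i j + crossing (lo k) (hi k) i' j' = crossing (lo k) (hi k) b0 b2
            + crossing (lo k) (hi k) b1 b3"
      for i j i' j'
    proof (rule cluster_val_exchange[OF nz Q _ h])
      show "k \<in> {1..m}" using intervals_bounds[OF *] set nm by simp
      show "?x k * \<Phi> i' j' =
         (\<Prod>f=n+1..m. q f ^ nat (E f b0 b3 + E f b1 b2 - E f b0 b1 - E f b2 b3)) * (\<Phi> b0 b1 * \<Phi> b2 b3)
      + (\<Prod>f=n+1..m. q f ^ nat (- (E f b0 b3 + E f b1 b2 - E f b0 b1 - E f b2 b3))) * (\<Phi> b0 b3 * \<Phi> b1 b2)"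
        unfolding X[OF *] eq by (rule ex)
      fix k' assume k': "k' \<in> {1..n}"
      show "?\<phi> i' j' k' = min (?\<phi> b0 b1 k' + ?\<phi> b2 b3 k') (?\<phi> b0 b3 k' + ?\<phi> b1 b2 k') - (if k' = k then 1 else 0)"
        using trop[OF k' b(2-4)] dn[OF k' *] sum[of k'] unfolding max_ptolemy_def
        by (auto simp: max_def min_def split: if_splits)
    qed
    show "((k, b0, b2) \<in> intervals r t \<longrightarrow> cluster_val n m ?x (\<Phi> b1 b3) (?\<phi> b1 b3)) \<and>
        ((k, b1, b3) \<in> intervals r t \<longrightarrow> cluster_val n m ?x (\<Phi> b0 b2) (?\<phi> b0 b2))"
      using flip[of b0 b2 b1 b3] flip[of b1 b3 b0 b2] by (simp add: mult.commute add.commute)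
  qed (use ij lvt in auto)
qed

text \<open>
  A diagonal that crosses the diameter of the triangulation is expressed by \<open>R2\<close> through four
  diagonals that do not. A diagonal \<open>[lo k, hi k]\<close> of the half polygon is crossed once for each of
  the vertices \<open>p\<close> and \<open>s\<close> that it separates from the diameter.
\<close>

lemma straddle_laurent:
  assumes R: "realizes r t S" and I: "indep (snd S) {1..m}"
    and lohi: "\<And>k. k \<in> {1..n} \<Longrightarrow> (k, lo k, hi k) \<in> intervals r t" and ps: "r < p" "p \<le> s" "s < r + N"
  shows "cluster_val n m (snd S) (\<Phi> s (p + N))
    (\<lambda>k. - (if hi k = lo k + N then 1 else of_bool (lo k < p \<and> p < hi k) + of_bool (lo k < s \<and> s < hi k)))"
proof -
  let ?x = "snd S" and ?\<phi> = "\<lambda>i j k. - crossing (lo k) (hi k) i j"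
  have distinct_labels: "distinct_labels t" and set: "labels t = {1..n}" and X:
      "\<And>k i j. (k, i, j) \<in> intervals r t \<Longrightarrow> ?x k = \<Phi> i j"
    and Q: "\<And>f. f \<in> {n+1..m} \<Longrightarrow> q f = ?x f" using R unfolding realizes_def by auto
  have lvt: "leaves t = N" using realizes_leaves[OF R] .
  have nz: "\<forall>j\<in>{1..m}. ?x j \<noteq> 0" using indep_nonzero[OF I] by blast
  have nm: "k \<in> {1..m}" if "k \<in> {1..n}" for k using that n by auto
  have "t \<noteq> Leaf" using lvt N2 by auto
  then have root_label: "(root_label t, r, r + N) \<in> intervals r t" using intervals_root_label[of t r] lvt by simp
  have topn: "root_label t \<in> {1..n}" using intervals_bounds[OF root_label] set by simp
  note ins = inside_laurent[OF R I lohi]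
  show ?thesis
  proof (rule cluster_val_exchange[OF nz Q])
    show "root_label t \<in> {1..m}" using nm[OF topn] .
    show "?x (root_label t) * \<Phi> s (p + N) = 
        (\<Prod>f=n+1..m. q f ^ nat (E f s (r + N) + E f p (r + N) - E f r s - E f r p - \<kappa> f)) * (\<Phi> r s * \<Phi> r p)
      + (\<Prod>f=n+1..m. q f ^ nat (- (E f s (r + N) + E f p (r + N) - E f r s - E f r p - \<kappa> f)))
          * (\<Phi> s (r + N) * \<Phi> p (r + N))"
      unfolding X[OF root_label] by (rule R2[OF ps])
    show "cluster_val n m ?x (\<Phi> r s) (?\<phi> r s)" "cluster_val n m ?x (\<Phi> r p) (?\<phi> r p)"
      "cluster_val n m ?x (\<Phi> s (r + N)) (?\<phi> s (r + N))" "cluster_val n m ?x (\<Phi> p (r + N)) (?\<phi> p (r + N))"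
      using ps by (auto intro!: ins)
    fix k assume k: "k \<in> {1..n}"
    note b = intervals_bounds[OF lohi[OF k]]
    have root: "hi k = lo k + N \<longleftrightarrow> k = root_label t"
    proof
      assume "hi k = lo k + N"
      then have "lo k = r" "hi k = r + N" using b lvt by auto
      then show "k = root_label t" using intervals_inj[OF distinct_labels lohi[OF k]] root_label by simp
    next
      assume "k = root_label t"
      then show "hi k = lo k + N" using intervals_unique[OF distinct_labels lohi[OF k]] root_label by auto
    qed
    show "- (if hi k = lo k + N then 1 else of_bool (lo k < p \<and> p < hi k) + of_bool (lo k < s \<and> s < hi k))
      = min (?\<phi> r s k + ?\<phi> r p k) (?\<phi> s (r + N) k + ?\<phi> p (r + N) k) - (if k = root_label t then 1 else 0)"
    proof (cases "k = root_label t")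
      case True
      then have "lo k = r" "hi k = r + N" using intervals_unique[OF distinct_labels lohi[OF k]] root_label by auto
      then show ?thesis using True ps by (simp add: crossing_def)
    next
      case False
      then have nr: "hi k \<noteq> lo k + N" using root by simp
      have b': "r \<le> lo k" "lo k + 2 \<le> hi k" "hi k \<le> r + N" using b lvt by auto
      then have "r < lo k \<or> hi k < r + N" using nr by auto
      then show ?thesis using False nr b' ps
        by (auto simp: crossing_def max_def min_def of_bool_def)
    qed
  qed
qed

end

section \<open>Trees with prescribed intervals\<close>

lemma tree_of_size: "1 \<le> k \<Longrightarrow> \<exists>s :: unit btree. leaves s = k"
proof (induction k rule: dec_induct)
  case base
  then show ?case by (intro exI[of _ Leaf]) simp
next
  case (step k)
  then obtain s :: "unit btree" where "leaves s = k" by blast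
  then show ?case by (intro exI[of _ "Node s () Leaf"]) simp
qed

lemma tree_of_size': "a < b \<Longrightarrow> \<exists>s :: unit btree. leaves s = b - a"
  by (simp add: tree_of_size)

text \<open>
  The step by which triangulations are built around prescribed diagonals.
\<close>

lemma extend_tree:
  fixes u :: "unit btree"
  assumes "a \<le> i" "i + leaves u \<le> d"
  shows "\<exists>s :: unit btree. leaves s = d - a \<and> intervals i u \<subseteq> intervals a s"
proof -
  obtain s1 :: "unit btree" where s1: "leaves s1 = i + leaves u - a" "intervals i u \<subseteq> intervals a s1"
  proof (cases "i = a")
    case False
    then obtain L :: "unit btree" where "leaves L = i - a" using tree_of_size'[of a i] assms by auto
    then show thesis using that[of "Node L () u"] assms by auto
  qed (use that[of u] in auto)
  show ?thesis
  proof (cases "i + leaves u = d")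
    case False
    then obtain R :: "unit btree" where "leaves R = d - (i + leaves u)" using tree_of_size'[of "i + leaves u" d] assms
        by auto
    then show ?thesis using s1 assms by (intro exI[of _ "Node s1 () R"]) auto
  qed (use s1 in auto)
qed

lemma tree_with_interval:
  assumes "a \<le> i" "i + 2 \<le> j" "j \<le> d"
  shows "\<exists>s :: unit btree. leaves s = d - a \<and> ((), i, j) \<in> intervals a s"
proof -
  obtain u :: "unit btree" where u: "leaves u = j - i" using tree_of_size'[of i j] assms by auto
  then have "u \<noteq> Leaf" using assms by auto
  then have "((), i, j) \<in> intervals i u" using u assms by (cases u) auto
  then show ?thesis using extend_tree[of a i u d] u assms by fastforce
qed

lemma tree_with_nested:
  assumes "a \<le> i" "i \<le> k" "k + 2 \<le> l" "l \<le> j" "j \<le> d"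
  shows "\<exists>s :: unit btree. leaves s = d - a \<and> ((), i, j) \<in> intervals a s \<and> ((), k, l) \<in> intervals a s"
proof -
  obtain u :: "unit btree" where u: "leaves u = j - i" "((), k, l) \<in> intervals i u"
    using tree_with_interval[of i k l j] assms by auto
  then have "((), i, j) \<in> intervals i u" using assms by (cases u) auto
  then show ?thesis using extend_tree[of a i u d] u assms by fastforce
qed

lemma tree_with_disjoint:
  assumes "a \<le> k" "k + 2 \<le> l" "l \<le> i" "i + 2 \<le> j" "j \<le> d"
  shows "\<exists>s :: unit btree. leaves s = d - a \<and> ((), i, j) \<in> intervals a s \<and> ((), k, l) \<in> intervals a s"
proof -
  obtain s1 :: "unit btree" where s1: "leaves s1 = l - a" "((), k, l) \<in> intervals a s1"
    using tree_with_interval[of a k l l] assms by auto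
  obtain s2 :: "unit btree" where s2: "leaves s2 = d - l" "((), i, j) \<in> intervals l s2"
    using tree_with_interval[of l i j d] assms by auto
  show ?thesis using s1 s2 assms by (intro exI[of _ "Node s1 () s2"]) auto
qed

lemma left_comb_unit_unique: "left_comb s \<Longrightarrow> left_comb s' \<Longrightarrow> leaves s = leaves s' \<Longrightarrow> s = (s' :: unit btree)"
proof (induction s arbitrary: s')
  case Leaf
  show ?case
  proof (cases s')
    case (Node l p r)
    then show ?thesis using Leaf leaves_pos[of l] leaves_pos[of r] by simp
  qed simp
next
  case (Node l p r)
  then show ?case using leaves_pos[of l] by (cases s') auto
qed

lemma rots_leaves: "rots s s' \<Longrightarrow> leaves s' = leaves s"
  by (induction rule: rtranclp_induct) (auto simp: rot_leaves)

lemma rots_unit: "leaves s = leaves s' \<Longrightarrow> rots s (s' :: unit btree)"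
proof -
  assume eq: "leaves s = leaves s'"
  obtain c where c: "rots s c" "left_comb c" using rots_left_comb by blast
  obtain c' where c': "rots s' c'" "left_comb c'" using rots_left_comb by blast
  have "c = c'" using c c' eq rots_leaves left_comb_unit_unique by metis
  then show ?thesis using rtranclp_trans[OF c(1)] rots_sym[OF c'(1)] by blast
qed

section \<open>Compatibility degrees\<close>

context coeff_polygon
begin

definition crossA :: "nat \<Rightarrow> nat \<Rightarrow> nat \<Rightarrow> nat \<Rightarrow> bool" where
  "crossA k l i j \<longleftrightarrow> (\<exists>s s'. k + s' * N < i + s * N \<and> i + s * N < l + s' * N \<and> l + s' * N < j + s * N)"

definition crossB :: "nat \<Rightarrow> nat \<Rightarrow> nat \<Rightarrow> nat \<Rightarrow> bool" where
  "crossB k l i j \<longleftrightarrow> (\<exists>s s'. i + s * N < k + s' * N \<and> k + s' * N < j + s * N \<and> j + s * N < l + s' * N)"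

lemma compat_degree_alt: "compat_degree k l i j = (if congruent_iv i j k l then - 1
     else (if l = k + N then 0 else of_bool (crossA k l i j)) + of_bool (crossB k l i j))"
  unfolding compat_degree_def crossA_def crossB_def by (rule refl)

lemma compat_degree_nonneg: "\<not> congruent_iv i j k l \<Longrightarrow> 0 \<le> compat_degree k l i j"
  by (simp add: compat_degree_alt)

lemma compat_degree_congruent: "congruent_iv i j k l \<Longrightarrow> compat_degree k l i j = - 1"
  by (simp add: compat_degree_alt)

text \<open>
  Compatibility degrees belong to orbits: they do not change if one of the two intervals is
  shifted.
\<close>

lemma shift_both:
  fixes P :: "nat \<Rightarrow> nat \<Rightarrow> nat \<Rightarrow> nat \<Rightarrow> bool"
  assumes "\<And>k l i j. P (k + N) (l + N) (i + N) (j + N) \<longleftrightarrow> P k l i j"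
  shows "(\<exists>s s'. P (k + s' * N) (l + s' * N) (i + a * N + s * N) (j + a * N + s * N)) \<longleftrightarrow>
         (\<exists>s s'. P (k + s' * N) (l + s' * N) (i + s * N) (j + s * N))"
    and "(\<exists>s s'. P (k + a * N + s' * N) (l + a * N + s' * N) (i + s * N) (j + s * N)) \<longleftrightarrow>
         (\<exists>s s'. P (k + s' * N) (l + s' * N) (i + s * N) (j + s * N))"
proof -
  have inv: "P (k + a * N) (l + a * N) (i + a * N) (j + a * N) \<longleftrightarrow> P k l i j" for k l i j a
  proof (induction a)
    case (Suc a)
    then show ?case using assms[of "k + a * N" "l + a * N" "i + a * N" "j + a * N"] by (simp add: add_ac)
  qed simp
  show "(\<exists>s s'. P (k + s' * N) (l + s' * N) (i + a * N + s * N) (j + a * N + s * N)) \<longleftrightarrow>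
         (\<exists>s s'. P (k + s' * N) (l + s' * N) (i + s * N) (j + s * N))"
  proof safe
    fix s s' assume "P (k + s' * N) (l + s' * N) (i + a * N + s * N) (j + a * N + s * N)"
    then have "P (k + s' * N) (l + s' * N) (i + (a + s) * N) (j + (a + s) * N)" by (simp add: algebra_simps)
    then show "\<exists>s s'. P (k + s' * N) (l + s' * N) (i + s * N) (j + s * N)" by blast
  next
    fix s s' assume "P (k + s' * N) (l + s' * N) (i + s * N) (j + s * N)"
    then have "P (k + (s' + a) * N) (l + (s' + a) * N) (i + a * N + s * N) (j + a * N + s * N)"
      using inv[of "k + s' * N" a "l + s' * N" "i + s * N" "j + s * N"] by (simp add: algebra_simps)
    then show "\<exists>s s'. P (k + s' * N) (l + s' * N) (i + a * N + s * N) (j + a * N + s * N)" by blast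
  qed
  show "(\<exists>s s'. P (k + a * N + s' * N) (l + a * N + s' * N) (i + s * N) (j + s * N)) \<longleftrightarrow>
         (\<exists>s s'. P (k + s' * N) (l + s' * N) (i + s * N) (j + s * N))"
  proof safe
    fix s s' assume "P (k + a * N + s' * N) (l + a * N + s' * N) (i + s * N) (j + s * N)"
    then have "P (k + (a + s') * N) (l + (a + s') * N) (i + s * N) (j + s * N)" by (simp add: algebra_simps)
    then show "\<exists>s s'. P (k + s' * N) (l + s' * N) (i + s * N) (j + s * N)" by blast
  next
    fix s s' assume "P (k + s' * N) (l + s' * N) (i + s * N) (j + s * N)"
    then have "P (k + a * N + s' * N) (l + a * N + s' * N) (i + (s + a) * N) (j + (s + a) * N)"
      using inv[of "k + s' * N" a "l + s' * N" "i + s * N" "j + s * N"] by (simp add: algebra_simps)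
    then show "\<exists>s s'. P (k + a * N + s' * N) (l + a * N + s' * N) (i + s * N) (j + s * N)" by blast
  qed
qed

lemma compat_degree_shift:
  "compat_degree k l (i + a * N) (j + a * N) = compat_degree k l i j"
  "compat_degree (k + a * N) (l + a * N) i j = compat_degree k l i j"
proof -
  note 1 = shift_both[of "\<lambda>k l i j. i = k \<and> j = l"] and 2 = shift_both[of "\<lambda>k l i j. k < i \<and> i < l \<and> l < j"]
    and 3 = shift_both[of "\<lambda>k l i j. i < k \<and> k < j \<and> j < l"]
  show "compat_degree k l (i + a * N) (j + a * N) = compat_degree k l i j"
    unfolding compat_degree_def congruent_iv_def using 1(1) 2(1) 3(1) by simp
  show "compat_degree (k + a * N) (l + a * N) i j = compat_degree k l i j"
    unfolding compat_degree_def congruent_iv_def using 1(2) 2(2) 3(2) by simp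
qed

lemma compat_degree_cong_left: "congruent_iv k l k' l' \<Longrightarrow> compat_degree k l i j = compat_degree k' l' i j"
  unfolding congruent_iv_def using compat_degree_shift(2) by metis

lemma Phi_congruent:
  assumes "congruent_iv i j k l" "i < j" "j \<le> i + N" "k < l" "l \<le> k + N"
  shows "\<Phi> i j = \<Phi> k l"
  using assms unfolding congruent_iv_def by (metis Phi_shift_mult)

lemma compat_degree_inside:
  assumes "r \<le> k" "k + 2 \<le> l" "l \<le> r + N" "r \<le> i" "i < j" "j \<le> r + N"
  shows "compat_degree k l i j = crossing k l i j"
proof -
  have A: "crossA k l i j \<longleftrightarrow> k < i \<and> i < l \<and> l < j"
  proof
    assume "crossA k l i j"
    then obtain s s' where *: "k + s' * N < i + s * N" "i + s * N < l + s' * N" "l + s' * N < j + s * N"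
      unfolding crossA_def by blast
    then show "k < i \<and> i < l \<and> l < j" using shift_trichotomy[of s' s] assms N2 by linarith
  next
    assume "k < i \<and> i < l \<and> l < j"
    then show "crossA k l i j" unfolding crossA_def by (intro exI[of _ 0]) simp
  qed
  have B: "crossB k l i j \<longleftrightarrow> i < k \<and> k < j \<and> j < l"
  proof
    assume "crossB k l i j"
    then obtain s s' where *: "i + s * N < k + s' * N" "k + s' * N < j + s * N" "j + s * N < l + s' * N"
      unfolding crossB_def by blast
    then show "i < k \<and> k < j \<and> j < l" using shift_trichotomy[of s' s] assms N2 by linarith
  next
    assume "i < k \<and> k < j \<and> j < l"
    then show "crossB k l i j" unfolding crossB_def by (intro exI[of _ 0]) simp
  qed
  have C: "congruent_iv i j k l \<longleftrightarrow> i = k \<and> j = l"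
  proof
    assume "congruent_iv i j k l"
    then obtain s s' where *: "i + s * N = k + s' * N" "j + s * N = l + s' * N"
      unfolding congruent_iv_def by blast
    then show "i = k \<and> j = l" using shift_trichotomy[of s' s] assms N2 by linarith
  next
    assume "i = k \<and> j = l"
    then show "congruent_iv i j k l" unfolding congruent_iv_def by (intro exI[of _ 0]) simp
  qed
  show ?thesis unfolding compat_degree_alt A B C crossing_def using assms by auto
qed

lemma compat_degree_straddle:
  assumes "r \<le> k" "k + 2 \<le> l" "l \<le> r + N" "r < p" "p \<le> q'" "q' < r + N"
  shows "compat_degree k l q' (p + N) = (if l = k + N then 1 else of_bool (k < p \<and> p < l) + of_bool (k < q'
      \<and> q' < l))"
proof -
  have A: "crossA k l q' (p + N) \<longleftrightarrow> k < q' \<and> q' < l"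
  proof
    assume "crossA k l q' (p + N)"
    then obtain s s' where *: "k + s' * N < q' + s * N" "q' + s * N < l + s' * N"
      unfolding crossA_def by blast
    then show "k < q' \<and> q' < l" using shift_trichotomy[of s' s] assms N2 by linarith
  next
    assume "k < q' \<and> q' < l"
    then show "crossA k l q' (p + N)" unfolding crossA_def using assms by (intro exI[of _ 0]) simp
  qed
  have B: "crossB k l q' (p + N) \<longleftrightarrow> k < p \<and> p < l"
  proof
    assume "crossB k l q' (p + N)"
    then obtain s s' where *: "q' + s * N < k + s' * N" "k + s' * N < p + N + s * N" "p + N + s * N < l + s' * N"
      unfolding crossB_def by blast
    then show "k < p \<and> p < l" using shift_trichotomy[of s' s] assms N2 by linarith
  next
    assume "k < p \<and> p < l"
    then show "crossB k l q' (p + N)" unfolding crossB_def using assms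
      by (intro exI[of _ 0] exI[of _ 1]) simp
  qed
  have C: "\<not> congruent_iv q' (p + N) k l"
  proof
    assume "congruent_iv q' (p + N) k l"
    then obtain s s' where *: "q' + s * N = k + s' * N" "p + N + s * N = l + s' * N"
      unfolding congruent_iv_def by blast
    then show False using shift_trichotomy[of s' s] assms N2 by linarith
  qed
  show ?thesis unfolding compat_degree_alt A B using C assms by auto
qed

text \<open>
  How a diagonal lies relative to the diameter \<open>[r, r + N]\<close> is read off from its representative in
  the window from \<open>r\<close> to \<open>r + N\<close>: it crosses the diameter exactly if this representative leaves
  the window.
\<close>

lemma frame:
  assumes "i < j" "j \<le> i + N"
  obtains i0 j0 a b where "i0 + b * N = i + a * N" "j0 + b * N = j + a * N" "r \<le> i0" "i0 < r + N" "i0 < j0"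
      "j0 \<le> i0 + N"
    "j0 + i = i0 + j"
proof -
  define b where "b = (i + r * N - r) div N"
  define i0 where "i0 = r + (i + r * N - r) mod N"
  have "r \<le> r * N" using N2 by simp
  then have le: "r \<le> i + r * N" by linarith
  have "(i + r * N - r) mod N + (i + r * N - r) div N * N = i + r * N - r" by simp
  then have "i0 + b * N = i + r * N" unfolding i0_def b_def using le by linarith
  moreover have "r \<le> i0" "i0 < r + N" unfolding i0_def using N2 by auto
  ultimately show thesis using assms by (intro that[of i0 b r "i0 + (j - i)"]) auto
qed

lemma laurent_compat_degree:
  assumes R: "realizes r t S" and I: "indep (snd S) {1..m}"
    and lohi: "\<And>k. k \<in> {1..n} \<Longrightarrow> (k, lo k, hi k) \<in> intervals r t" and ij: "i < j" "j \<le> i + N"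
  shows "cluster_val n m (snd S) (\<Phi> i j) (\<lambda>k. - compat_degree (lo k) (hi k) i j)"
proof -
  obtain i0 j0 a b where f: "i0 + b * N = i + a * N" "j0 + b * N = j + a * N" "r \<le> i0" "i0 < r + N" "i0 < j0"
      "j0 \<le> i0 + N"
    by (rule frame[OF ij, of r])
  have Phi: "\<Phi> i j = \<Phi> i0 j0" using Phi_shift_mult[OF ij, of a] Phi_shift_mult[OF f(5,6), of b] f by simp
  have cn: "compat_degree k l i j = compat_degree k l i0 j0" for k l
    using compat_degree_shift(1)[of k l i a j] compat_degree_shift(1)[of k l i0 b j0] f by simp
  have lh: "r \<le> lo k" "lo k + 2 \<le> hi k" "hi k \<le> r + N" if "k \<in> {1..n}" for k
    using intervals_bounds[OF lohi[OF that]] realizes_leaves[OF R] by auto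
  show ?thesis unfolding Phi cn
  proof (cases "j0 \<le> r + N")
    case True
    have "cluster_val n m (snd S) (\<Phi> i0 j0) (\<lambda>k. - crossing (lo k) (hi k) i0 j0)"
      by (rule inside_laurent[OF R I lohi f(3,5) True])
    then show "cluster_val n m (snd S) (\<Phi> i0 j0) (\<lambda>k. - compat_degree (lo k) (hi k) i0 j0)"
      by (rule cluster_val_cong[rotated]) (subst compat_degree_inside[where r = r], use lh True f in auto)
  next
    case False
    \<comment> \<open>The interval crosses the diameter, and its right end is the image of \<open>p\<close> under the half turn.\<close>
    define p where "p = j0 - N"
    have p: "j0 = p + N" "r < p" "p \<le> i0" unfolding p_def using False f by auto
    have "cluster_val n m (snd S) (\<Phi> i0 (p + N))
       (\<lambda>k. - (if hi k = lo k + N then 1 else of_bool (lo k < p \<and> p < hi k) + of_bool (lo k < i0 \<and> i0 < hi k)))"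
      by (rule straddle_laurent[OF R I lohi p(2,3) f(4)])
    then show "cluster_val n m (snd S) (\<Phi> i0 j0) (\<lambda>k. - compat_degree (lo k) (hi k) i0 j0)"
      unfolding p(1) by (rule cluster_val_cong[rotated]) (subst compat_degree_straddle[where r = r], use lh p f in
          auto)
  qed
qed

text \<open>
  Components of denominator vectors are compatibility degrees. The right hand side involves only
  the two intervals and not the rest of the triangulation.
\<close>

lemma den_compat_degree:
  assumes R: "realizes r t S" and I: "indep (snd S) {1..m}"
    and k: "(k, k1, k2) \<in> intervals r t" and ij: "i < j" "j \<le> i + N"
  shows "den n m (snd S) (\<Phi> i j) k = compat_degree k1 k2 i j"
proof -
  have set: "labels t = {1..n}" and distinct_labels: "distinct_labels t" using R unfolding realizes_def by auto
  have "\<forall>k\<in>{1..n}. \<exists>p. (k, fst p, snd p) \<in> intervals r t" using interval_of_label set by fastforce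
  then obtain p where "\<forall>k\<in>{1..n}. (k, fst (p k), snd (p k)) \<in> intervals r t" by (rule bchoice[THEN exE])
  then have lohi: "\<And>k. k \<in> {1..n} \<Longrightarrow> (k, fst (p k), snd (p k)) \<in> intervals r t" by blast
  have kn: "k \<in> {1..n}" using intervals_bounds[OF k] set by simp
  have eq: "fst (p k) = k1" "snd (p k) = k2" using intervals_unique[OF distinct_labels lohi[OF kn] k] by auto
  obtain \<nu> where \<nu>: "has_val (snd S) {1..m} (\<Phi> i j) \<nu>" "\<forall>k\<in>{1..n}. \<nu> k = - compat_degree (fst (p k)) (snd (p k)) i j"
    using laurent_compat_degree[OF R I lohi ij, unfolded cluster_val_def] by blast
  show ?thesis unfolding den_eq_has_val[OF I n(2) \<nu>(1)] using \<nu>(2) kn eq by auto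
qed

text \<open>
  Let \<open>[i0, j0]\<close> be the shift of \<open>[i, j]\<close> that starts in the window from \<open>k\<close> to \<open>k + N\<close>. If it
  ends in this window, then \<open>[k, k + N]\<close> can serve as the diameter: as the intervals do not cross,
  they are disjoint or nested. Otherwise \<open>[i0, j0]\<close> contains \<open>k + N\<close> in its interior and therefore
  the whole interval \<open>[k + N, l + N]\<close>, and \<open>[i0, i0 + N]\<close> can serve as the diameter.
\<close>

lemma compatible_tree:
  assumes "k + 2 \<le> l" "l \<le> k + N" "i + 2 \<le> j" "j \<le> i + N" and c: "compat_degree k l i j = 0"
  shows "\<exists>r (s :: unit btree) k' l' i' j'. leaves s = N \<and> ((), k', l') \<in> intervals r s \<and> ((), i', j') \<in> intervals r s
      \<and>
    congruent_iv k' l' k l \<and> congruent_iv i' j' i j"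
proof -
  have ij: "i < j" using assms by simp
  obtain i0 j0 a b where f: "i0 + b * N = i + a * N" "j0 + b * N = j + a * N" "k \<le> i0" "i0 < k + N" "i0 < j0"
      "j0 \<le> i0 + N"
    "j0 + i = i0 + j"
    by (rule frame[OF ij assms(4), of k])
  have len: "i0 + 2 \<le> j0" using f assms by linarith
  have cg: "congruent_iv i0 j0 i j" unfolding congruent_iv_def using f by blast
  have "compat_degree k l i j = compat_degree k l i0 j0"
    using compat_degree_shift(1)[of k l i a j] compat_degree_shift(1)[of k l i0 b j0] f by simp
  with c have c0: "\<not> congruent_iv i0 j0 k l" "l = k + N \<or> \<not> crossA k l i0 j0" "\<not> crossB k l i0 j0"
    unfolding compat_degree_alt of_bool_def by (auto split: if_splits)
  have refl: "congruent_iv k l k l" "congruent_iv (k + N) (l + N) k l" unfolding congruent_iv_def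
    by (intro exI[of _ 0], simp) (intro exI[of _ 0] exI[of _ 1], simp)
  show ?thesis
  proof (cases "j0 \<le> k + N")
    case True
    have "\<not> (k < i0 \<and> i0 < l \<and> l < j0)"
    proof
      assume *: "k < i0 \<and> i0 < l \<and> l < j0"
      then have "crossA k l i0 j0" unfolding crossA_def by (intro exI[of _ 0]) simp
      with c0 True * show False by auto
    qed
    then consider "l \<le> i0" | "j0 \<le> l" | "i0 = k" "l \<le> j0" using f(3) by linarith
    then obtain s :: "unit btree" where "leaves s = k + N - k" "((), i0, j0) \<in> intervals k s"
        "((), k, l) \<in> intervals k s"
    proof cases
      case 1
      then show thesis using tree_with_disjoint[of k k l i0 j0 "k + N"] that assms True len by auto
    next
      case 2
      then show thesis using tree_with_nested[of k k i0 j0 l "k + N"] that assms True len f by auto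
    next
      case 3
      then show thesis using tree_with_nested[of k i0 k l j0 "k + N"] that assms True len f by auto
    qed
    then have "leaves s = N" "((), i0, j0) \<in> intervals k s" "((), k, l) \<in> intervals k s" by auto
    then show ?thesis using cg refl(1) by blast
  next
    case False
    \<comment> \<open>Otherwise the interval would cross \<open>[k + N, l + N]\<close>.\<close>
    have "l + N \<le> j0"
    proof (rule ccontr)
      assume "\<not> l + N \<le> j0"
      then have "crossB k l i0 j0" unfolding crossB_def using False f
        by (intro exI[of _ 0] exI[of _ 1]) simp
      with c0 show False by simp
    qed
    then obtain s :: "unit btree" where "leaves s = i0 + N - i0" "((), i0, j0) \<in> intervals i0 s"
        "((), k + N, l + N) \<in> intervals i0 s"
      using tree_with_nested[of i0 i0 "k + N" "l + N" j0 "i0 + N"] assms f by auto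
    then have "leaves s = N" "((), i0, j0) \<in> intervals i0 s" "((), k + N, l + N) \<in> intervals i0 s" by auto
    then show ?thesis using cg refl(2) by blast
  qed
qed

end

section \<open>Reachability of all triangulations\<close>

text \<open>
  The set \<open>C\<close> stands for a mutation class, and \<open>t1\<close> for the comb from which \<open>\<Phi>\<close> has been
  constructed.
\<close>

locale polygon_seeds = coeff_polygon n m \<Phi> E \<kappa> q N
  for n m :: nat and \<Phi> :: "nat \<Rightarrow> nat \<Rightarrow> 'f::field_char_0" and E \<kappa> q N +
  fixes C :: "'f seed set" and S1 :: "'f seed" and t1 :: "nat btree"
  assumes closed: "\<lbrakk>S \<in> C; k \<in> {1..n}\<rbrakk> \<Longrightarrow> mutate m k S \<in> C"
    and start: "S1 \<in> C" "realizes 0 t1 S1"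
    and seed_indep: "S \<in> C \<Longrightarrow> indep (snd S) {1..m}"
begin

text \<open>
  The labels are forgotten: they are permuted along closed paths of flips.
\<close>

definition reached :: "nat \<Rightarrow> unit btree \<Rightarrow> bool" where
  "reached r s \<longleftrightarrow> (\<exists>S\<in>C. \<exists>t. realizes r t S \<and> map_btree (\<lambda>_. ()) t = s)"

lemma reached_rotations:
  assumes "rots s s'" "reached r s"
  shows "reached r s'"
  using assms
proof (induction rule: rtranclp_induct)
  case (step y z)
  then obtain S t k where S: "S \<in> C" "realizes r t S" "map_btree (\<lambda>_. ()) t = y" "rot k y z"
    unfolding reached_def by blast
  obtain k' t' where t': "rot k' t t'" "map_btree (\<lambda>_. ()) t' = z"
    using rot_map_lift[of k "\<lambda>_. ()" t z] S by auto
  have "k' \<in> {1..n}" using rot_label[OF t'(1)] S(2) unfolding realizes_def by auto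
  then show ?case
    using closed[OF S(1)] realizes_rot[OF S(2) t'(1)] t' unfolding reached_def by blast
qed

text \<open>
  For a given position of the diameter all trees are connected by rotations. The position moves by
  1 with the flip of the diameter of a tree whose left subtree is a leaf.
\<close>

lemma reached_all: "leaves s = N \<Longrightarrow> reached r s"
proof (induction r arbitrary: s)
  case 0
  have "reached 0 (map_btree (\<lambda>_. ()) t1)" using start unfolding reached_def by blast
  moreover have "rots (map_btree (\<lambda>_. ()) t1) s" using realizes_leaves[OF start(2)] 0 by (intro rots_unit) simp
  ultimately show ?case by (rule reached_rotations[rotated])
next
  case (Suc r)
  obtain s' :: "unit btree" where s': "leaves s' = n" using tree_of_size n by blast
  then have "reached r (Node Leaf () s')" using N by (intro Suc.IH) simp
  then obtain S t where S: "S \<in> C" "realizes r t S" "map_btree (\<lambda>_. ()) t = Node Leaf () s'"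
    unfolding reached_def by blast
  then obtain l k u where t: "t = Node l k u" "map_btree (\<lambda>_. ()) l = Leaf" "map_btree (\<lambda>_. ()) u = s'"
    by (cases t) auto
  then have l: "l = Leaf" by (cases l) auto
  have "k \<in> {1..n}" using S(2) unfolding realizes_def t by auto
  then have "mutate m k S \<in> C" using closed S(1) by blast
  moreover have "realizes (Suc r) (Node u k Leaf) (mutate m k S)"
    using realizes_root_flip[of r l k u S] S(2) unfolding t l by simp
  ultimately have "reached (Suc r) (Node s' () Leaf)" using t unfolding reached_def by fastforce
  moreover have "rots (Node s' () Leaf) s" using Suc.prems s' N by (intro rots_unit) simp
  ultimately show ?case by (rule reached_rotations[rotated])
qed

lemma interval_reached:
  assumes "leaves s = N"
  obtains S t where "S \<in> C" "realizes r t S"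
      "\<forall>i j. ((), i, j) \<in> intervals r s \<longrightarrow> (\<exists>u\<in>{1..n}. (u, i, j) \<in> intervals r t)"
proof -
  obtain S t where S: "S \<in> C" "realizes r t S" "map_btree (\<lambda>_. ()) t = s"
    using reached_all[OF assms] unfolding reached_def by blast
  show thesis
  proof (rule that[OF S(1,2)], intro allI impI)
    fix i j assume "((), i, j) \<in> intervals r s"
    then obtain u where u: "(u, i, j) \<in> intervals r t" unfolding S(3)[symmetric] intervals_map by auto
    then show "\<exists>u\<in>{1..n}. (u, i, j) \<in> intervals r t"
      using intervals_bounds[OF u] S(2) unfolding realizes_def by auto
  qed
qed

text \<open>
  In a seed that contains the first cluster variable, the denominator component at it is \<open>-1\<close> only
  for its own interval.
\<close>

lemma Phi_inj:
  assumes "i + 2 \<le> j" "j \<le> i + N" "i' < j'" "j' \<le> i' + N" "\<Phi> i j = \<Phi> i' j'"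
  shows "congruent_iv i' j' i j"
proof -
  obtain s :: "unit btree" where s: "leaves s = N" "((), i, j) \<in> intervals i s"
    using tree_with_interval[of i i j "i + N"] assms by auto
  obtain S t where S: "S \<in> C" "realizes i t S"
      "\<forall>k l. ((), k, l) \<in> intervals i s \<longrightarrow> (\<exists>u\<in>{1..n}. (u, k, l) \<in> intervals i t)"
    by (rule interval_reached[OF s(1), of i])
  obtain u where u: "(u, i, j) \<in> intervals i t" using S(3) s(2) by blast
  have ij: "i < j" using assms by simp
  have "compat_degree i j i j = compat_degree i j i' j'"
    using den_compat_degree[OF S(2) seed_indep[OF S(1)] u ij assms(2)] den_compat_degree[OF S(2) seed_indep[OF S(1)] u
        assms(3,4)] assms(5) by simp
  moreover have "congruent_iv i j i j" unfolding congruent_iv_def by blast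
  ultimately show ?thesis using compat_degree_congruent compat_degree_nonneg
      by (metis neg_0_le_iff_le not_one_le_zero)
qed

end

section \<open>Diagonal functions from a comb seed\<close>

lemma left_comb_intervals: "left_comb t \<Longrightarrow> (k, i, j) \<in> intervals a t \<Longrightarrow> i = a"
  by (induction t) auto

lemma left_comb_label: "left_comb t \<Longrightarrow> 2 \<le> j \<Longrightarrow> j \<le> leaves t \<Longrightarrow> \<exists>k. (k, a, a + j) \<in> intervals a t"
proof (induction t)
  case (Node l p r)
  show ?case
  proof (cases "j = leaves l + 1")
    case True
    then show ?thesis using Node.prems by auto
  next
    case False
    then show ?thesis using Node by fastforce
  qed
qed simp

text \<open>
  In a fan the shear coordinates are differences of the values of \<open>E\<close> on consecutive edges of the
  polygon, once \<open>E\<close> is normalized to 0 on the intervals that start at the apex 0.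
\<close>

lemma frozen_row_left_comb:
  assumes "left_comb t" "distinct_labels t" "0 \<notin> labels t" "(k, 0, j) \<in> intervals 0 t" and E:
      "\<And>j. 0 < j \<Longrightarrow> j \<le> leaves t \<Longrightarrow> E 0 j = 0"
  shows "frozen_row E c \<kappa> 0 t k = (if j = leaves t then c * E (j - 1) j - \<kappa> else E (j - 1) j - E j (Suc j))"
  using assms
proof (induction t arbitrary: c \<kappa>)
  case (Node l p r)
  have r: "r = Leaf" using Node.prems(1) by simp
  have pos: "0 < leaves l" by simp
  have root_label: "p \<noteq> root_label l" using Node.prems(2,3) root_label_neq[of p l] by auto
  have E0: "E 0 (leaves l) = 0" "E 0 (Suc (leaves l)) = 0" using Node.prems(5) r by auto
  have p0: "p \<noteq> 0" "p \<notin> labels l" using Node.prems by auto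
  from Node.prems(4) consider "k = p" "j = Suc (leaves l)" | "(k, 0, j) \<in> intervals 0 l" unfolding r by auto
  then show ?case
  proof cases
    case 1
    then show ?thesis using E0 root_label p0 unfolding r by (simp add: frozen_row_outside)
  next
    case 2
    note b = intervals_bounds[OF 2]
    have "k \<in> labels l" using b by blast
    then have kp: "k \<noteq> p" "k \<noteq> 0" using Node.prems(2,3) by (metis distinct_labels.simps(2), metis btree.set_intros(1))
    have IH: "frozen_row E 1 0 0 l k = (if j = leaves l then 1 * E (j - 1) j - 0 else E (j - 1) j - E j (Suc j))"
      using Node.prems 2 r by (intro Node.IH) auto
    have "k = root_label l \<longleftrightarrow> j = leaves l"
    proof
      assume "j = leaves l"
      moreover have "(root_label l, 0, leaves l) \<in> intervals 0 l" using intervals_root_label[of l 0] 2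
          by (cases l) auto
      ultimately show "k = root_label l" using intervals_inj[of l k 0 j 0 "root_label l"] 2 Node.prems(2) by auto
    next
      assume "k = root_label l"
      moreover have "(root_label l, 0, leaves l) \<in> intervals 0 l" using intervals_root_label[of l 0] 2
          by (cases l) auto
      ultimately show "j = leaves l" using intervals_unique[of l k 0 j 0 0 "leaves l"] 2 Node.prems(2) by auto
    qed
    then show ?thesis using IH kp E0 b unfolding r by auto
  qed
qed simp

text \<open>
  A seed whose principal part is the matrix of a left comb \<open>t\<close>, placed at 0. The frozen rows are
  arbitrary.
\<close>

locale comb_seed =
  fixes n m :: nat and B :: "nat \<Rightarrow> nat \<Rightarrow> int" and x :: "nat \<Rightarrow> 'f::field_char_0" and t :: "nat btree"
  assumes n: "1 \<le> n" "n \<le> m" and ind: "indep x {1..m}"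
    and comb: "left_comb t" "distinct_labels t" "labels t = {1..n}"
    and tree_matrix: "\<And>i j. i \<in> {1..n} \<Longrightarrow> j \<in> {1..n} \<Longrightarrow> B i j = tree_matrix 2 t i j"
begin

definition "N = Suc n"

text \<open>
  The label of the diagonal \<open>[0, j]\<close> of the fan, and \<open>u j\<close> its cluster variable; \<open>[0, 1]\<close> is an
  edge of the polygon.
\<close>

definition "diag_label j = (SOME k. (k, 0, j) \<in> intervals 0 t)"

definition "u j = (if j = 1 then 1 else x (diag_label j))"

text \<open>
  The values of \<open>E f\<close> on the edges \<open>[j, j + 1]\<close>, and the constant by which \<open>E f\<close> changes under the
  half turn. They are solved for by \<open>frozen_row_left_comb\<close> so that the shear coordinates become
  the given frozen row. Admitting a nonzero constant is necessary: with \<open>\<kappa> = 0\<close> the coordinate at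
  the diameter would always be even.
\<close>

definition "\<epsilon> f j = - (\<Sum>i=2..j. B f (diag_label i))"

definition "\<kappa> f = 2 * \<epsilon> f n - B f (diag_label N)"

definition frozen_mon :: "(nat \<Rightarrow> int) \<Rightarrow> 'f" where "frozen_mon e = (\<Prod>f=n+1..m. x f powi e f)"

text \<open>
  The determinants on the edges \<open>[k, k + 1]\<close>, and the determinant of \<open>R\<close>.
\<close>

definition "w k = frozen_mon (\<lambda>f. - \<epsilon> f k)"

definition "K = frozen_mon (\<lambda>f. - \<kappa> f)"

text \<open>
  The points of the configuration: \<open>v 0 = (1, 0)\<close>, and for \<open>1 \<le> j \<le> N\<close> the vector \<open>v j\<close> is \<open>u j\<close>
  times \<open>(\<zeta> j, 1)\<close>, which gives \<open>X 0 j = u j\<close>; the differences of consecutive \<open>\<zeta> j\<close> are chosen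
  such that \<open>X k (k + 1) = w k\<close>. The matrix \<open>R\<close> maps \<open>v 0\<close> to \<open>v N = (0, u N)\<close>, has determinant
  \<open>K\<close> and trace 0, hence \<open>R\<close> applied twice is multiplication by \<open>- K\<close>.
\<close>

definition "\<zeta> j = (\<Sum>k=j..<N. w k * inverse (u k) * inverse (u (Suc k)))"

definition "R v = (- (K * inverse (u N)) * snd v, u N * fst v)"

definition "v0 i = (if i = 0 then (1, 0) else (\<zeta> i * u i, u i))"

definition "v i = (R ^^ (i div N)) (v0 (i mod N))"

definition "X i j = fst (v i) * snd (v j) - snd (v i) * fst (v j)"

lemma N2: "2 \<le> N" using n by (simp add: N_def)

lemma leaves_t: "leaves t = N"
  using leaves_card[OF comb(2)] comb(3) by (simp add: N_def)

lemma diag_label: "2 \<le> j \<Longrightarrow> j \<le> N \<Longrightarrow> (diag_label j, 0, j) \<in> intervals 0 t"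
  unfolding diag_label_def using left_comb_label[OF comb(1), of j 0] leaves_t by (auto intro: someI)

lemma diag_label_range: "2 \<le> j \<Longrightarrow> j \<le> N \<Longrightarrow> diag_label j \<in> {1..n}"
  using intervals_bounds[OF diag_label] comb(3) by auto

lemma nz: "\<forall>j\<in>{1..m}. x j \<noteq> 0"
  using indep_nonzero[OF ind] by blast

lemma u_nz: "1 \<le> j \<Longrightarrow> j \<le> N \<Longrightarrow> u j \<noteq> 0"
  using diag_label_range[of j] nz n by (cases "j = 1") (auto simp: u_def)

lemma frozen_mon_add: "frozen_mon (\<lambda>f. e f + e' f) = frozen_mon e * frozen_mon e'"
  unfolding frozen_mon_def prod.distrib[symmetric] using nz by (intro prod.cong refl) (auto simp: power_int_add)

lemma frozen_mon_nz: "frozen_mon e \<noteq> 0"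
  unfolding frozen_mon_def using nz by auto

lemma frozen_mon_laurent_monomial: "frozen_mon e = laurent_monomial x (\<Sum>f\<in>{n+1..m}. single f (e f))"
  and keys_frozen_mon: "keys (\<Sum>f\<in>{n+1..m}. single f (e f)) \<subseteq> {n+1..m}"
proof -
  show k: "keys (\<Sum>f\<in>{n+1..m}. single f (e f)) \<subseteq> {n+1..m}"
    by (auto simp: in_keys_iff lookup_sum_single split: if_splits)
  show "frozen_mon e = laurent_monomial x (\<Sum>f\<in>{n+1..m}. single f (e f))"
    unfolding frozen_mon_def by (subst laurent_monomial_superset[OF _ k]) (auto simp: lookup_sum_single)
qed

lemma v_shift: "v (i + N) = R (v i)"
  using N2 by (simp add: v_def)

lemma v_le_N: "1 \<le> i \<Longrightarrow> i \<le> N \<Longrightarrow> v i = (\<zeta> i * u i, u i)"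
proof (cases "i = N")
  case True
  then show ?thesis using v_shift[of 0] N2 by (simp add: v_def v0_def R_def \<zeta>_def)
next
  case False
  assume "1 \<le> i" "i \<le> N"
  then show ?thesis using False by (simp add: v_def v0_def)
qed

lemma v_0: "v 0 = (1, 0)"
  by (simp add: v_def v0_def)

lemma X_shift: "X (i + N) (j + N) = K * X i j"
  using u_nz[of N] N2 unfolding X_def v_shift R_def by (simp add: field_simps)

text \<open>
  This is where the trace of \<open>R\<close> being 0 enters: orbits of diagonals are unordered.
\<close>

lemma X_twist: "X i (j + N) = X j (i + N)"
  unfolding X_def v_shift R_def by (simp add: algebra_simps)

lemma X_plucker: "X a c * X b d = X a b * X c d + X a d * X b c"
  unfolding X_def by (simp add: algebra_simps)

lemma X_shift_mult: "X (i + s * N) (j + s * N) = K ^ s * X i j"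
proof (induction s)
  case (Suc s)
  then show ?case using X_shift[of "i + s * N" "j + s * N"] by (simp add: add_ac)
qed simp

lemma X_0: "1 \<le> j \<Longrightarrow> j \<le> N \<Longrightarrow> X 0 j = u j"
  unfolding X_def v_0 by (simp add: v_le_N)

text \<open>
  The explicit formulas in \<open>X_0\<close>, \<open>X_inside\<close> and \<open>X_straddle\<close> are free of subtractions.
\<close>

lemma X_inside:
  assumes "1 \<le> i" "i < j" "j \<le> N"
  shows "X i j = u i * u j * (\<Sum>k=i..<j. w k * inverse (u k) * inverse (u (Suc k)))"
proof -
  have "\<zeta> i = (\<Sum>k=i..<j. w k * inverse (u k) * inverse (u (Suc k))) + \<zeta> j"
    unfolding \<zeta>_def using assms by (subst sum.atLeastLessThan_concat) auto
  then show ?thesis unfolding X_def using assms by (simp add: v_le_N algebra_simps)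
qed

lemma X_straddle:
  assumes "1 \<le> i" "i < N" "1 \<le> j" "j < N"
  shows "X i (j + N) = u N * \<zeta> i * \<zeta> j * u i * u j + K * inverse (u N) * u i * u j"
  unfolding X_def v_shift R_def using assms by (simp add: v_le_N algebra_simps)

section \<open>Positivity and tropical relations\<close>

abbreviation "hval \<equiv> has_val x {1..m}"

definition "pos z \<longleftrightarrow> (\<exists>\<nu>. hval z \<nu>)"

lemma pos_mult: "pos a \<Longrightarrow> pos b \<Longrightarrow> pos (a * b)"
  unfolding pos_def using has_val_mult[OF _ _ nz] by blast

lemma pos_add: "pos a \<Longrightarrow> pos b \<Longrightarrow> pos (a + b)"
  unfolding pos_def using has_val.add by blast

lemma pos_one: "pos 1"
  unfolding pos_def using has_val_one by blast

lemma hval_frozen_mon: "\<exists>\<nu>. hval (frozen_mon e) \<nu> \<and> (\<forall>f\<in>{n+1..m}. \<nu> f = e f)"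
proof -
  let ?a = "\<Sum>f\<in>{n+1..m}. single f (e f)"
  have "hval (frozen_mon e) (lookup ?a)"
    unfolding frozen_mon_laurent_monomial using keys_frozen_mon[of e] by (intro has_val_laurent_monomial) fastforce
  moreover have "lookup ?a f = e f" if "f \<in> {n+1..m}" for f
    using that by (simp add: lookup_sum_single)
  ultimately show ?thesis by blast
qed

lemma pos_frozen_mon: "pos (frozen_mon e)"
  unfolding pos_def using hval_frozen_mon[of e] by blast

lemma pos_power: "pos z \<Longrightarrow> pos (z ^ k)"
  by (induction k) (auto intro: pos_one pos_mult)

lemma pos_var: "j \<in> {1..m} \<Longrightarrow> pos (x j)" "j \<in> {1..m} \<Longrightarrow> pos (inverse (x j))"
  unfolding pos_def using has_val_var[of j "{1..m}" x] has_val_inverse_var[of j "{1..m}" x] by blast+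

lemma pos_u:
  assumes "1 \<le> j" "j \<le> N"
  shows "pos (u j)" "pos (inverse (u j))"
proof -
  have "j \<noteq> 1 \<Longrightarrow> diag_label j \<in> {1..m}" using diag_label_range[of j] assms n by auto
  then show "pos (u j)" "pos (inverse (u j))"
    using pos_var[of "diag_label j"] pos_one unfolding u_def by (cases "j = 1"; simp)+
qed

lemma pos_sum:
  fixes i j :: nat
  assumes "i < j" "\<And>k. i \<le> k \<Longrightarrow> k < j \<Longrightarrow> pos (g k)"
  shows "pos (\<Sum>k=i..<j. g k)"
  using assms
proof (induction j rule: less_induct)
  case (less j)
  then obtain j' where j: "j = Suc j'" "i \<le> j'" by (cases j) auto
  show ?case
  proof (cases "i = j'")
    case True
    then show ?thesis using less.prems(2)[of i] j by simp
  next
    case False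
    then have "pos (\<Sum>k=i..<j'. g k)" using less.prems j by (intro less.IH) auto
    then show ?thesis using less.prems(2)[of j'] j by (simp add: pos_add)
  qed
qed

lemma pos_X:
  assumes "i < j" "j \<le> i + N"
  shows "pos (X i j)"
proof -
  define i0 where "i0 = i mod N"
  define j0 where "j0 = i0 + (j - i)"
  have i: "i = i0 + (i div N) * N" unfolding i0_def by simp
  have j: "j = j0 + (i div N) * N" unfolding j0_def using assms i by linarith
  have b: "i0 < N" "i0 < j0" "j0 \<le> i0 + N" unfolding i0_def j0_def using N2 assms by auto
  have summand: "pos (w k * inverse (u k) * inverse (u (Suc k)))" if "1 \<le> k" "k < N" for k
    using that unfolding w_def by (intro pos_mult pos_frozen_mon pos_u) auto
  have "pos (X i0 j0)"
  proof (cases "i0 = 0")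
    case True
    then show ?thesis using X_0[of j0] pos_u(1)[of j0] b by simp
  next
    case i0: False
    show ?thesis
    proof (cases "j0 \<le> N")
      case True
      then show ?thesis using X_inside[of i0 j0] i0 b
        by (auto intro!: pos_mult pos_u pos_sum summand)
    next
      case False
      then have j0: "1 \<le> j0 - N" "j0 - N < N" using b by auto
      have "pos (\<zeta> k)" if "1 \<le> k" "k < N" for k
        unfolding \<zeta>_def using that by (intro pos_sum summand) auto
      then show ?thesis using X_straddle[of i0 "j0 - N"] i0 b j0 False N2
        by (auto simp: K_def intro!: pos_add pos_mult pos_u pos_frozen_mon)
    qed
  qed
  then have "pos (K ^ (i div N) * X i0 j0)" unfolding K_def by (intro pos_mult pos_power pos_frozen_mon)
  moreover have "X i j = K ^ (i div N) * X i0 j0"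
    using X_shift_mult[of i0 "i div N" j0] unfolding i[symmetric] j[symmetric] .
  ultimately show ?thesis by simp
qed

definition "val z = (THE \<nu>. hval z \<nu>)"

lemma val_eq: "hval z \<nu> \<Longrightarrow> val z = \<nu>"
  unfolding val_def using has_val_unique[OF ind] by blast

lemma hval_val: "pos z \<Longrightarrow> hval z (val z)"
  unfolding pos_def using val_eq by auto

lemma val_mult: "pos a \<Longrightarrow> pos b \<Longrightarrow> val (a * b) f = val a f + val b f"
  using val_eq[OF has_val_mult[OF hval_val hval_val nz]] by simp

lemma val_add: "pos a \<Longrightarrow> pos b \<Longrightarrow> val (a + b) f = min (val a f) (val b f)"
  using val_eq[OF has_val.add[OF hval_val hval_val]] by simp

lemma val_frozen_mon: "f \<in> {n+1..m} \<Longrightarrow> val (frozen_mon e) f = e f"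
  using hval_frozen_mon[of e] val_eq by auto

text \<open>
  With this choice the smallest exponent of each frozen variable in \<open>\<Phi> i j\<close> is 0.
\<close>

definition "E f i j = - val (X i j) f"

lemma E_shift: "f \<in> {n+1..m} \<Longrightarrow> i < j \<Longrightarrow> j \<le> i + N \<Longrightarrow> E f (i + N) (j + N) = E f i j + \<kappa> f"
  unfolding E_def X_shift K_def by (subst val_mult) (auto simp: pos_frozen_mon pos_X val_frozen_mon)

lemma E_max_ptolemy:
  assumes "a < b" "b < c" "c < d" "d \<le> a + N"
  shows "max_ptolemy (E f) a b c d"
proof -
  have "val (X a c) f + val (X b d) f = min (val (X a b) f + val (X c d) f) (val (X a d) f + val (X b c) f)"
    using arg_cong[OF X_plucker[of a c b d], of "\<lambda>z. val z f"] assms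
    by (simp add: val_mult val_add pos_X pos_mult)
  then show ?thesis unfolding max_ptolemy_def E_def by (simp add: max_def min_def split: if_splits)
qed

lemma X_root:
  assumes "r < p" "p \<le> s" "s < r + N"
  shows "X r (r + N) * X s (p + N) = K * (X r s * X r p) + X s (r + N) * X p (r + N)"
  using X_plucker[of r "r + N" s "p + N"] by (simp add: X_shift X_twist[of r p] mult_ac)

lemma E_root_gen:
  assumes "f \<in> {n+1..m}" "r < p" "p \<le> s" "s < r + N"
  shows "E f r (r + N) + E f s (p + N) = max (E f r s + E f r p + \<kappa> f) (E f s (r + N) + E f p (r + N))"
proof -
  have "val (X r (r + N)) f + val (X s (p + N)) f
      = min (- \<kappa> f + (val (X r s) f + val (X r p) f)) (val (X s (r + N)) f + val (X p (r + N)) f)"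
    using arg_cong[OF X_root[OF assms(2-4)], of "\<lambda>z. val z f"] assms N2 unfolding K_def
    by (simp add: val_mult val_add pos_X pos_mult pos_frozen_mon val_frozen_mon)
  then show ?thesis unfolding E_def by (simp add: max_def min_def split: if_splits)
qed

lemma E_0:
  assumes "f \<in> {n+1..m}" "0 < j" "j \<le> N"
  shows "E f 0 j = 0"
proof (cases "j = 1")
  case True
  then show ?thesis using assms val_eq[OF has_val_one] unfolding E_def by (simp add: X_0 u_def)
next
  case False
  then have l: "diag_label j \<in> {1..n}" "diag_label j \<in> {1..m}" "f \<noteq> diag_label j" using diag_label_range[of j] assms n
      by auto
  then show ?thesis using False assms val_eq[OF has_val_var[OF l(2)]] unfolding E_def by (simp add: X_0 u_def)
qed

lemma X_unit: "1 \<le> k \<Longrightarrow> k < N \<Longrightarrow> X k (Suc k) = w k"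
  using u_nz[of k] u_nz[of "Suc k"] by (simp add: X_inside field_simps)

lemma E_unit: "f \<in> {n+1..m} \<Longrightarrow> 1 \<le> k \<Longrightarrow> k < N \<Longrightarrow> E f k (Suc k) = \<epsilon> f k"
  unfolding E_def by (simp add: X_unit w_def val_frozen_mon)

definition "\<Phi> i j = frozen_mon (\<lambda>f. E f i j) * X i j"

lemma frozen_mon_cong: "(\<And>f. f \<in> {n+1..m} \<Longrightarrow> e f = e' f) \<Longrightarrow> frozen_mon e = frozen_mon e'"
  unfolding frozen_mon_def by (intro prod.cong refl) simp

lemma Phi_shift: "i < j \<Longrightarrow> j \<le> i + N \<Longrightarrow> \<Phi> (i + N) (j + N) = \<Phi> i j"
proof -
  assume ij: "i < j" "j \<le> i + N"
  have "frozen_mon (\<lambda>f. E f (i + N) (j + N)) = frozen_mon (\<lambda>f. E f i j + \<kappa> f)" using E_shift ij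
      by (intro frozen_mon_cong) auto
  also have "\<dots> * K = frozen_mon (\<lambda>f. E f i j)" unfolding K_def frozen_mon_add[symmetric] by simp
  ultimately show ?thesis unfolding \<Phi>_def X_shift by (simp add: mult.assoc[symmetric])
qed

lemma Phi_unit: "\<Phi> i (Suc i) = 1"
proof (induction i rule: less_induct)
  case (less i)
  consider "i = 0" | "1 \<le> i" "i < N" | "N \<le> i" by linarith
  then show ?case
  proof cases
    case 1
    have "frozen_mon (\<lambda>f. E f 0 1) = frozen_mon (\<lambda>_. 0)" using E_0[of _ 1] N2 by (intro frozen_mon_cong) simp
    then show ?thesis using 1 N2 X_0[of 1] by (simp add: \<Phi>_def u_def frozen_mon_def)
  next
    case 2
    have "frozen_mon (\<lambda>f. E f i (Suc i)) = frozen_mon (\<epsilon>' i)" if "\<epsilon>' = (\<lambda>i f. \<epsilon> f i)" for \<epsilon>'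
      using E_unit 2 that by (intro frozen_mon_cong) simp
    then have "\<Phi> i (Suc i) = frozen_mon (\<lambda>f. \<epsilon> f i) * frozen_mon (\<lambda>f. - \<epsilon> f i)" using 2
        by (simp add: \<Phi>_def X_unit w_def)
    also have "\<dots> = 1" unfolding frozen_mon_add[symmetric] by (simp add: frozen_mon_def)
    finally show ?thesis .
  next
    case 3
    then show ?thesis using Phi_shift[of "i - N" "Suc (i - N)"] less[of "i - N"] N2 by (simp add: Suc_diff_le)
  qed
qed

lemma frozen_mon_nat: "(\<Prod>f=n+1..m. x f ^ nat (e f)) = frozen_mon (\<lambda>f. max (e f) 0)"
  unfolding frozen_mon_def by (intro prod.cong refl) (auto simp: max_def power_int_def)

text \<open>
  A Ptolemy relation and its tropical form combine to an exchange relation between elements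
  rescaled by frozen monomials.
\<close>

lemma exchange_coeffs:
  assumes "Y = Z1 + Z2" "\<And>f. f \<in> {n+1..m} \<Longrightarrow> e f = max (a f) (b f)"
  shows "frozen_mon e * Y = (\<Prod>f=n+1..m. x f ^ nat (b f - a f)) * (frozen_mon a * Z1) + (\<Prod>f=n+1..m. x f ^ nat (- (b f
      - a f))) * (frozen_mon b * Z2)"
proof -
  have "frozen_mon e = frozen_mon (\<lambda>f. max (b f - a f) 0 + a f)" using assms(2) by (intro frozen_mon_cong) auto
  moreover have "frozen_mon e = frozen_mon (\<lambda>f. max (- (b f - a f)) 0 + b f)" using assms(2)
      by (intro frozen_mon_cong) auto
  ultimately show ?thesis unfolding assms(1) distrib_left frozen_mon_nat by (simp add: frozen_mon_add mult.assoc)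
qed

sublocale coeff_polygon n m \<Phi> E \<kappa> x N
proof
  show "1 \<le> n" "n \<le> m" "N = Suc n" using n N_def by auto
  show "\<Phi> i j \<noteq> 0" if "i < j" "j \<le> i + N" for i j
    using pos_X[OF that] has_val_nonzero[OF ind] frozen_mon_nz unfolding \<Phi>_def pos_def by auto
  show "\<Phi> (i + N) (j + N) = \<Phi> i j" if "i < j" "j \<le> i + N" for i j using Phi_shift that .
  show "\<Phi> i (Suc i) = 1" for i by (rule Phi_unit)
  show "E f (i + N) (j + N) = E f i j + \<kappa> f" if "f \<in> {n+1..m}" "i < j" "j \<le> i + N" for f i j
    using E_shift that .
  show "max_ptolemy (E f) a b c d" if "f \<in> {n+1..m}" "a < b" "b < c" "c < d" "d \<le> a + N" for f a b c d
    using E_max_ptolemy that by blast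
  show "E f r (r + N) + E f s (s + N) = max (2 * E f r s + \<kappa> f) (2 * E f s (r + N))"
    if "f \<in> {n+1..m}" "r < s" "s < r + N" for f r s
    using E_root_gen[of f r s s] that by simp
  show "\<Phi> a c * \<Phi> b d =
        (\<Prod>f=n+1..m. x f ^ nat (E f a d + E f b c - E f a b - E f c d)) * (\<Phi> a b * \<Phi> c d)
      + (\<Prod>f=n+1..m. x f ^ nat (- (E f a d + E f b c - E f a b - E f c d))) * (\<Phi> a d * \<Phi> b c)"
    if "a < b" "b < c" "c < d" "d \<le> a + N" for a b c d
  proof -
    have pair: "frozen_mon (\<lambda>f. E f i j + E f k l) * (X i j * X k l) = \<Phi> i j * \<Phi> k l" for i j k l
      unfolding \<Phi>_def by (simp add: frozen_mon_add mult_ac)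
    note ex = exchange_coeffs[OF X_plucker[of a c b d], of "\<lambda>f. E f a c + E f b d" "\<lambda>f. E f a b + E f c d"
        "\<lambda>f. E f a d + E f b c"]
    have "E f a c + E f b d = max (E f a b + E f c d) (E f a d + E f b c)" for f
      using E_max_ptolemy[OF that] unfolding max_ptolemy_def .
    from ex[OF this] show ?thesis
      unfolding pair by (simp only: diff_diff_eq)
  qed
  show "\<Phi> r (r + N) * \<Phi> s (p + N) =
        (\<Prod>f=n+1..m. x f ^ nat (E f s (r + N) + E f p (r + N) - E f r s - E f r p - \<kappa> f)) * (\<Phi> r s * \<Phi> r p)
      + (\<Prod>f=n+1..m. x f ^ nat (- (E f s (r + N) + E f p (r + N) - E f r s - E f r p - \<kappa> f)))
          * (\<Phi> s (r + N) * \<Phi> p (r + N))"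
    if "r < p" "p \<le> s" "s < r + N" for r p s
  proof -
    have "frozen_mon (\<lambda>f. E f r s + E f r p + \<kappa> f) * (K * (X r s * X r p)) = \<Phi> r s * \<Phi> r p"
    proof -
      have "frozen_mon (\<lambda>f. (E f r s + E f r p) + \<kappa> f) * K = frozen_mon (\<lambda>f. E f r s + E f r p)"
        unfolding K_def frozen_mon_add[symmetric] by simp
      then show ?thesis unfolding \<Phi>_def by (simp add: frozen_mon_add mult_ac)
    qed
    moreover have "frozen_mon (\<lambda>f. E f s (r + N) + E f p (r + N)) * (X s (r + N) * X p (r + N)) = \<Phi> s (r + N) * \<Phi> p (r
        + N)"
      unfolding \<Phi>_def by (simp add: frozen_mon_add mult_ac)
    moreover have "frozen_mon (\<lambda>f. E f r (r + N) + E f s (p + N)) * (X r (r + N) * X s (p + N)) = \<Phi> r (r + N) * \<Phi> s (p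
        + N)"
      unfolding \<Phi>_def by (simp add: frozen_mon_add mult_ac)
    ultimately show ?thesis
      using exchange_coeffs[OF X_root[OF that], of "\<lambda>f. E f r (r + N) + E f s (p + N)"
          "\<lambda>f. E f r s + E f r p + \<kappa> f" "\<lambda>f. E f s (r + N) + E f p (r + N)"] E_root_gen[OF _ that]
      by (simp add: algebra_simps)
  qed
qed

text \<open>
  The comb seed itself is realized; for the frozen rows this is the choice of \<open>\<epsilon>\<close> and \<open>\<kappa>\<close>.
\<close>

lemma comb_realizes: "realizes 0 t (B, x)"
  unfolding realizes_def
proof (intro conjI ballI allI impI)
  fix i j assume "i \<in> {1..n}" "j \<in> {1..n}"
  then show "fst (B, x) i j = tree_matrix 2 t i j" using tree_matrix by simp
next
  fix f k assume f: "f \<in> {n+1..m}" and k: "k \<in> {1..n}"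
  obtain i j where "(k, i, j) \<in> intervals 0 t" using interval_of_label[of k t 0] k comb by auto
  then have j: "(k, 0, j) \<in> intervals 0 t" using left_comb_intervals[OF comb(1)] by blast
  note b = intervals_bounds[OF j]
  have jl: "2 \<le> j" "j \<le> N" using b leaves_t by auto
  then have kl: "k = diag_label j" using intervals_inj[OF comb(2) j diag_label] by blast
  have "frozen_row (E f) 2 (\<kappa> f) 0 t k = (if j = N then 2 * E f (j - 1) j - \<kappa> f else E f (j - 1) j - E f j (Suc j))"
    using frozen_row_left_comb[OF comb(1,2) _ j, of "E f"] E_0[OF f] comb(3) leaves_t by simp
  also have "\<dots> = B f k"
  proof (cases "j = N")
    case True
    have "E f (j - 1) j = \<epsilon> f n" using E_unit[OF f, of n] True n by (simp add: N_def)
    then show ?thesis using True kl by (simp add: \<kappa>_def)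
  next
    case False
    obtain j' where j': "j = Suc j'" "1 \<le> j'" using jl by (cases j) auto
    have "E f (j - 1) j = \<epsilon> f j'" "E f j (Suc j) = \<epsilon> f j"
      using E_unit[OF f, of j'] E_unit[OF f, of j] jl j' False by auto
    moreover have "\<epsilon> f j' - \<epsilon> f j = B f (diag_label j)" unfolding \<epsilon>_def j' using j' by simp
    ultimately show ?thesis using False kl by simp
  qed
  finally show "fst (B, x) f k = frozen_row (E f) 2 (\<kappa> f) 0 t k" by simp
next
  fix k i j assume *: "(k, i, j) \<in> intervals 0 t"
  then have i: "i = 0" using left_comb_intervals[OF comb(1)] by blast
  note b = intervals_bounds[OF *]
  have jl: "2 \<le> j" "j \<le> N" using b leaves_t i by auto
  then have kl: "k = diag_label j" using intervals_inj[OF comb(2) *] diag_label i by blast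
  have "frozen_mon (\<lambda>f. E f 0 j) = frozen_mon (\<lambda>_. 0)" using E_0 jl by (intro frozen_mon_cong) auto
  then show "snd (B, x) k = \<Phi> i j" using kl jl i by (simp add: \<Phi>_def X_0 u_def frozen_mon_def)
qed (use comb in auto)

end

section \<open>Mutation classes\<close>

lemma mutate_matrix_involutive: "mutate_matrix k (mutate_matrix k B) = B"
  by (intro ext) (auto simp: mutate_matrix_def sgn_if)

text \<open>
  The same symmetrizer works, since the entries \<open>B i k\<close> and \<open>B k i\<close> have opposite signs.
\<close>

lemma skew_symmetrizable_mutate:
  assumes "skew_symmetrizable n B" "k \<in> {1..n}"
  shows "skew_symmetrizable n (mutate_matrix k B)"
proof -
  obtain d where d: "\<And>i. i \<in> {1..n} \<Longrightarrow> 0 < d i"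
    "\<And>i j. i \<in> {1..n} \<Longrightarrow> j \<in> {1..n} \<Longrightarrow> d i * B i j = - (d j * B j i)"
    using assms(1) unfolding skew_symmetrizable_def by blast
  have sg: "sgn (B i j) = - sgn (B j i)" if "i \<in> {1..n}" "j \<in> {1..n}" for i j
  proof -
    have "sgn (d i * B i j) = sgn (- (d j * B j i))" using d(2)[OF that] by simp
    then show ?thesis using d(1) that by (simp add: sgn_mult)
  qed
  have "d i * mutate_matrix k B i j = - (d j * mutate_matrix k B j i)" if ij: "i \<in> {1..n}" "j \<in> {1..n}" for i j
  proof (cases "i = k \<or> j = k")
    case True
    then show ?thesis using d(2)[OF ij] by (auto simp: mutate_matrix_def)
  next
    case False
    note k = assms(2)
    have e: "d i * (sgn (B i k) * max (B i k * B k j) 0) = - (d j * (sgn (B j k) * max (B j k * B k i) 0))"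
    proof (cases "0 < B i k * B k j")
      case True
      have s: "sgn (B k j) = sgn (B i k)" using True by (auto simp: zero_less_mult_iff)
      have sj: "sgn (B j k) = - sgn (B i k)" using sg[OF ij(2) k] s by simp
      have si: "sgn (B k i) = - sgn (B i k)" using sg[OF k ij(1)] by simp
      have "sgn (B j k * B k i) = 1" using True by (simp add: sgn_mult sj si) (auto simp: zero_less_mult_iff)
      then have pos: "0 < B j k * B k i" by (simp add: sgn_1_pos)
      have 1: "d i * (B i k * B k j) = d j * (B j k * B k i)"
      proof -
        have "d i * (B i k * B k j) = (d i * B i k) * B k j" by (simp only: mult.assoc)
        also have "\<dots> = - (B k i * (d k * B k j))" unfolding d(2)[OF ij(1) k] by (simp add: mult_ac)
        also have "\<dots> = d j * (B j k * B k i)" unfolding d(2)[OF k ij(2)] by (simp add: mult_ac)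
        finally show ?thesis .
      qed
      have "d i * (sgn (B i k) * max (B i k * B k j) 0) = sgn (B i k) * (d i * (B i k * B k j))" using True by simp
      also have "\<dots> = - (d j * (sgn (B j k) * max (B j k * B k i) 0))" unfolding 1 sj using pos by simp
      finally show ?thesis .
    next
      case np: False
      have "\<not> 0 < B j k * B k i"
      proof
        assume "0 < B j k * B k i"
        then have "sgn (B j k * B k i) = 1" by simp
        then have "sgn (B i k * B k j) = 1"
          using sg[OF ij(2) k] sg[OF k ij(1)] by (simp add: sgn_mult mult.commute)
        with np show False by (simp add: sgn_1_pos)
      qed
      with np show ?thesis by simp
    qed
    then show ?thesis using False d(2)[OF ij] unfolding mutate_matrix_def by (simp add: distrib_left)
  qed
  then show ?thesis unfolding skew_symmetrizable_def using d(1) by blast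
qed

lemma skew_symmetrizable_diag:
  assumes "skew_symmetrizable n B" "k \<in> {1..n}"
  shows "B k k = 0"
proof -
  obtain d where d: "\<forall>i\<in>{1..n}. (0::int) < d i" "\<forall>i\<in>{1..n}. \<forall>j\<in>{1..n}. d i * B i j = - (d j * B j i)"
    using assms(1) unfolding skew_symmetrizable_def by blast
  then have "d k * B k k = 0" "d k \<noteq> 0" using assms(2) by fastforce+
  then show ?thesis by simp
qed

text \<open>
  Both conditions are inherited along mutations.
\<close>

definition independent_seed :: "nat \<Rightarrow> nat \<Rightarrow> 'f::field_char_0 seed \<Rightarrow> bool" where
  "independent_seed n m S \<longleftrightarrow> skew_symmetrizable n (fst S) \<and> indep (snd S) {1..m}"

lemma exchange_polynomial:
  fixes x :: "nat \<Rightarrow> 'f::field_char_0"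
  assumes "indep x {1..m}" "b k = 0"
  defines "M \<equiv> (\<Prod>i=1..m. x i ^ nat (b i)) + (\<Prod>i=1..m. x i ^ nat (- b i))"
  shows "M \<in> laurent_ring x ({1..m} - {k})" "M \<noteq> 0"
proof -
  have lm: "(\<Prod>i=1..m. x i ^ nat (e i)) = laurent_monomial x (exp_vector m (\<lambda>i. int (nat (e i))))" for e :: "nat \<Rightarrow> int"
    unfolding laurent_monomial_exp_vector by (simp only: power_int_of_nat)
  have keys: "keys (exp_vector m (\<lambda>i. int (nat (e i)))) \<subseteq> {1..m} - {k}" if "e k = 0" for e :: "nat \<Rightarrow> int"
    using that by (auto simp: in_keys_iff lookup_exp_vector split: if_splits)
  show "M \<in> laurent_ring x ({1..m} - {k})"
    unfolding M_def lm[of b] lm[of "\<lambda>i. - b i"] using assms(2)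
    by (intro laurent_ring.add laurent_ring_laurent_monomial keys) auto
  have "has_val x {1..m} (laurent_monomial x (exp_vector m (\<lambda>i. int (nat (e i))))) (lookup (exp_vector m (\<lambda>i. int (nat
      (e i)))))"
    for e :: "nat \<Rightarrow> int" by (intro has_val_laurent_monomial keys_exp_vector)
  from has_val.add[OF this[of b] this[of "\<lambda>i. - b i"]] show "M \<noteq> 0"
    unfolding M_def lm[of b] lm[of "\<lambda>i. - b i"] by (rule has_val_nonzero[OF assms(1)])
qed

text \<open>
  The exchange polynomial does not involve \<open>x k\<close>, because \<open>B k k = 0\<close>, and it is not zero, because
  it is positive. Hence the mutation is an involution.
\<close>

lemma independent_seed_mutate:
  assumes S: "independent_seed n m S" and k: "k \<in> {1..n}" and nm: "n \<le> m"
  shows "independent_seed n m (mutate m k S)" "mutate m k (mutate m k S) = S"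
proof -
  obtain B x where S': "S = (B, x)" by (cases S)
  have I: "indep x {1..m}" and sk: "skew_symmetrizable n B" using S unfolding independent_seed_def S' by auto
  have km: "k \<in> {1..m}" using k nm by auto
  have b: "B k k = 0" using skew_symmetrizable_diag[OF sk k] .
  define M where "M = (\<Prod>i=1..m. x i ^ nat (B i k)) + (\<Prod>i=1..m. x i ^ nat (- B i k))"
  have M: "M \<in> laurent_ring x ({1..m} - {k})" "M \<noteq> 0"
    unfolding M_def using exchange_polynomial[of x m "\<lambda>i. B i k" k, OF I b] by auto
  have xk: "x k \<noteq> 0" using indep_nonzero[OF I km] .
  have mv: "mutate_variables m k B x = x(k := M / x k)"
    unfolding mutate_variables_def M_def by simp
  have ins: "insert k ({1..m} - {k}) = {1..m}" using km by auto
  have "indep (x(k := M / x k)) {1..m}"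
    using indep_replace[of x k "{1..m} - {k}" M] M I unfolding ins by simp
  then show "independent_seed n m (mutate m k S)"
    using skew_symmetrizable_mutate[OF sk k] unfolding independent_seed_def S' by (simp add: mutate_def mv)
  have p: "(\<Prod>i=1..m. (x(k := y)) i ^ nat (e i)) = (\<Prod>i=1..m. x i ^ nat (e i))" if "e k = 0" for e :: "nat \<Rightarrow> int" and y
    using that by (intro prod.cong refl) auto
  have col: "mutate_matrix k B i k = - B i k" for i by (simp add: mutate_matrix_def)
  have "mutate_variables m k (mutate_matrix k B) (x(k := M / x k)) = x"
    unfolding mutate_variables_def col
    using p[of "\<lambda>i. B i k" "M / x k"] p[of "\<lambda>i. - B i k" "M / x k"] b M(2) xk
    by (simp add: M_def[symmetric] add.commute fun_upd_idem_iff del: One_nat_def)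
  then show "mutate m k (mutate m k S) = S"
    unfolding S' by (simp add: mutate_def mv mutate_matrix_involutive)
qed

lemma independent_seed_class: "S \<in> mutation_class n m S0 \<Longrightarrow> independent_seed n m S0 \<Longrightarrow> n \<le> m \<Longrightarrow> independent_seed n m S"
  by (induction rule: mutation_class.induct) (auto intro: independent_seed_mutate(1))

lemma mutation_class_trans:
  "T \<in> mutation_class n m S \<Longrightarrow> S \<in> mutation_class n m R \<Longrightarrow> T \<in> mutation_class n m R"
  by (induction rule: mutation_class.induct) (auto intro: mutation_class.step)

lemma mutation_class_sym:
  assumes "S \<in> mutation_class n m S0" "independent_seed n m S0" "n \<le> m"
  shows "S0 \<in> mutation_class n m S"
  using assms
proof (induction rule: mutation_class.induct)
  case initial
  show ?case by (rule mutation_class.initial)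
next
  case (step S k)
  have g: "independent_seed n m S" using independent_seed_class[OF step(1,4,5)] .
  have "mutate m k (mutate m k S) \<in> mutation_class n m (mutate m k S)"
    using step(2) by (intro mutation_class.step mutation_class.initial)
  then have "S \<in> mutation_class n m (mutate m k S)"
    unfolding independent_seed_mutate(2)[OF g step(2,5)] .
  then show ?case using mutation_class_trans[OF step(3)[OF step(4,5)]] by blast
qed

lemma mutation_class_eq:
  assumes "S \<in> mutation_class n m S0" "independent_seed n m S0" "n \<le> m"
  shows "mutation_class n m S = mutation_class n m S0"
  using mutation_class_trans[OF _ assms(1)] mutation_class_trans[OF _ mutation_class_sym[OF assms]] by blast

section \<open>The tree of a type C seed\<close>

text \<open>
  The path tree on the labels \<open>p 1, \<dots>, p j\<close> with root \<open>p j\<close>. The Cartan matrix fixes the absolute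
  values of the entries; the sign of the entry between consecutive labels decides whether the
  child is on the left or on the right.
\<close>

primrec path_tree :: "(nat \<Rightarrow> nat \<Rightarrow> int) \<Rightarrow> (nat \<Rightarrow> nat) \<Rightarrow> nat \<Rightarrow> nat btree" where
  "path_tree B p 0 = Leaf"
| "path_tree B p (Suc j) = (if 0 < B (p j) (p (Suc j)) then Node (path_tree B p j) (p (Suc j)) Leaf
     else Node Leaf (p (Suc j)) (path_tree B p j))"

lemma set_path_tree: "labels (path_tree B p j) = p ` {1..j}"
proof (induction j)
  case (Suc j)
  have "{1..Suc j} = insert (Suc j) {1..j}" by auto
  then show ?case using Suc by (simp del: atLeastAtMost_iff)
qed simp

lemma distinct_labels_path_tree: "inj p \<Longrightarrow> distinct_labels (path_tree B p j)"
  by (induction j) (auto simp: set_path_tree inj_eq)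

lemma tree_matrix_path_tree:
  assumes "inj p" "p 0 = 0" "a \<in> {1..j}" "b \<in> {1..j}"
  shows "tree_matrix c (path_tree B p j) (p a) (p b) =
    (if b = Suc a then (if 0 < B (p a) (p b) then 1 else - 1) * (if b = j then c else 1)
     else if a = Suc b then (if 0 < B (p b) (p a) then - 1 else 1) else 0)"
  using assms(3,4)
proof (induction j arbitrary: c a b)
  case (Suc j)
  have inj: "p u = p v \<longleftrightarrow> u = v" for u v using inj_eq[OF assms(1)] .
  have p0: "p u = 0 \<longleftrightarrow> u = 0" for u using inj[of u 0] assms(2) by simp
  have root_label: "root_label (path_tree B p j) = p j" using assms(2) by (cases j) auto
  have new: "p (Suc j) \<noteq> 0" "p (Suc j) \<notin> labels (path_tree B p j)"
    by (auto simp: p0 set_path_tree inj)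
  have out: "tree_matrix 1 (path_tree B p j) (p u) (p v) = 0" if "u = Suc j \<or> v = Suc j" for u v
    using that tree_matrix_outside(1)[OF new, of 1 "p v"] tree_matrix_outside(2)[OF new, of 1 "p u"] by auto
  have ab: "a \<noteq> 0" "b \<noteq> 0" using Suc.prems by auto
  have expand: "tree_matrix c (path_tree B p (Suc j)) (p a) (p b) =
      (if 0 < B (p j) (p (Suc j)) then triangle c (p (Suc j)) (p j) 0 (p a) (p b) else triangle c (p (Suc j)) 0 (p j)
          (p a) (p b))
      + tree_matrix 1 (path_tree B p j) (p a) (p b)"
    by (simp add: root_label)
  consider "a = Suc j" | "b = Suc j" "a \<noteq> Suc j" | "a \<in> {1..j}" "b \<in> {1..j}" using Suc.prems by (auto simp: le_Suc_eq)
  then show ?case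
  proof cases
    case 1
    then show ?thesis using out[of a b] ab Suc.prems unfolding expand by (auto simp: triangle_def inj p0)
  next
    case 2
    then show ?thesis using out[of a b] ab Suc.prems unfolding expand by (auto simp: triangle_def inj p0)
  next
    case 3
    then show ?thesis using Suc.IH[OF 3, of 1] ab unfolding expand by (auto simp: triangle_def inj p0)
  qed
qed simp

text \<open>
  Only the principal part of the matrix is compared with the tree: the functions \<open>E\<close> and \<open>\<Phi>\<close> are
  constructed from a seed that is found by means of this relation.
\<close>

definition principal :: "nat \<Rightarrow> 'f seed \<Rightarrow> nat btree \<Rightarrow> bool" where
  "principal n S t \<longleftrightarrow> distinct_labels t \<and> labels t = {1..n} \<and> (\<forall>i\<in>{1..n}. \<forall>j\<in>{1..n}. fst S i j = tree_matrix 2 t i j)"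

lemma type_C_principal:
  assumes skew: "skew_symmetrizable n (fst S)" and p: "p permutes {1..n}"
    and C: "\<And>i j. i \<in> {1..n} \<Longrightarrow> j \<in> {1..n} \<Longrightarrow> cartan_counterpart (fst S) (p i) (p j) = cartan_matrix_C n i j"
  shows "principal n S (path_tree (fst S) p n)"
proof -
  let ?B = "fst S"
  have inj: "inj p" using permutes_inj[OF p] .
  have p0: "p 0 = 0" using p by (simp add: permutes_def)
  have img: "p ` {1..n} = {1..n}" using permutes_image[OF p] .
  obtain d where d: "\<And>i. i \<in> {1..n} \<Longrightarrow> (0::int) < d i"
    "\<And>i j. i \<in> {1..n} \<Longrightarrow> j \<in> {1..n} \<Longrightarrow> d i * ?B i j = - (d j * ?B j i)"
    using skew unfolding skew_symmetrizable_def by blast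
  have sg: "sgn (?B i j) = - sgn (?B j i)" if "i \<in> {1..n}" "j \<in> {1..n}" for i j
  proof -
    have "sgn (d i * ?B i j) = sgn (- (d j * ?B j i))" using d(2)[OF that] by simp
    then show ?thesis using d(1) that by (simp add: sgn_mult)
  qed
  have abs: "\<bar>?B (p a) (p b)\<bar> = - cartan_matrix_C n a b" if "a \<in> {1..n}" "b \<in> {1..n}" "a \<noteq> b" for a b
    using C[OF that(1,2)] that(3) unfolding cartan_counterpart_def by (simp add: inj_eq[OF inj])
  have pin: "p a \<in> {1..n}" if "a \<in> {1..n}" for a using img that by blast
  have "?B (p a) (p b) = tree_matrix 2 (path_tree ?B p n) (p a) (p b)" if ab: "a \<in> {1..n}" "b \<in> {1..n}" for a b
  proof -
    consider "a = b" | "b = Suc a" | "a = Suc b" | "a \<noteq> b" "b \<noteq> Suc a" "a \<noteq> Suc b" by blast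
    then have "?B (p a) (p b) = (if b = Suc a then (if 0 < ?B (p a) (p b) then 1 else - 1) * (if b = n then 2 else 1)
        else if a = Suc b then (if 0 < ?B (p b) (p a) then - 1 else 1) else 0)"
    proof cases
      case 1
      then show ?thesis
        using skew_symmetrizable_diag[OF skew pin[OF ab(1)]] by simp
    next
      case 2
      then show ?thesis
        using abs[OF ab] unfolding cartan_matrix_C_def by (auto simp: abs_if split: if_splits)
    next
      case 3
      then have "\<bar>?B (p a) (p b)\<bar> = 1" using abs[OF ab] ab unfolding cartan_matrix_C_def by auto
      moreover have "0 < ?B (p b) (p a) \<longleftrightarrow> ?B (p a) (p b) < 0"
        using sg[OF pin[OF ab(1)] pin[OF ab(2)]] by (auto simp: sgn_if split: if_splits)
      ultimately show "?B (p a) (p b) = (if b = Suc a then (if 0 < ?B (p a) (p b) then 1 else - 1) * (if b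
          = n then 2 else 1)
        else if a = Suc b then (if 0 < ?B (p b) (p a) then - 1 else 1) else 0)"
        using 3 by (auto simp: abs_if split: if_splits)
    next
      case 4
      then show ?thesis
        using abs[OF ab 4(1)] 4 by (auto simp: cartan_matrix_C_def split: if_splits)
    qed
    then show ?thesis unfolding tree_matrix_path_tree[OF inj p0 ab] .
  qed
  then have "\<forall>i\<in>p ` {1..n}. \<forall>j\<in>p ` {1..n}. ?B i j = tree_matrix 2 (path_tree ?B p n) i j" by blast
  then have "\<forall>i\<in>{1..n}. \<forall>j\<in>{1..n}. ?B i j = tree_matrix 2 (path_tree ?B p n) i j" unfolding img .
  moreover have "labels (path_tree ?B p n) = {1..n}" unfolding set_path_tree img ..
  ultimately show ?thesis unfolding principal_def using distinct_labels_path_tree[OF inj] by blast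
qed

lemma principal_rots:
  assumes "rots t t'" "principal n S t"
  shows "\<exists>S'\<in>mutation_class n m S. principal n S' t'"
  using assms
proof (induction rule: rtranclp_induct)
  case base
  then show ?case using mutation_class.initial by blast
next
  case (step y z)
  then obtain S' k where S': "S' \<in> mutation_class n m S" "principal n S' y" and k: "rot k y z" by blast
  have distinct_labels: "distinct_labels y" "labels y = {1..n}" and B:
      "\<And>i j. i \<in> {1..n} \<Longrightarrow> j \<in> {1..n} \<Longrightarrow> fst S' i j = tree_matrix 2 y i j"
    using S'(2) unfolding principal_def by blast+
  have kn: "k \<in> {1..n}" using rot_label[OF k distinct_labels(1)] distinct_labels by simp
  have "fst (mutate m k S') i j = tree_matrix 2 z i j" if ij: "i \<in> {1..n}" "j \<in> {1..n}" for i j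
  proof -
    have "mutate_matrix k (fst S') i j = mutate_matrix k (tree_matrix 2 y) i j"
      using ij kn B by (simp add: mutate_matrix_def)
    also have "\<dots> = tree_matrix 2 z i j" using ij distinct_labels by (intro tree_matrix_rot[OF k]) auto
    finally show ?thesis by (simp add: mutate_def)
  qed
  then have "principal n (mutate m k S') z"
    using rot_distinct_labels[OF k distinct_labels(1)] rot_set[OF k] distinct_labels(2) unfolding principal_def
        by simp
  then show ?case using mutation_class.step[OF S'(1) kn] by blast
qed

section \<open>Denominator vectors in type C\<close>

context polygon_seeds
begin

lemma all_realized:
  assumes "S \<in> mutation_class n m S1"
  shows "\<exists>r t. realizes r t S"
  using assms
proof (induction rule: mutation_class.induct)
  case initial
  then show ?case using start(2) by blast
next
  case (step S k)
  then obtain r t where R: "realizes r t S" by blast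
  then have set: "labels t = {1..n}" unfolding realizes_def by blast
  show ?case
  proof (cases "k = root_label t")
    case False
    then obtain t' where "rot k t t'" using rot_exists[of k t] step(2) set by blast
    then show ?thesis using realizes_rot[OF R] by blast
  next
    case True
    then obtain l u where "t = Node l k u" using set step(2) by (cases t) auto
    then show ?thesis using realizes_root_flip R by blast
  qed
qed

lemma cluster_variable_interval:
  assumes "realizes r t S" "k \<in> {1..n}"
  obtains i j where "(k, i, j) \<in> intervals r t" "snd S k = \<Phi> i j" "i + 2 \<le> j" "j \<le> i + N"
proof -
  have "labels t = {1..n}" using assms(1) unfolding realizes_def by blast
  then obtain i j where ij: "(k, i, j) \<in> intervals r t" using interval_of_label[of k t r] assms(2) by auto
  have "i + 2 \<le> j" "j \<le> i + N" using intervals_bounds[OF ij] realizes_leaves[OF assms(1)] by auto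
  moreover have "snd S k = \<Phi> i j" using assms(1) ij unfolding realizes_def by blast
  ultimately show thesis using that ij by blast
qed

text \<open>
  Translation of the statements on compatibility degrees into statements on cluster variables: by
  \<open>Phi_congruent\<close> and \<open>Phi_inj\<close> equal cluster variables are the same as intervals that agree up to
  a shift.
\<close>

lemma polygon_denominators:
  assumes C: "C = mutation_class n m S1" and S: "S \<in> C"
    and z: "z \<in> \<Union> (cluster n ` C)" "z \<notin> cluster n S"
  shows "\<forall>i\<in>{1..n}. 0 \<le> den n m (snd S) z i"
    and "\<forall>i\<in>{1..n}. den n m (snd S) z i = 0 \<longleftrightarrow> (\<exists>X\<in>cluster n ` C. z \<in> X \<and> snd S i \<in> X)"
    and "\<forall>i\<in>{1..n}. \<forall>S'\<in>C. \<forall>j\<in>{1..n}. snd S' j = snd S i \<longrightarrow> den n m (snd S') z j = den n m (snd S) z i"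
proof -
  obtain r t where R: "realizes r t S" using all_realized S unfolding C by blast
  obtain Sz rz tz kz where Sz: "realizes rz tz Sz" "kz \<in> {1..n}" "z = snd Sz kz"
    using z(1) all_realized unfolding C cluster_def by fastforce
  obtain i j where "(kz, i, j) \<in> intervals rz tz" and zij: "snd Sz kz = \<Phi> i j" and ij: "i + 2 \<le> j" "j \<le> i + N"
    by (rule cluster_variable_interval[OF Sz(1,2)])
  have zP: "z = \<Phi> i j" using Sz(3) zij by simp
  have ij': "i < j" using ij by simp
  have den: "den n m (snd S') z k = compat_degree k1 k2 i j"
      if "S' \<in> C" "realizes r' t' S'" "(k, k1, k2) \<in> intervals r' t'" for S' r' t' k k1 k2
    unfolding zP by (rule den_compat_degree[OF that(2) seed_indep[OF that(1)] that(3) ij' ij(2)])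
  show "\<forall>i\<in>{1..n}. 0 \<le> den n m (snd S) z i"
  proof
    fix k assume k: "k \<in> {1..n}"
    obtain k1 k2 where K: "(k, k1, k2) \<in> intervals r t" "snd S k = \<Phi> k1 k2" "k1 + 2 \<le> k2" "k2 \<le> k1 + N"
      by (rule cluster_variable_interval[OF R k])
    have "\<not> congruent_iv i j k1 k2"
    proof
      assume "congruent_iv i j k1 k2"
      then have "z = snd S k" unfolding zP K(2) using ij K by (intro Phi_congruent) auto
      then show False using z(2) k unfolding cluster_def by blast
    qed
    then show "0 \<le> den n m (snd S) z k" unfolding den[OF S R K(1)] by (rule compat_degree_nonneg)
  qed
  show "\<forall>i\<in>{1..n}. den n m (snd S) z i = 0 \<longleftrightarrow> (\<exists>X\<in>cluster n ` C. z \<in> X \<and> snd S i \<in> X)"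
  proof
    fix k assume k: "k \<in> {1..n}"
    obtain k1 k2 where K: "(k, k1, k2) \<in> intervals r t" "snd S k = \<Phi> k1 k2" "k1 + 2 \<le> k2" "k2 \<le> k1 + N"
      by (rule cluster_variable_interval[OF R k])
    show "den n m (snd S) z k = 0 \<longleftrightarrow> (\<exists>X\<in>cluster n ` C. z \<in> X \<and> snd S k \<in> X)"
    proof
      assume "den n m (snd S) z k = 0"
      then have "compat_degree k1 k2 i j = 0" unfolding den[OF S R K(1)] .
      then obtain r' k' l' i' j' and s :: "unit btree" where
        s: "leaves s = N" "((), k', l') \<in> intervals r' s" "((), i', j') \<in> intervals r' s"
          "congruent_iv k' l' k1 k2" "congruent_iv i' j' i j"
        using compatible_tree[OF K(3,4) ij] by blast
      obtain S' t' where S': "S' \<in> C" "realizes r' t' S'"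
          "\<forall>i j. ((), i, j) \<in> intervals r' s \<longrightarrow> (\<exists>u\<in>{1..n}. (u, i, j) \<in> intervals r' t')"
        by (rule interval_reached[OF s(1), of r'])
      have in_cl: "\<Phi> a b \<in> cluster n S'" if "((), a, b) \<in> intervals r' s" for a b
        using S'(2,3) that unfolding realizes_def cluster_def by (metis image_eqI)
      have "z = \<Phi> i' j'" unfolding zP
        using intervals_bounds[OF s(3)] s(1) ij by (intro Phi_congruent[OF s(5), symmetric]) auto
      moreover have "snd S k = \<Phi> k' l'" unfolding K(2)
        using intervals_bounds[OF s(2)] s(1) K(3,4) by (intro Phi_congruent[OF s(4), symmetric]) auto
      ultimately show "\<exists>X\<in>cluster n ` C. z \<in> X \<and> snd S k \<in> X" using in_cl s(2,3) S'(1) by auto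
    next
      assume "\<exists>X\<in>cluster n ` C. z \<in> X \<and> snd S k \<in> X"
      then obtain S' a b where S': "S' \<in> C" and ab: "a \<in> {1..n}" "b \<in> {1..n}" "z = snd S' a" "snd S k = snd S' b"
        unfolding cluster_def by auto
      have "z \<noteq> snd S k" using z(2) k unfolding cluster_def by blast
      then have ne: "a \<noteq> b" using ab by auto
      obtain r' t' where R': "realizes r' t' S'" using all_realized S' unfolding C by blast
      obtain b1 b2 where b: "(b, b1, b2) \<in> intervals r' t'" "snd S' b = \<Phi> b1 b2" "b1 + 2 \<le> b2" "b2 \<le> b1 + N"
        by (rule cluster_variable_interval[OF R' ab(2)])
      have "congruent_iv b1 b2 k1 k2" using K b ab(4) by (intro Phi_inj) auto
      then have "compat_degree k1 k2 i j = compat_degree b1 b2 i j" using compat_degree_cong_left by simp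
      also have "\<dots> = den n m (snd S') (snd S' a) b" using den[OF S' R' b(1)] ab(3) by simp
      also have "\<dots> = 0"
      proof -
        have "a \<in> {1..m}" using ab(1) n by auto
        from den_eq_has_val[OF seed_indep[OF S'] n(2) has_val_var[OF this]] show ?thesis
          using ne by simp
      qed
      finally show "den n m (snd S) z k = 0" unfolding den[OF S R K(1)] .
    qed
  qed
  show "\<forall>i\<in>{1..n}. \<forall>S'\<in>C. \<forall>j\<in>{1..n}. snd S' j = snd S i \<longrightarrow> den n m (snd S') z j = den n m (snd S) z i"
  proof (intro ballI impI)
    fix k S' b assume k: "k \<in> {1..n}" and S': "S' \<in> C" and b: "b \<in> {1..n}" "snd S' b = snd S k"
    obtain k1 k2 where K: "(k, k1, k2) \<in> intervals r t" "snd S k = \<Phi> k1 k2" "k1 + 2 \<le> k2" "k2 \<le> k1 + N"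
      by (rule cluster_variable_interval[OF R k])
    obtain r' t' where R': "realizes r' t' S'" using all_realized S' unfolding C by blast
    obtain b1 b2 where B: "(b, b1, b2) \<in> intervals r' t'" "snd S' b = \<Phi> b1 b2" "b1 + 2 \<le> b2" "b2 \<le> b1 + N"
      by (rule cluster_variable_interval[OF R' b(1)])
    have "congruent_iv b1 b2 k1 k2" using K B b(2) by (intro Phi_inj) auto
    then show "den n m (snd S') z b = den n m (snd S) z k"
      unfolding den[OF S R K(1)] den[OF S' R' B(1)] by (rule compat_degree_cong_left)
  qed
qed

end

theorem theorem4p5:
  fixes n m :: nat
    and B :: "nat \<Rightarrow> nat \<Rightarrow> int"
    and x :: "nat \<Rightarrow> 'f::field_char_0"
    and z :: 'f
  assumes "1 \<le> n" and "n \<le> m"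
    and "is_seed n m (B, x)"
    and "is_type_C n m (B, x)"
    and "z \<in> cluster_variables n m (B, x)"
    and "z \<notin> cluster n (B, x)"
  shows "(\<forall>i\<in>{1..n}. 0 \<le> den n m x z i) \<and>
    (\<forall>i\<in>{1..n}. den n m x z i = 0 \<longleftrightarrow> (\<exists>X\<in>clusters n m (B, x). z \<in> X \<and> x i \<in> X)) \<and>
    (\<forall>i\<in>{1..n}. \<forall>(B', x')\<in>mutation_class n m (B, x). \<forall>j\<in>{1..n}.
       x' j = x i \<longrightarrow> den n m x' z j = den n m x z i)"
proof -
  let ?S = "(B, x)"
  have good: "independent_seed n m ?S"
    using assms(2,3) free_generating_indep[of n m x] unfolding independent_seed_def is_seed_def by simp
  obtain SC p where SC: "SC \<in> mutation_class n m ?S" and p: "p permutes {1..n}"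
    and Cartan: "\<forall>i\<in>{1..n}. \<forall>j\<in>{1..n}. cartan_counterpart (fst SC) (p i) (p j) = cartan_matrix_C n i j"
    using assms(4) unfolding is_type_C_def by blast
  have goodC: "independent_seed n m SC" using independent_seed_class[OF SC good assms(2)] .
  have "principal n SC (path_tree (fst SC) p n)"
    using goodC p Cartan unfolding independent_seed_def by (intro type_C_principal) auto
  moreover obtain t1 where t1: "rots (path_tree (fst SC) p n) t1" "left_comb t1" using rots_left_comb by blast
  ultimately obtain S1 where S1: "S1 \<in> mutation_class n m SC" "principal n S1 t1"
    using principal_rots[where m = m] by blast
  have S1': "S1 \<in> mutation_class n m ?S" using mutation_class_trans[OF S1(1) SC] .
  have good1: "independent_seed n m S1" using independent_seed_class[OF S1' good assms(2)] .
  have eq: "mutation_class n m S1 = mutation_class n m ?S" using mutation_class_eq[OF S1' good assms(2)] .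
  interpret comb: comb_seed n m "fst S1" "snd S1" t1
    using assms(1,2) good1 S1(2) t1(2) unfolding independent_seed_def principal_def by unfold_locales auto
  interpret polygon_seeds n m comb.\<Phi> comb.E comb.\<kappa> "snd S1" comb.N "mutation_class n m S1" S1 t1
  proof
    show "mutate m k S \<in> mutation_class n m S1" if "S \<in> mutation_class n m S1" "k \<in> {1..n}" for S k
      using that by (rule mutation_class.step)
    show "S1 \<in> mutation_class n m S1" by (rule mutation_class.initial)
    show "comb.realizes 0 t1 S1" using comb.comb_realizes by simp
    show "indep (snd S) {1..m}" if "S \<in> mutation_class n m S1" for S
      using independent_seed_class[OF that good1 assms(2)] unfolding independent_seed_def by blast
  qed
  have S: "?S \<in> mutation_class n m S1" unfolding eq by (rule mutation_class.initial)
  have z: "z \<in> \<Union> (cluster n ` mutation_class n m S1)"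
    using assms(5) unfolding cluster_variables_def clusters_def eq .
  note all_parts = polygon_denominators[OF refl S z assms(6), unfolded eq, folded clusters_def]
  show ?thesis
    using all_parts by (intro conjI) (auto simp: split_beta)
qed

end
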